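(* Let $F$ be a field whose characteristic is not $2$, and let $r,s,n$ be positive integers. If a sums-of-squares formula of type $[r,s,n]$ exists over $F$, then $2^{\lfloor \frac{s-1}{2} \rfloor -i+1}$ divides the binomial coefficient $\binom{n}{i}$ for every integer $i$ with $n-r < i \leq \lfloor \frac{s-1}{2} \rfloor$.
   Context: A sums-of-squares formula of type $[r,s,n]$ over a field $F$ is an identity $$(x_1^2+\cdots+x_r^2)(y_1^2+\cdots+y_s^2)=z_1^2+\cdots+z_n^2$$ in the polynomial ring $F[x_1,\ldots,x_r,y_1,\ldots,y_s]$, where each $z_j$ is a bilinear expression in the $x$'s and $y$'s, i.e. $z_j=\sum_{a,b} c^{(j)}_{ab}\,x_a y_b$ with coefficients $c^{(j)}_{ab}\in F$. *)

theory Defs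
  imports "HOL-Library.Poly_Mapping"
begin

text \<open>
  Monomials in indeterminates \<open>x\<^sub>a\<close> (written \<open>Inl a\<close>) and \<open>y\<^sub>b\<close> (written \<open>Inr b\<close>) are finitely
  supported exponent functions, and polynomials are finitely supported coefficient functions on
  monomials, multiplied by convolution. All indices \<open>a, b\<close> in \<open>nat\<close> are allowed, so
  \<open>F[x\<^sub>1, \<dots>, x\<^sub>r, y\<^sub>1, \<dots>, y\<^sub>s]\<close> is the subring of polynomials in the first \<open>r\<close> and \<open>s\<close> of them.
\<close>
type_synonym 'a xy_poly = "((nat + nat) \<Rightarrow>\<^sub>0 nat) \<Rightarrow>\<^sub>0 'a"

definition const_poly :: "'a::field \<Rightarrow> 'a xy_poly"
  where "const_poly c = Poly_Mapping.single 0 c"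

definition var_x :: "nat \<Rightarrow> 'a::field xy_poly"
  where "var_x a = Poly_Mapping.single (Poly_Mapping.single (Inl a) 1) 1"

definition var_y :: "nat \<Rightarrow> 'a::field xy_poly"
  where "var_y b = Poly_Mapping.single (Poly_Mapping.single (Inr b) 1) 1"

definition bilinear_expr :: "nat \<Rightarrow> nat \<Rightarrow> (nat \<Rightarrow> nat \<Rightarrow> 'a::field) \<Rightarrow> 'a xy_poly"
  where "bilinear_expr r s c = (\<Sum>a = 1..r. \<Sum>b = 1..s. const_poly (c a b) * var_x a * var_y b)"

text \<open>
  The family \<open>c\<close> determines \<open>z\<^sub>j\<close> as the bilinear expression with coefficients \<open>c j a b\<close>; values of
  \<open>c\<close> at indices outside \<open>{1..n}\<close>, \<open>{1..r}\<close>, \<open>{1..s}\<close> play no role.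
\<close>
definition sums_of_squares_formula ::
  "nat \<Rightarrow> nat \<Rightarrow> nat \<Rightarrow> (nat \<Rightarrow> nat \<Rightarrow> nat \<Rightarrow> 'a::field) \<Rightarrow> bool"
  where "sums_of_squares_formula r s n c \<longleftrightarrow>
    (\<Sum>a = 1..r. (var_x a)\<^sup>2) * (\<Sum>b = 1..s. (var_y b)\<^sup>2)
      = (\<Sum>j = 1..n. (bilinear_expr r s (c j))\<^sup>2)"

end

theory Submission
  imports Defs "HOL-Library.Function_Algebras" "HOL-Algebra.Algebraic_Closure_Type"
begin

text \<open>
  Let \<open>R = F[y\<^sub>1, \<dots>, y\<^sub>s]\<close> and \<open>q = y\<^sub>1\<^sup>2 + \<dots> + y\<^sub>s\<^sup>2\<close>. Read as an identity between quadratic forms in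
  the \<open>x\<close> variables, a formula of type \<open>[r, s, n]\<close> is a family of vectors \<open>A\<^sub>1, \<dots>, A\<^sub>r\<close> in \<open>R\<^sup>n\<close> whose
  entries are linear forms, such that the product of \<open>A\<^sub>a\<close> and \<open>A\<^sub>b\<close> is \<open>q\<close> if \<open>a = b\<close> and \<open>0\<close> otherwise.
  For a given \<open>i\<close> only \<open>n - i + 1 \<le> r\<close> of these vectors are kept; \<open>r\<close> denotes this number from now on.

  The vectors define a Koszul complex on the direct sum over \<open>j\<close> of the modules
  \<open>D\<^sup>j(R\<^sup>r) \<otimes> \<Lambda>\<^sup>i\<^sup>-\<^sup>j(R\<^sup>n)\<close>, where \<open>D\<^sup>j\<close> is a divided power. The differential lowers the divided power in
  the \<open>a\<close>-th direction and multiplies by \<open>A\<^sub>a\<close> in the exterior algebra. Since \<open>r + i > n\<close>, the complex is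
  exact after inverting \<open>q\<close>: explicit homotopies show that \<open>q\<^sup>r\<close> kills its homology (\<open>koszul.torsion\<close>).
  Its rank is the sum over \<open>j\<close> of \<open>((r + j - 1) choose j) * (n choose (i - j))\<close>, which is
  \<open>2\<^sup>i * (n choose i)\<close> for \<open>r = n - i + 1\<close>. So it suffices that the rank of a free graded \<open>R\<close>-module with
  a linear differential, whose homology is killed by a power of \<open>q\<close>, is divisible by \<open>2\<^sup>c\<close> with
  \<open>c = \<lfloor>(s + 1) / 2\<rfloor>\<close>.

  Such a divisibility reflects the \<open>K\<close>-theory of the complement of the quadric \<open>q = 0\<close>. Here it comes
  from Dirac operators. Tensor everything with the exterior algebra on \<open>s\<close> generators. It carries
  anticommuting involutions \<open>c\<^sub>1, \<dots>, c\<^sub>s\<close>, and a second family \<open>g\<^sub>0, \<dots>, g\<^sub>s\<close> of anticommuting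
  involutions; \<open>g\<^sub>s\<close> is the sign of the exterior degree and anticommutes with every \<open>c\<^sub>b\<close>, and the other
  \<open>g\<^sub>j\<close> commute with every \<open>c\<^sub>b\<close>. The operator \<open>D = y\<^sub>1 c\<^sub>1 + \<dots> + y\<^sub>s c\<^sub>s\<close> satisfies \<open>D\<^sup>2 = q\<close> and
  \<open>D c\<^sub>b + c\<^sub>b D = 2 y\<^sub>b\<close>. Let \<open>U' \<subseteq> U\<close> be graded modules stable under all these operators, with
  \<open>q U \<subseteq> U'\<close>. Then \<open>D\<close> is a differential on \<open>U / U'\<close>. On its homology every \<open>y\<^sub>b\<close> is zero, because
  \<open>D c\<^sub>b + c\<^sub>b D = 2 y\<^sub>b\<close>; being finitely generated, the homology is finite-dimensional. The \<open>g\<^sub>j\<close> act on it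
  as well, so the dimension of each of its graded pieces is divisible by \<open>2\<^sup>c\<close> (\<open>clifford_dim_dvd\<close>).
  Hence the alternating sum of the dimensions of the graded pieces of \<open>U / U'\<close> is divisible by \<open>2\<^sup>c\<close>.

  For a module that is not finite-dimensional the alternating sum is read as the value at \<open>-1\<close> of the
  Hilbert series. Multiplied by \<open>2\<^sup>s\<close> it is an integer, determined by finitely many values of the Hilbert
  function (\<open>reg_sum\<close>), because Hilbert functions are eventually polynomial of degree less than \<open>s\<close>
  (\<open>hilbert_function\<close>). In these terms the values of \<open>U\<close> and \<open>U'\<close> are congruent modulo \<open>2\<^sup>s\<^sup>+\<^sup>c\<close>
  (\<open>dirac_congruence\<close>). A chain of such congruences leads from the cycles of the Koszul complex, tensored
  with the exterior algebra, to its boundaries. So the value of the whole complex is divisible by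
  \<open>2\<^sup>s\<^sup>+\<^sup>c\<close>. That value is \<open>2\<^sup>s\<close> times the rank of the Koszul complex, the factor being the dimension of the
  exterior algebra, and the theorem follows.

  The base field is replaced by its algebraic closure at the start, because the argument for
  \<open>clifford_dim_dvd\<close> needs a square root of \<open>-1\<close>.
\<close>

section \<open>Dimensions of finite-dimensional subspaces\<close>

definition set_sum :: "'b::plus set \<Rightarrow> 'b set \<Rightarrow> 'b set"
  where "set_sum A B = {a + b | a b. a \<in> A \<and> b \<in> B}"

text \<open>
  A locale of its own makes \<open>span\<close>, \<open>dim\<close> and the like refer to the scalar multiplication at hand rather
  than to that of the real vector spaces.
\<close>
locale vspace = vector_space scale
  for scale :: "'a::field \<Rightarrow> 'b::ab_group_add \<Rightarrow> 'b"  (infixr \<open>*s\<close> 75)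
begin

abbreviation linear_op :: "('b \<Rightarrow> 'b) \<Rightarrow> bool"
  where "linear_op \<equiv> Vector_Spaces.linear scale scale"

lemma linear_opI:
  assumes "\<And>x y. f (x + y) = f x + f y" "\<And>c x. f (c *s x) = c *s f x"
  shows "linear_op f"
  by unfold_locales (use assms in auto)

definition fin_dim :: "'b set \<Rightarrow> bool"
  where "fin_dim S \<longleftrightarrow> (\<exists>B. finite B \<and> S \<subseteq> span B)"

lemma fin_dim_subset: "fin_dim T \<Longrightarrow> S \<subseteq> T \<Longrightarrow> fin_dim S"
  by (auto simp: fin_dim_def)

lemma fin_dim_basis:
  assumes "fin_dim S" "independent B" "B \<subseteq> S"
  shows "finite B" and "card B \<le> dim S"
proof -
  obtain T where T: "finite T" "S \<subseteq> span T" using assms(1) by (auto simp: fin_dim_def)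
  show "finite B" using independent_span_bound[OF T(1) assms(2)] assms(3) T(2) by blast
  obtain C where C: "B \<subseteq> C" "C \<subseteq> S" "independent C" "S \<subseteq> span C"
    using maximal_independent_subset_extend[OF assms(3,2)] by metis
  have "finite C" using independent_span_bound[OF T(1) C(3)] C(2) T(2) by blast
  then have "card B \<le> card C" using C(1) by (rule card_mono)
  also have "card C = dim S" using basis_card_eq_dim[OF C(2,4,3)] .
  finally show "card B \<le> dim S" .
qed

lemma fin_dim_dim_mono:
  assumes "fin_dim T" "S \<subseteq> T"
  shows "dim S \<le> dim T"
proof -
  obtain B where "B \<subseteq> S" "independent B" "S \<subseteq> span B" "card B = dim S"
    using basis_exists by blast
  then show ?thesis using fin_dim_basis(2)[OF assms(1)] assms(2) by (metis subset_trans)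
qed

lemma subspace_eq_of_dim_eq:
  assumes "fin_dim T" "S \<subseteq> T" "subspace S" "dim S = dim T"
  shows "S = T"
proof (rule ccontr)
  assume "S \<noteq> T"
  then obtain x where x: "x \<in> T" "x \<notin> S" using assms(2) by blast
  obtain B where B: "B \<subseteq> S" "independent B" "S \<subseteq> span B" "card B = dim S"
    using basis_exists by blast
  have "x \<notin> span B" using span_minimal[OF B(1) assms(3)] x(2) by blast
  then have ind: "independent (insert x B)" using B(2) by (rule independent_insertI)
  have sub: "insert x B \<subseteq> T" using B(1) assms(2) x(1) by blast
  have fB: "finite (insert x B)" and "card (insert x B) \<le> dim T"
    using fin_dim_basis[OF assms(1) ind sub] by auto
  moreover have "x \<notin> B" using B(1) x(2) by blast
  ultimately show False using B(4) assms(4) by simp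
qed

lemma independent_scalars_zero:
  assumes "independent B" "finite B" "(\<Sum>b\<in>B. c b *s b) = 0" "b \<in> B"
  shows "c b = 0"
  using assms(1)[unfolded independent_explicit_finite_subsets, rule_format, OF subset_refl assms(2-4)] .

lemma fin_dim_zero [simp]: "fin_dim {0}"
  unfolding fin_dim_def by (rule exI[of _ "{}"]) auto

lemma dim_zero [simp]: "dim {0} = 0"
  by (rule dim_unique[of "{}"]) (auto simp: independent_empty)

lemma fin_dim_set_sum:
  assumes "fin_dim S" "fin_dim T"
  shows "fin_dim (set_sum S T)"
proof -
  obtain A B where A: "finite A" "S \<subseteq> span A" and B: "finite B" "T \<subseteq> span B"
    using assms by (auto simp: fin_dim_def)
  have "set_sum S T \<subseteq> span (A \<union> B)"
    using A(2) B(2) span_mono[of A "A \<union> B"] span_mono[of B "A \<union> B"]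
    by (auto simp: set_sum_def intro!: span_add)
  then show ?thesis using A(1) B(1) unfolding fin_dim_def by blast
qed

lemma fin_dim_image:
  assumes "fin_dim S" "linear_op f"
  shows "fin_dim (f ` S)"
proof -
  interpret f: Vector_Spaces.linear scale scale f by fact
  obtain A where A: "finite A" "S \<subseteq> span A" using assms by (auto simp: fin_dim_def)
  have "f ` S \<subseteq> span (f ` A)" using A(2) f.span_image by blast
  then show ?thesis using A(1) unfolding fin_dim_def by blast
qed

lemma subspace_set_sum: "subspace S \<Longrightarrow> subspace T \<Longrightarrow> subspace (set_sum S T)"
  unfolding set_sum_def by (rule subspace_sums)

lemma set_sum_left: "subspace T \<Longrightarrow> S \<subseteq> set_sum S T"
  unfolding set_sum_def using subspace_0 by force

lemma set_sum_right: "subspace S \<Longrightarrow> T \<subseteq> set_sum S T"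
  unfolding set_sum_def using subspace_0 by force

lemma set_sum_least: "S \<subseteq> Y \<Longrightarrow> T \<subseteq> Y \<Longrightarrow> subspace Y \<Longrightarrow> set_sum S T \<subseteq> Y"
  unfolding set_sum_def using subspace_add by blast

lemma subspace_vimage_Int:
  assumes "linear_op f" "subspace U" "subspace U'"
  shows "subspace {u \<in> U. f u \<in> U'}"
proof -
  interpret f: Vector_Spaces.linear scale scale f by fact
  show ?thesis using assms(2,3)
    by (auto simp: subspace_def f.add f.scale)
qed

lemma subspace_image_op: "linear_op f \<Longrightarrow> subspace U \<Longrightarrow> subspace (f ` U)"
  by (rule module_hom.subspace_image[OF Vector_Spaces.linear.axioms(3)])

text \<open>
  This is rank and nullity for the map from \<open>U\<close> to the quotient by \<open>U'\<close> that \<open>f\<close> induces. It avoids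
  quotient spaces, and so do all later statements on pairs \<open>U' \<subseteq> U\<close>.
\<close>
lemma rank_nullity_mod:
  assumes f: "linear_op f" and U: "subspace U" "fin_dim U" and U': "subspace U'" "fin_dim U'"
  shows "dim {u \<in> U. f u \<in> U'} + dim (set_sum U' (f ` U)) = dim U + dim U'"
proof -
  interpret f: Vector_Spaces.linear scale scale f by fact
  let ?K = "{u \<in> U. f u \<in> U'}"
  have sK: "subspace ?K" using subspace_vimage_Int[OF f U(1) U'(1)] .
  obtain A where A: "A \<subseteq> ?K" "independent A" "?K \<subseteq> span A" "card A = dim ?K"
    using basis_exists by blast
  obtain B where B: "A \<subseteq> B" "B \<subseteq> U" "independent B" "U \<subseteq> span B"
    using maximal_independent_subset_extend[of A U] A(1,2) by blast
  have finB: "finite B" and cardB: "card B = dim U"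
    using fin_dim_basis(1)[OF U(2) B(3,2)] basis_card_eq_dim[OF B(2,4,3)] by auto
  obtain C where C: "C \<subseteq> U'" "independent C" "U' \<subseteq> span C" "card C = dim U'"
    using basis_exists by blast
  have finC: "finite C" using fin_dim_basis(1)[OF U'(2) C(2,1)] .
  have spanC: "span C = U'" using span_subspace[OF C(1,3) U'(1)] .
  define E where "E = B - A"
  have finE: "finite E" "E \<subseteq> U" "finite A" using finB B by (auto simp: E_def intro: finite_subset)
  have cE: "card E + dim ?K = dim U"
    using card_Diff_subset[of A B] card_mono[OF finB B(1)] B(1) finE A(4) cardB by (simp add: E_def)
  \<comment> \<open>Modulo \<open>U'\<close>, the images of the vectors that extend a basis of the kernel are independent.\<close>
  have key: "\<And>e. e \<in> E \<Longrightarrow> c e = 0" if c: "(\<Sum>e\<in>E. c e *s f e) \<in> U'" for c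
  proof -
    let ?x = "\<Sum>e\<in>E. c e *s e"
    have "?x \<in> U" using finE(2) U(1) by (auto intro!: subspace_sum subspace_scale)
    moreover have "f ?x \<in> U'" using c by (simp add: f.sum f.scale)
    ultimately have "?x \<in> span A" using A(3) by blast
    then obtain g where g: "?x = (\<Sum>a\<in>A. g a *s a)" using span_finite[OF finE(3)] by auto
    have "(\<Sum>b\<in>B. (if b \<in> A then - g b else c b) *s b) = (\<Sum>e\<in>E. c e *s e) + (\<Sum>a\<in>A. (- g a) *s a)"
      using sum.subset_diff[OF B(1) finB, of "\<lambda>b. (if b \<in> A then - g b else c b) *s b"]
      by (simp add: E_def)
    also have "\<dots> = 0" using g by (simp add: sum_negf)
    finally have "\<forall>b\<in>B. (if b \<in> A then - g b else c b) = 0"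
      using independent_scalars_zero[OF B(3) finB, of "\<lambda>b. if b \<in> A then - g b else c b"] by blast
    then show "\<And>e. e \<in> E \<Longrightarrow> c e = 0" by (force simp: E_def)
  qed
  have inj: "inj_on f E"
  proof (rule inj_onI, rule ccontr)
    fix e e' assume e: "e \<in> E" "e' \<in> E" "f e = f e'" "e \<noteq> e'"
    let ?c = "\<lambda>b. if b = e then 1 else if b = e' then -1 else 0"
    have "(\<Sum>b\<in>E. ?c b *s f b) = (\<Sum>b\<in>E. (if b = e then f e else 0) - (if b = e' then f e' else 0))"
      using e by (intro sum.cong) auto
    also have "\<dots> = 0" using e finE by (simp add: sum_subtractf)
    finally have "(\<Sum>b\<in>E. ?c b *s f b) \<in> U'" using subspace_0[OF U'(1)] by simp
    from key[OF this e(1)] show False by simp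
  qed
  have disj: "f ` E \<inter> C = {}"
  proof (rule ccontr)
    assume "f ` E \<inter> C \<noteq> {}"
    then obtain e where e: "e \<in> E" "f e \<in> U'" using C(1) by blast
    have "(\<Sum>b\<in>E. (if b = e then 1 else 0) *s f b) = (\<Sum>b\<in>E. (if b = e then f b else 0))"
      by (intro sum.cong) auto
    also have "\<dots> = f e" using e finE by simp
    finally have "(\<Sum>b\<in>E. (if b = e then 1 else 0) *s f b) \<in> U'" using e by simp
    from key[OF this e(1)] show False by simp
  qed
  have ind: "independent (f ` E \<union> C)"
  proof (rule independent_if_scalars_zero)
    show "finite (f ` E \<union> C)" using finE finC by auto
    fix g x assume s: "(\<Sum>x\<in>f ` E \<union> C. g x *s x) = 0" and x: "x \<in> f ` E \<union> C"
    have s1: "(\<Sum>x\<in>f ` E. g x *s x) + (\<Sum>x\<in>C. g x *s x) = 0"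
      using s finE finC disj by (simp add: sum.union_disjoint)
    have "(\<Sum>x\<in>C. g x *s x) \<in> U'" using C(1) U'(1) by (auto intro!: subspace_sum subspace_scale)
    then have "(\<Sum>x\<in>f ` E. g x *s x) \<in> U'"
      using s1 subspace_neg[OF U'(1)] by (metis eq_neg_iff_add_eq_0)
    then have "(\<Sum>e\<in>E. g (f e) *s f e) \<in> U'" using inj by (simp add: sum.reindex)
    then have z: "g (f e) = 0" if "e \<in> E" for e using key[of "\<lambda>e. g (f e)"] that by blast
    then have "(\<Sum>x\<in>f ` E. g x *s x) = 0" by (auto intro: sum.neutral)
    then have "(\<Sum>x\<in>C. g x *s x) = 0" using s1 by simp
    then have "\<forall>x\<in>C. g x = 0" using independent_scalars_zero[OF C(2) finC, of g] by blast
    then show "g x = 0" using x z by blast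
  qed
  have sub: "f ` E \<union> C \<subseteq> set_sum U' (f ` U)"
    using set_sum_left[OF subspace_image_op[OF f U(1)], of U'] set_sum_right[OF U'(1), of "f ` U"] C(1)
      image_mono[OF finE(2), of f] by (meson Un_least subset_trans)
  have "set_sum U' (f ` U) \<subseteq> span (f ` E \<union> C)"
  proof (rule set_sum_least)
    show U'C: "U' \<subseteq> span (f ` E \<union> C)" using spanC span_mono[of C "f ` E \<union> C"] by auto
    have "f ` B \<subseteq> span (f ` E \<union> C)"
    proof
      fix y assume "y \<in> f ` B"
      then obtain b where b: "b \<in> B" "y = f b" by blast
      show "y \<in> span (f ` E \<union> C)"
      proof (cases "b \<in> A")
        case True then show ?thesis using A(1) b U'C by blast
      next
        case False then show ?thesis using b by (auto simp: E_def intro: span_base)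
      qed
    qed
    then have "span (f ` B) \<subseteq> span (f ` E \<union> C)" by (intro span_minimal) auto
    then show "f ` U \<subseteq> span (f ` E \<union> C)" using f.span_image[of B] B(4) by blast
  qed auto
  then have "card (f ` E \<union> C) = dim (set_sum U' (f ` U))"
    using basis_card_eq_dim[OF sub _ ind] by blast
  moreover have "card (f ` E \<union> C) = card E + card C"
    using card_Un_disjoint[OF _ finC disj] finE card_image[OF inj] by simp
  ultimately show ?thesis using cE C(4) by simp
qed

lemma set_sum_zero_left [simp]: "set_sum {0::'b} S = S"
  by (auto simp: set_sum_def)

lemma rank_nullity:
  assumes "linear_op f" "subspace U" "fin_dim U"
  shows "dim {u \<in> U. f u = 0} + dim (f ` U) = dim U"
  using rank_nullity_mod[OF assms, of "{0}"] by simp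

text \<open>
  The coordinate functionals \<open>k\<close> witness the independence of the vectors \<open>e\<close>, and \<open>expand\<close> their spanning
  property.
\<close>
lemma dim_eq_card_dual_basis:
  assumes W: "subspace W" and T: "finite T" and e: "\<And>t. t \<in> T \<Longrightarrow> e t \<in> W"
    and k: "\<And>t. k t 0 = 0" "\<And>t x y. k t (x + y) = k t x + k t y" "\<And>t c x. k t (c *s x) = c * k t x"
    and dual: "\<And>t t'. t \<in> T \<Longrightarrow> t' \<in> T \<Longrightarrow> k t (e t') = (if t = t' then 1 else 0)"
    and expand: "\<And>w. w \<in> W \<Longrightarrow> w = (\<Sum>t\<in>T. k t w *s e t)"
  shows "fin_dim W" and "dim W = card T"
proof -
  have sub: "e ` T \<subseteq> W" using e by blast
  have inj: "inj_on e T" by (rule inj_onI) (metis dual zero_neq_one)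
  have span: "W \<subseteq> span (e ` T)"
  proof
    fix w assume "w \<in> W"
    then have "w = (\<Sum>t\<in>T. k t w *s e t)" by (rule expand)
    also have "\<dots> \<in> span (e ` T)" by (intro span_sum span_scale span_base) auto
    finally show "w \<in> span (e ` T)" .
  qed
  then show "fin_dim W" using T unfolding fin_dim_def by blast
  have ksum: "k t (sum h A) = (\<Sum>a\<in>A. k t (h a))" for t h and A :: "'b set"
    by (induction A rule: infinite_finite_induct) (auto simp: k)
  have "independent (e ` T)"
  proof (rule independent_if_scalars_zero)
    fix g x assume s: "(\<Sum>x\<in>e ` T. g x *s x) = 0" and "x \<in> e ` T"
    then obtain t where t: "t \<in> T" "x = e t" by blast
    have "0 = k t (\<Sum>x\<in>e ` T. g x *s x)" using s k(1) by simp
    also have "\<dots> = (\<Sum>x\<in>e ` T. g x * k t x)" by (simp add: ksum k(3))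
    also have "\<dots> = (\<Sum>t'\<in>T. g (e t') * k t (e t'))" using inj by (simp add: sum.reindex)
    also have "\<dots> = (\<Sum>t'\<in>T. if t = t' then g (e t') else 0)" using dual t(1) by (intro sum.cong) auto
    also have "\<dots> = g x" using t T by simp
    finally show "g x = 0" by simp
  qed (use T in auto)
  then have "card (e ` T) = dim W" using basis_card_eq_dim[OF sub span] by blast
  then show "dim W = card T" using card_image[OF inj] by simp
qed

text \<open>
  For two of the involutions, \<open>h = i g\<^sub>l g\<^sub>l\<^sub>+\<^sub>1\<close> is an involution that commutes with all the others. Its two
  eigenspaces are exchanged by \<open>g\<^sub>l\<close>, so they have the same dimension, and the remaining \<open>k - 2\<close> involutions
  act on each of them. So every pair of involutions contributes a factor \<open>2\<close>.
\<close>
lemma clifford_dim_dvd: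
  fixes g :: "nat \<Rightarrow> 'b \<Rightarrow> 'b"
  assumes two: "(2::'a) \<noteq> 0" and i: "i * i = (-1::'a)"
    and lin: "\<And>j. j < k \<Longrightarrow> linear_op (g j)"
    and sq: "\<And>j x. j < k \<Longrightarrow> g j (g j x) = x"
    and anti: "\<And>j l x. j < k \<Longrightarrow> l < k \<Longrightarrow> j \<noteq> l \<Longrightarrow> g j (g l x) = - g l (g j x)"
    and Y: "subspace Y" "fin_dim Y" and inv: "\<And>j x. j < k \<Longrightarrow> x \<in> Y \<Longrightarrow> g j x \<in> Y"
  shows "2 ^ (k div 2) dvd dim Y"
  using lin sq anti Y inv
proof (induction "k div 2" arbitrary: k Y)
  case 0 then show ?case by simp
next
  case (Suc m)
  have "\<not> k < 2" using Suc.hyps(2) by auto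
  then obtain l where l: "k = l + 2" by (metis add.commute le_Suc_ex not_less)
  have l2: "l div 2 = m" using Suc.hyps(2) l by simp
  note lin = Suc.prems(1) and sq = Suc.prems(2) and anti = Suc.prems(3) and Y = Suc.prems(4,5) and inv = Suc.prems(6)
  interpret p: Vector_Spaces.linear scale scale "g l" using lin[of l] l by simp
  interpret p': Vector_Spaces.linear scale scale "g (Suc l)" using lin[of "Suc l"] l by simp
  define h where "h x = i *s g l (g (Suc l) x)" for x
  have linh: "linear_op h"
    by (rule linear_opI) (simp_all add: h_def p.add p.scale p'.add p'.scale scale_right_distrib scale_left_commute)
  interpret h: Vector_Spaces.linear scale scale h by fact
  have hh: "h (h x) = x" for x
  proof -
    have "h (h x) = (i * i) *s g l (g (Suc l) (g l (g (Suc l) x)))"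
      by (simp add: h_def p.scale p'.scale)
    also have "g (Suc l) (g l (g (Suc l) x)) = - g l x"
      using anti[of "Suc l" l "g (Suc l) x"] sq[of "Suc l" x] l by simp
    also have "g l (- g l x) = - x" using sq[of l x] l by (simp add: p.neg)
    finally show ?thesis using i by simp
  qed
  have anti_h: "h (g l x) = - g l (h x)" for x
  proof -
    have a: "g (Suc l) (g l x) = - g l (g (Suc l) x)" using anti[of "Suc l" l x] l by simp
    show ?thesis unfolding h_def a p.neg p.scale by simp
  qed
  have comm_h: "h (g j x) = g j (h x)" if "j < l" for j x
  proof -
    interpret j: Vector_Spaces.linear scale scale "g j" using lin[of j] l that by simp
    have a: "g j (g l (g (Suc l) x)) = - g l (g j (g (Suc l) x))" "g j (g (Suc l) x) = - g (Suc l) (g j x)"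
      using anti[of j l "g (Suc l) x"] anti[of j "Suc l" x] l that by simp_all
    show ?thesis unfolding h_def j.scale a p.neg by simp
  qed
  have invh: "h x \<in> Y" if "x \<in> Y" for x
    unfolding h_def using that inv[of l] inv[of "Suc l"] l by (intro subspace_scale[OF Y(1)]) simp
  let ?P = "{x \<in> Y. h x = x}" and ?N = "{x \<in> Y. h x = - x}"
  have sP: "subspace ?P" using Y(1) by (auto simp: subspace_def h.add h.scale)
  have fP: "fin_dim ?P" by (rule fin_dim_subset[OF Y(2)]) auto
  have lh: "linear_op (\<lambda>x. h x - x)"
    by (rule linear_opI) (simp_all add: h.add h.scale scale_right_diff_distrib algebra_simps)
  have "(\<lambda>x. h x - x) ` Y = ?N"
  proof (intro equalityI subsetI)
    fix y assume "y \<in> (\<lambda>x. h x - x) ` Y"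
    then obtain x where "x \<in> Y" "y = h x - x" by blast
    then show "y \<in> ?N" using subspace_diff[OF Y(1) invh[of x]] by (simp add: h.diff hh)
  next
    fix y assume y: "y \<in> ?N"
    let ?x = "(- 1/2) *s y"
    have "h ?x - ?x = (1/2) *s y + (1/2) *s y" using y by (simp add: h.scale h.neg)
    also have "\<dots> = y" using two by (simp add: scale_left_distrib[symmetric] field_simps)
    finally have "h ?x - ?x = y" .
    moreover have "?x \<in> Y" using y subspace_scale[OF Y(1), of y "- 1 / 2"] by simp
    ultimately show "y \<in> (\<lambda>x. h x - x) ` Y" by (metis (no_types, lifting) image_eqI)
  qed
  then have dims: "dim ?P + dim ?N = dim Y"
    using rank_nullity[OF lh Y] by simp
  have "{u \<in> ?P. g l u = 0} = {0}"
  proof -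
    have "u = 0" if "g l u = 0" for u using sq[of l u] that l p.zero by simp
    then show ?thesis using subspace_0[OF Y(1)] h.zero p.zero by auto
  qed
  moreover have "g l ` ?P = ?N"
  proof (intro equalityI subsetI)
    fix y assume "y \<in> g l ` ?P"
    then obtain x where "x \<in> Y" "h x = x" "y = g l x" by blast
    then show "y \<in> ?N" using inv[of l x] l by (simp add: anti_h)
  next
    fix y assume y: "y \<in> ?N"
    then have "h (g l y) = g l y" by (simp add: anti_h p.neg)
    then have "g l y \<in> ?P" using y inv[of l y] l by simp
    then show "y \<in> g l ` ?P" using sq[of l y] l by (intro image_eqI[of _ _ "g l y"]) simp_all
  qed
  ultimately have "dim ?N = dim ?P"
    using rank_nullity[OF p.linear_axioms sP fP] by simp
  then have "dim Y = 2 * dim ?P" using dims by simp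
  moreover have "2 ^ (l div 2) dvd dim ?P"
  proof (rule Suc.hyps(1))
    show "m = l div 2" using l2 by simp
    show "g j x \<in> ?P" if "j < l" "x \<in> ?P" for j x using that inv[of j x] comm_h[of j x] l by simp
    show "linear_op (g j)" "g j (g j x) = x" if "j < l" for j x using that lin sq l by simp_all
    show "g j (g l' x) = - g l' (g j x)" if "j < l" "l' < l" "j \<noteq> l'" for j l' x
      using anti[of j l' x] that l by simp
  qed (fact sP fP)+
  ultimately show ?case using l2 Suc.hyps(2) by (simp flip: Suc.hyps(2))
qed

end

section \<open>Regularised alternating sums\<close>

text \<open>
  For a family of subspaces indexed by degree and an operator of degree \<open>1\<close>, this is the family of images;
  nothing of degree \<open>0\<close> is hit.
\<close>
definition shift_image :: "('b \<Rightarrow> 'b) \<Rightarrow> (nat \<Rightarrow> 'b set) \<Rightarrow> nat \<Rightarrow> 'b::zero set"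
  where "shift_image f U m = (case m of 0 \<Rightarrow> {0} | Suc m' \<Rightarrow> f ` U m')"

lemma shift_image_simps [simp]:
  "shift_image f U 0 = {0}" "shift_image f U (Suc m) = f ` U m"
  by (simp_all add: shift_image_def)

text \<open>
  For the signed sequence \<open>f m = (-1)\<^sup>m a m\<close>, this is the difference operator on \<open>a\<close> up to sign. Its \<open>k\<close>-th
  power kills \<open>f\<close> from some point on if \<open>a\<close> is eventually polynomial of degree less than \<open>k\<close>.
\<close>
definition pair_sum :: "(nat \<Rightarrow> int) \<Rightarrow> nat \<Rightarrow> int"
  where "pair_sum f m = f m + f (Suc m)"

lemma pair_sum_pow_add: "(pair_sum ^^ k) (\<lambda>m. f m + g m) = (\<lambda>m. (pair_sum ^^ k) f m + (pair_sum ^^ k) g m)"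
  by (induction k) (auto simp: pair_sum_def fun_eq_iff)

lemma pair_sum_pow_diff: "(pair_sum ^^ k) (\<lambda>m. f m - g m) = (\<lambda>m. (pair_sum ^^ k) f m - (pair_sum ^^ k) g m)"
  by (induction k) (auto simp: pair_sum_def fun_eq_iff)

lemma pair_sum_pow_Suc: "(pair_sum ^^ k) (\<lambda>m. f (Suc m)) m = (pair_sum ^^ k) f (Suc m)"
  by (induction k arbitrary: m) (auto simp: pair_sum_def)

lemma pair_sum_pow_const_from: "(\<And>m. m \<ge> M \<Longrightarrow> f m = c) \<Longrightarrow> m \<ge> M \<Longrightarrow> (pair_sum ^^ k) f m = 2 ^ k * c"
  by (induction k arbitrary: m) (auto simp: pair_sum_def)

definition partial_sum :: "(nat \<Rightarrow> int) \<Rightarrow> nat \<Rightarrow> int"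
  where "partial_sum f M = (\<Sum>m<M. f m)"

text \<open>
  If \<open>f m = (-1)\<^sup>m a m\<close> and \<open>a\<close> is eventually polynomial of degree less than \<open>k\<close>, then the partial sums of
  \<open>f\<close> are eventually a constant \<open>C\<close> plus \<open>(-1)\<^sup>m\<close> times such a polynomial. Applying \<open>pair_sum\<close> \<open>k\<close> times
  leaves \<open>2\<^sup>k C\<close>, where \<open>C\<close> is the value of the generating function of \<open>a\<close> at \<open>-1\<close>. The result is defined for
  every \<open>M\<close>, without any limit, and is constant for large \<open>M\<close>.
\<close>
definition reg_sum :: "nat \<Rightarrow> (nat \<Rightarrow> int) \<Rightarrow> nat \<Rightarrow> int"
  where "reg_sum k f = (pair_sum ^^ k) (partial_sum f)"

lemma reg_sum_diff: "reg_sum k (\<lambda>m. f m - g m) = (\<lambda>m. reg_sum k f m - reg_sum k g m)"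
proof -
  have "partial_sum (\<lambda>m. f m - g m) = (\<lambda>M. partial_sum f M - partial_sum g M)"
    by (simp add: partial_sum_def sum_subtractf fun_eq_iff)
  then show ?thesis by (simp add: reg_sum_def pair_sum_pow_diff)
qed

lemma reg_sum_Suc: "reg_sum k f (Suc M) = reg_sum k f M + (pair_sum ^^ k) f M"
proof -
  have "(pair_sum ^^ k) (\<lambda>m. partial_sum f (Suc m) - partial_sum f m) M = (pair_sum ^^ k) f M"
    by (simp add: partial_sum_def)
  then show ?thesis
    using pair_sum_pow_Suc[of k "partial_sum f" M]
    by (simp add: reg_sum_def pair_sum_pow_diff)
qed

text \<open>
  This transfers a relation between Hilbert functions, of the kind that a map of degree \<open>1\<close> yields by rank
  and nullity, to regularised sums.
\<close>
lemma reg_sum_shift: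
  assumes "\<And>m. f m - f' m = h (Suc m) - h' (Suc m)" "h 0 = h' 0"
  shows "reg_sum k f M - reg_sum k f' M = reg_sum k h (Suc M) - reg_sum k h' (Suc M)"
proof -
  have "partial_sum f M - partial_sum f' M = partial_sum h (Suc M) - partial_sum h' (Suc M)" for M
  proof (induction M)
    case (Suc M)
    then show ?case using assms(1)[of M] by (simp add: partial_sum_def)
  qed (use assms(2) in \<open>simp add: partial_sum_def\<close>)
  then have "(pair_sum ^^ k) (\<lambda>M. partial_sum f M - partial_sum f' M) M
      = (pair_sum ^^ k) (\<lambda>M. partial_sum h (Suc M) - partial_sum h' (Suc M)) M"
    by simp
  then show ?thesis
    by (simp only: reg_sum_def pair_sum_pow_diff pair_sum_pow_Suc[of k "partial_sum h"] pair_sum_pow_Suc[of k "partial_sum h'"])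
qed

context vspace
begin

lemma linear_op_funpow: "linear_op f \<Longrightarrow> linear_op (f ^^ j)"
proof (induction j)
  case 0 then show ?case by (intro linear_opI) auto
next
  case (Suc j)
  interpret f: Vector_Spaces.linear scale scale f using Suc by simp
  interpret fj: Vector_Spaces.linear scale scale "f ^^ j" using Suc by simp
  show ?case by (intro linear_opI) (auto simp: f.add fj.add f.scale fj.scale)
qed

definition sdim :: "(nat \<Rightarrow> 'b set) \<Rightarrow> nat \<Rightarrow> int"
  where "sdim U m = (-1) ^ m * int (dim (U m))"

lemma subspace_shift_image:
  "linear_op f \<Longrightarrow> (\<And>m. subspace (U m)) \<Longrightarrow> subspace (shift_image f U m)"
  by (cases m) (auto intro: subspace_image_op)

lemma fin_dim_shift_image:
  "linear_op f \<Longrightarrow> (\<And>m. fin_dim (U m)) \<Longrightarrow> fin_dim (shift_image f U m)"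
  by (cases m) (auto intro: fin_dim_image)

lemma sdim_rank_nullity:
  assumes "linear_op f" "\<And>m. subspace (U m)" "\<And>m. fin_dim (U m)" "\<And>m. subspace (U' m)" "\<And>m. fin_dim (U' m)"
  shows "sdim U m - sdim (\<lambda>m. {u \<in> U m. f u \<in> U' (Suc m)}) m
    = sdim U' (Suc m) - sdim (\<lambda>m. set_sum (U' m) (shift_image f U m)) (Suc m)"
proof -
  have *: "int (dim {u \<in> U m. f u \<in> U' (Suc m)}) + int (dim (set_sum (U' (Suc m)) (f ` U m)))
      = int (dim (U m)) + int (dim (U' (Suc m)))"
    using rank_nullity_mod[OF assms(1), of "U m" "U' (Suc m)"] assms(2-5) by (simp flip: of_nat_add)
  have "(-1) ^ m * (int (dim (U m)) - int (dim {u \<in> U m. f u \<in> U' (Suc m)}))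
      = (-1) ^ m * (int (dim (set_sum (U' (Suc m)) (f ` U m))) - int (dim (U' (Suc m))))"
    using * by (intro arg_cong[of _ _ "(*) ((-1) ^ m)"]) linarith
  then show ?thesis by (simp add: sdim_def right_diff_distrib)
qed

end

section \<open>Noetherian families and Hilbert functions\<close>

text \<open>
  A graded module over the polynomial ring in \<open>k\<close> variables is represented by its family of homogeneous
  parts, which are subspaces of one ambient vector space; the variable \<open>b\<close> acts as \<open>y b\<close>. All values of
  \<open>y\<close> commute, so that the same operators serve for every \<open>k\<close>.
\<close>
locale graded_ops = vspace scale
  for scale :: "'a::field \<Rightarrow> 'b::ab_group_add \<Rightarrow> 'b"  (infixr \<open>*s\<close> 75) +
  fixes y :: "nat \<Rightarrow> 'b \<Rightarrow> 'b"
  assumes y_linear: "linear_op (y b)"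
    and y_commute: "y a (y b x) = y b (y a x)"
begin

lemma y_add: "y b (u + v) = y b u + y b v" and y_zero: "y b 0 = 0"
proof -
  interpret l: Vector_Spaces.linear scale scale "y b" by (rule y_linear)
  show "y b (u + v) = y b u + y b v" "y b 0 = 0" by (fact l.add l.zero)+
qed

definition graded_submodule :: "nat \<Rightarrow> (nat \<Rightarrow> 'b set) \<Rightarrow> bool"
  where "graded_submodule k U \<longleftrightarrow>
    (\<forall>m. subspace (U m) \<and> fin_dim (U m) \<and> (\<forall>b<k. \<forall>u\<in>U m. y b u \<in> U (Suc m)))"

lemma graded_submoduleD:
  assumes "graded_submodule k U"
  shows "subspace (U m)" "fin_dim (U m)" "b < k \<Longrightarrow> u \<in> U m \<Longrightarrow> y b u \<in> U (Suc m)"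
  using assms by (auto simp: graded_submodule_def)

lemma graded_submodule_mono: "graded_submodule k U \<Longrightarrow> l \<le> k \<Longrightarrow> graded_submodule l U"
  by (auto simp: graded_submodule_def)

text \<open>
  This is the ascending chain condition for the graded submodules of \<open>U / U'\<close> over the first \<open>k\<close> variables.
\<close>
definition noetherian :: "nat \<Rightarrow> (nat \<Rightarrow> 'b set) \<Rightarrow> (nat \<Rightarrow> 'b set) \<Rightarrow> bool"
  where "noetherian k U U' \<longleftrightarrow>
    (\<forall>C. (\<forall>n. graded_submodule k (C n) \<and> U' \<le> C n \<and> C n \<le> U \<and> C n \<le> C (Suc n)) \<longrightarrow>
      (\<exists>N. \<forall>n\<ge>N. C n = C N))"

lemma noetherian_subinterval:
  "noetherian k U U' \<Longrightarrow> U' \<le> A \<Longrightarrow> B \<le> U \<Longrightarrow> noetherian k B A"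
  unfolding noetherian_def by (meson order_trans)

text \<open>
  This is Hilbert's basis theorem in graded form: if \<open>U / (U' + y\<^sub>k U)\<close> is Noetherian over \<open>k\<close> variables,
  then \<open>U / U'\<close> is Noetherian over \<open>k + 1\<close> variables. To a submodule \<open>X\<close> one attaches the leading terms with
  respect to the filtration by powers of \<open>y\<^sub>k\<close>, namely the modules \<open>L\<^sub>j\<close> of all \<open>u\<close> with
  \<open>y\<^sub>k\<^sup>j u \<in> X + y\<^sub>k\<^sup>j\<^sup>+\<^sup>1 U\<close>. They increase with \<open>X\<close> and with \<open>j\<close> and contain \<open>U' + y\<^sub>k U\<close>, so they become
  stationary along a chain of submodules. Two members of the chain with the same leading terms are equal, as
  \<open>y\<^sub>k\<^sup>j U\<close> vanishes in each fixed degree once \<open>j\<close> is large.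
\<close>
lemma noetherian_step:
  assumes U: "graded_submodule (Suc k) U" and U': "graded_submodule (Suc k) U'"
    and noeth: "noetherian k U (\<lambda>m. set_sum (U' m) (shift_image (y k) U m))"
  shows "noetherian (Suc k) U U'"
  unfolding noetherian_def
proof (intro allI impI)
  fix C :: "nat \<Rightarrow> nat \<Rightarrow> 'b set"
  assume C: "\<forall>n. graded_submodule (Suc k) (C n) \<and> U' \<le> C n \<and> C n \<le> U \<and> C n \<le> C (Suc n)"
  note sU = graded_submoduleD[OF U]
  have C_sub: "graded_submodule (Suc k) (C n)" for n using C by blast
  note sC = graded_submoduleD[OF C_sub]
  have C_mono: "C n m \<subseteq> C n' m" if "n \<le> n'" for n n' m
    using lift_Suc_mono_le[of C n n'] C that by (auto simp: le_fun_def)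
  have U'C: "U' m \<subseteq> C n m" and CU: "C n m \<subseteq> U m" for n m using C by (auto simp: le_fun_def)
  define p where "p j = (y k ^^ j)" for j
  have p_lin: "linear_op (p j)" for j unfolding p_def by (rule linear_op_funpow[OF y_linear])
  have p_add: "p j (u + v) = p j u + p j v" for j u v
    using module_hom.add[OF Vector_Spaces.linear.axioms(3)[OF p_lin]] .
  have p_y: "p j (y b u) = y b (p j u)" for j b u
    unfolding p_def by (induction j) (auto simp: y_commute)
  have p_Suc: "p (Suc j) u = p j (y k u)" for j u by (simp add: p_def funpow_swap1)
  have p_in: "p j u \<in> V (m + j)" if "graded_submodule (Suc k) V" "u \<in> V m" for j u m V
    unfolding p_def by (induction j) (use that graded_submoduleD(3)[OF that(1)] in auto)
  let ?S = "shift_image (y k) U"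
  have S: "subspace (?S m)" "?S m \<subseteq> U m" for m
    using subspace_shift_image[OF y_linear sU(1)] sU(3)[of k] subspace_0[OF sU(1)] by (auto simp: shift_image_def split: nat.splits)
  have S_y: "y b w \<in> ?S (Suc m)" if w: "w \<in> ?S m" "b < k" for b w m
  proof (cases m)
    case 0 then show ?thesis using w subspace_0[OF sU(1)] y_zero[of k] by (auto simp: y_zero image_iff intro!: bexI[of _ 0])
  next
    case (Suc m')
    then obtain v where "v \<in> U m'" "w = y k v" using w Suc by auto
    then show ?thesis using Suc sU(3)[of b v m'] w(2) y_commute[of b k v] by auto
  qed
  define L where "L n j m = {u \<in> U m. p j u \<in> set_sum (C n (m + j)) (p j ` ?S m)}" for n j m
  have L_sub: "graded_submodule k (L n j)" for n j
    unfolding graded_submodule_def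
  proof (intro allI conjI impI ballI)
    fix m
    show "subspace (L n j m)" unfolding L_def
      by (intro subspace_vimage_Int subspace_set_sum subspace_image_op p_lin sU sC S)
    show "fin_dim (L n j m)" by (rule fin_dim_subset[OF sU(2)]) (auto simp: L_def)
    fix b u assume b: "b < k" and u: "u \<in> L n j m"
    then obtain x w where x: "x \<in> C n (m + j)" "w \<in> ?S m" "p j u = x + p j w"
      by (auto simp: L_def set_sum_def)
    have "p j (y b u) = y b x + p j (y b w)" by (simp add: p_y x(3) y_add)
    moreover have "y b x \<in> C n (Suc m + j)" using sC(3)[of b x n "m + j"] x b by simp
    ultimately have "p j (y b u) \<in> set_sum (C n (Suc m + j)) (p j ` ?S (Suc m))"
      using S_y[OF x(2) b] unfolding set_sum_def by blast
    then show "y b u \<in> L n j (Suc m)" using u b sU(3) by (auto simp: L_def)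
  qed
  have L_ge: "(\<lambda>m. set_sum (U' m) (?S m)) \<le> L n j" for n j
  proof (rule le_funI, rule subsetI)
    fix m u assume "u \<in> set_sum (U' m) (?S m)"
    then obtain x w where x: "x \<in> U' m" "w \<in> ?S m" "u = x + w" by (auto simp: set_sum_def)
    have "u \<in> U m" using x S(2)[of m] U'C[of m 0] CU[of 0 m] subspace_add[OF sU(1), of x m w] by auto
    moreover have "p j x \<in> C n (m + j)" using p_in[OF U' x(1)] U'C by blast
    ultimately show "u \<in> L n j m" using x by (auto simp: L_def set_sum_def p_add)
  qed
  have L_le: "L n j \<le> U" for n j by (auto simp: L_def le_fun_def)
  have L_n: "L n j \<le> L (Suc n) j" for n j
    using C_mono[of n "Suc n"] by (auto simp: L_def le_fun_def set_sum_def)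
  have L_j: "L n j \<le> L n (Suc j)" for n j
  proof (rule le_funI, rule subsetI)
    fix m u assume u: "u \<in> L n j m"
    then obtain x w where x: "x \<in> C n (m + j)" "w \<in> ?S m" "p j u = x + p j w"
      by (auto simp: L_def set_sum_def)
    have "p (Suc j) u = y k x + p (Suc j) w" by (simp add: p_Suc p_y x(3) y_add)
    moreover have "y k x \<in> C n (m + Suc j)" using sC(3)[of k x n "m + j"] x by simp
    ultimately show "u \<in> L n (Suc j) m" using u x(2) unfolding L_def set_sum_def by blast
  qed
  have stab: "\<exists>N. \<forall>n\<ge>N. B n = B N"
    if "\<And>n. graded_submodule k (B n)" "\<And>n. (\<lambda>m. set_sum (U' m) (?S m)) \<le> B n" "\<And>n. B n \<le> U" "\<And>n. B n \<le> B (Suc n)" for B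
    using noeth that unfolding noetherian_def by blast
  \<comment> \<open>The diagonal sequence controls all \<open>j \<ge> N\<close> at once; the finitely many smaller \<open>j\<close> are treated one by one.\<close>
  have "L n n \<le> L (Suc n) (Suc n)" for n using L_n L_j order_trans by blast
  then obtain N where N: "\<And>n. n \<ge> N \<Longrightarrow> L n n = L N N"
    using stab[of "\<lambda>n. L n n"] L_sub L_ge L_le by blast
  have "\<forall>j. \<exists>M. \<forall>n\<ge>M. L n j = L M j"
    using stab[of "\<lambda>n. L n j" for j] L_sub L_ge L_le L_n by blast
  then obtain R where R: "\<And>j n. n \<ge> R j \<Longrightarrow> L n j = L (R j) j" by metis
  define M where "M = Max (insert N (R ` {..<N}))"
  have MN: "N \<le> M" and MR: "\<And>j. j < N \<Longrightarrow> R j \<le> M" by (auto simp: M_def intro!: Max_ge)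
  have L_mono_n: "L n j \<le> L n' j" if "n \<le> n'" for n n' j using lift_Suc_mono_le[of "\<lambda>n. L n j"] L_n that by blast
  have L_mono_j: "L n j \<le> L n j'" if "j \<le> j'" for n j j' using lift_Suc_mono_le[of "\<lambda>j. L n j"] L_j that by blast
  have LM: "L n j = L M j" if n: "n \<ge> M" for n j
  proof (cases "j < N")
    case True then show ?thesis using R[of j n] R[of j M] MR[of j] n by simp
  next
    case False
    have "L n' j = L N N" if "n' \<ge> N" for n'
    proof (rule antisym)
      have "L n' j \<le> L (max n' j) (max n' j)" using L_mono_n L_mono_j by (meson max.cobounded1 max.cobounded2 order_trans)
      then show "L n' j \<le> L N N" using N[of "max n' j"] False by simp
      show "L N N \<le> L n' j" using L_mono_n[OF that] L_mono_j[of N j] False by (meson not_less order_trans)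
    qed
    then show ?thesis using n MN by simp
  qed
  have "C n m \<subseteq> C M m" if n: "n \<ge> M" for n m
  proof
    fix x assume x: "x \<in> C n m"
    \<comment> \<open>Successive approximation: the error moves into higher and higher powers of \<open>y\<^sub>k\<close>.\<close>
    have "\<exists>x0\<in>C M m. \<exists>u\<in>U (m - j). x = x0 + p j u" if "j \<le> m" for j
      using that
    proof (induction j)
      case 0
      show ?case using subspace_0[OF sC(1), of M m] x CU by (intro bexI[of _ 0] bexI[of _ x]) (auto simp: p_def)
    next
      case (Suc j)
      then obtain x0 u where xu: "x0 \<in> C M m" "u \<in> U (m - j)" "x = x0 + p j u" by auto
      have "p j u = x - x0" using xu by simp
      then have "p j u \<in> C n m" using subspace_diff[OF sC(1) x] xu(1) C_mono[OF n] by auto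
      then have "p j u \<in> set_sum (C n (m - j + j)) (p j ` ?S (m - j))"
        using set_sum_left[OF subspace_image_op[OF p_lin S(1)]] Suc.prems by auto
      then have "u \<in> L n j (m - j)" using xu(2) by (simp add: L_def)
      then have "u \<in> L M j (m - j)" using LM[OF n] by simp
      then obtain x1 w where w: "x1 \<in> C M m" "w \<in> ?S (m - j)" "p j u = x1 + p j w"
        using Suc.prems by (auto simp: L_def set_sum_def)
      moreover have "m - j = Suc (m - Suc j)" using Suc.prems by simp
      ultimately obtain v where v: "v \<in> U (m - Suc j)" "w = y k v" by auto
      have "x = (x0 + x1) + p (Suc j) v" using xu w v by (simp add: p_Suc)
      then show ?case using v subspace_add[OF sC(1) xu(1) w(1)] by blast
    qed
    then obtain x0 u where xu: "x0 \<in> C M m" "u \<in> U 0" "x = x0 + p m u" by force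
    have "p m u = x - x0" using xu by simp
    then have "p m u \<in> C n m" using subspace_diff[OF sC(1) x] xu(1) C_mono[OF n] by auto
    then have "u \<in> L n m 0" using xu(2) subspace_0[OF subspace_image_op[OF p_lin S(1)], of m 0]
      by (auto simp: L_def set_sum_def)
    then have "u \<in> L M m 0" using LM[OF n] by simp
    then have "p m u \<in> C M m"
      using module_hom.zero[OF Vector_Spaces.linear.axioms(3)[OF p_lin]] by (auto simp: L_def set_sum_def)
    then show "x \<in> C M m" using xu subspace_add[OF sC(1)] by blast
  qed
  then have "\<forall>n\<ge>M. C n = C M" using C_mono[of M] by (intro allI impI ext subset_antisym)
  then show "\<exists>N. \<forall>n\<ge>N. C n = C N" by blast
qed

text \<open>
  Without variables any choice of subspaces is a submodule, so the families that agree with \<open>U\<close> below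
  degree \<open>n\<close> and with \<open>U'\<close> from \<open>n\<close> on form a chain.
\<close>
lemma noetherian_0_eventually_eq:
  assumes U: "graded_submodule 0 U" and U': "graded_submodule 0 U'" and le: "U' \<le> U" and n: "noetherian 0 U U'"
  shows "\<exists>M. \<forall>m\<ge>M. U m = U' m"
proof -
  define C where "C n m = (if m < n then U m else U' m)" for n m
  have "\<forall>n. graded_submodule 0 (C n) \<and> U' \<le> C n \<and> C n \<le> U \<and> C n \<le> C (Suc n)"
    using U U' le by (auto simp: C_def graded_submodule_def le_fun_def)
  then obtain N where N: "\<And>n. n \<ge> N \<Longrightarrow> C n = C N" using n unfolding noetherian_def by metis
  have "U m = U' m" if "m \<ge> N" for m
  proof -
    have "C (Suc m) m = C N m" using N[of "Suc m"] that by simp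
    then show ?thesis using that by (simp add: C_def)
  qed
  then show ?thesis by blast
qed

text \<open>
  The last variable defines a map from \<open>U / U'\<close> to itself of degree \<open>1\<close>. On its kernel and cokernel it
  acts as zero, so these are Noetherian over one variable fewer, and the difference of consecutive values of
  the Hilbert function of \<open>U / U'\<close> is given by theirs.
\<close>
lemma hilbert_function:
  assumes "graded_submodule k U" "graded_submodule k U'" "U' \<le> U" "noetherian k U U'"
  shows "\<exists>M. \<forall>m\<ge>M. (pair_sum ^^ k) (\<lambda>m. sdim U m - sdim U' m) m = 0"
  using assms
proof (induction k arbitrary: U U')
  case 0
  then obtain M where "\<forall>m\<ge>M. U m = U' m" using noetherian_0_eventually_eq by blast
  then show ?case by (auto simp: sdim_def intro!: exI[of _ M])
next
  case (Suc k)
  note sU = graded_submoduleD[OF Suc.prems(1)] and sU' = graded_submoduleD[OF Suc.prems(2)]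
  have le: "U' m \<subseteq> U m" for m using Suc.prems(3) by (simp add: le_fun_def)
  let ?K = "\<lambda>m. {u \<in> U m. y k u \<in> U' (Suc m)}"
  let ?Q = "\<lambda>m. set_sum (U' m) (shift_image (y k) U m)"
  have S: "subspace (shift_image (y k) U m)" "shift_image (y k) U m \<subseteq> U m" for m
    using subspace_shift_image[OF y_linear sU(1)] sU(3)[of k] subspace_0[OF sU(1)] by (auto simp: shift_image_def split: nat.splits)
  have S_y: "y b w \<in> shift_image (y k) U (Suc m)" if w: "w \<in> shift_image (y k) U m" "b < k" for b w m
  proof (cases m)
    case 0 then show ?thesis using w subspace_0[OF sU(1)] y_zero[of k] by (auto simp: y_zero image_iff intro!: bexI[of _ 0])
  next
    case (Suc m')
    then obtain v where "v \<in> U m'" "w = y k v" using w Suc by auto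
    then show ?thesis using Suc sU(3)[of b v m'] w(2) y_commute[of b k v] by auto
  qed
  have U_k: "graded_submodule k U" and U'_k: "graded_submodule k U'"
    using Suc.prems graded_submodule_mono[of "Suc k"] by auto
  have K: "graded_submodule k ?K" unfolding graded_submodule_def
  proof (intro allI conjI impI ballI)
    fix m
    show "subspace (?K m)" by (rule subspace_vimage_Int[OF y_linear sU(1) sU'(1)])
    show "fin_dim (?K m)" by (rule fin_dim_subset[OF sU(2)]) auto
    fix b u assume "b < k" "u \<in> ?K m"
    then show "y b u \<in> ?K (Suc m)" using sU(3)[of b u m] sU'(3)[of b "y k u" "Suc m"] by (simp add: y_commute[of k b])
  qed
  have Q: "graded_submodule k ?Q" unfolding graded_submodule_def
  proof (intro allI conjI impI ballI)
    fix m
    show "subspace (?Q m)" by (intro subspace_set_sum sU' S)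
    show "fin_dim (?Q m)" by (intro fin_dim_set_sum sU' fin_dim_shift_image y_linear sU)
    fix b u assume b: "b < k" and "u \<in> ?Q m"
    then obtain x w where x: "x \<in> U' m" "w \<in> shift_image (y k) U m" "u = x + w" by (auto simp: set_sum_def)
    show "y b u \<in> ?Q (Suc m)"
      using S_y[OF x(2) b] sU'(3)[of b x m] b x(1) unfolding x(3) y_add set_sum_def by auto
  qed
  have QU: "?Q \<le> U" using set_sum_least[OF le S(2) sU(1)] by (simp add: le_fun_def)
  have U'K: "U' \<le> ?K" using le sU'(3)[of k] by (auto simp: le_fun_def)
  have "noetherian k ?K U'"
    unfolding noetherian_def
  proof (intro allI impI)
    fix C assume C: "\<forall>n. graded_submodule k (C n) \<and> U' \<le> C n \<and> C n \<le> ?K \<and> C n \<le> C (Suc n)"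
    have cl: "y k u \<in> C n (Suc m)" if "u \<in> C n m" for n m u using C that by (force simp: le_fun_def)
    have "graded_submodule (Suc k) (C n)" for n
      using C cl unfolding graded_submodule_def by (auto simp: less_Suc_eq)
    moreover have "C n \<le> U" for n using C by (force simp: le_fun_def)
    ultimately show "\<exists>N. \<forall>n\<ge>N. C n = C N" using C Suc.prems(4) unfolding noetherian_def by blast
  qed
  then obtain M1 where M1: "\<And>m. m \<ge> M1 \<Longrightarrow> (pair_sum ^^ k) (\<lambda>m. sdim ?K m - sdim U' m) m = 0"
    using Suc.IH[OF K U'_k U'K] by blast
  have "noetherian k U ?Q"
    unfolding noetherian_def
  proof (intro allI impI)
    fix C assume C: "\<forall>n. graded_submodule k (C n) \<and> ?Q \<le> C n \<and> C n \<le> U \<and> C n \<le> C (Suc n)"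
    have QC: "?Q m \<subseteq> C n m" and CU: "C n m \<subseteq> U m" for n m using C by (simp_all add: le_fun_def)
    have cl: "y k u \<in> C n (Suc m)" if "u \<in> C n m" for n m u
      using QC[of "Suc m" n] CU[of n m] set_sum_right[OF sU'(1), of "y k ` U m" "Suc m"] that by auto
    have "graded_submodule (Suc k) (C n)" for n
      using C cl unfolding graded_submodule_def by (auto simp: less_Suc_eq)
    moreover have "U' \<le> C n" for n
      using QC set_sum_left[OF S(1)] by (meson le_funI order_trans)
    ultimately show "\<exists>N. \<forall>n\<ge>N. C n = C N" using C Suc.prems(4) unfolding noetherian_def by blast
  qed
  then obtain M2 where M2: "\<And>m. m \<ge> M2 \<Longrightarrow> (pair_sum ^^ k) (\<lambda>m. sdim U m - sdim ?Q m) m = 0"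
    using Suc.IH[OF U_k Q QU] by blast
  have "pair_sum (\<lambda>m. sdim U m - sdim U' m) = (\<lambda>m. (sdim ?K m - sdim U' m) + (sdim U (Suc m) - sdim ?Q (Suc m)))"
  proof
    fix m show "pair_sum (\<lambda>m. sdim U m - sdim U' m) m = (sdim ?K m - sdim U' m) + (sdim U (Suc m) - sdim ?Q (Suc m))"
      using sdim_rank_nullity[of "y k" U U' m, OF y_linear sU(1,2) sU'(1,2)] by (simp add: pair_sum_def)
  qed
  then have "(pair_sum ^^ Suc k) (\<lambda>m. sdim U m - sdim U' m) m
      = (pair_sum ^^ k) (\<lambda>m. sdim ?K m - sdim U' m) m + (pair_sum ^^ k) (\<lambda>m. sdim U m - sdim ?Q m) (Suc m)" for m
    by (simp only: funpow_Suc_right o_apply pair_sum_pow_add pair_sum_pow_Suc[of k "\<lambda>m. sdim U m - sdim ?Q m"])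
  then show ?case using M1 M2 by (intro exI[of _ "max M1 M2"]) simp
qed

end

section \<open>Congruences from Dirac operators\<close>

text \<open>
  The operators that the exterior algebra on \<open>s\<close> generators contributes. Multiplication by
  \<open>q = y\<^sub>1\<^sup>2 + \<dots> + y\<^sub>s\<^sup>2\<close> enters only as the square of \<open>D\<close>.
\<close>
locale dirac_module = graded_ops scale y
  for scale :: "'a::field \<Rightarrow> 'b::ab_group_add \<Rightarrow> 'b"  (infixr \<open>*s\<close> 75)
    and y :: "nat \<Rightarrow> 'b \<Rightarrow> 'b" +
  fixes s :: nat and c g :: "nat \<Rightarrow> 'b \<Rightarrow> 'b" and D :: "'b \<Rightarrow> 'b"
  assumes two: "(2::'a) \<noteq> 0" and imaginary: "\<exists>i::'a. i * i = -1"
    and c_linear: "linear_op (c b)" and g_linear: "linear_op (g b)" and D_linear: "linear_op D"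
    and D_y: "D (y b u) = y b (D u)"
    and D_c: "b < s \<Longrightarrow> D (c b u) + c b (D u) = 2 *s y b u"
    and D_g_sign: "j < Suc s \<Longrightarrow> (\<forall>u. D (g j u) = g j (D u)) \<or> (\<forall>u. D (g j u) = - g j (D u))"
    and g_involution: "j < Suc s \<Longrightarrow> g j (g j u) = u"
    and g_anticommute: "j < Suc s \<Longrightarrow> l < Suc s \<Longrightarrow> j \<noteq> l \<Longrightarrow> g j (g l u) = - g l (g j u)"
begin

lemma g_invariant_dim_dvd:
  assumes "subspace Y" "fin_dim Y" "\<And>j u. j < Suc s \<Longrightarrow> u \<in> Y \<Longrightarrow> g j u \<in> Y"
  shows "2 ^ (Suc s div 2) dvd dim Y"
proof -
  obtain i :: 'a where "i * i = -1" using imaginary by blast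
  then show ?thesis
    using clifford_dim_dvd[OF two, of i "Suc s" g Y] g_linear g_involution g_anticommute assms by blast
qed

lemma D_g: "j < Suc s \<Longrightarrow> D (g j u) = g j (D u) \<or> D (g j u) = - g j (D u)"
  using D_g_sign by blast

lemma D_add: "D (u + v) = D u + D v" and D_neg: "D (- u) = - D u" and D_zero: "D 0 = 0"
  and D_scale: "D (r *s u) = r *s D u"
proof -
  interpret l: Vector_Spaces.linear scale scale D by (rule D_linear)
  show "D (u + v) = D u + D v" "D (- u) = - D u" "D 0 = 0" "D (r *s u) = r *s D u"
    by (fact l.add l.neg l.zero l.scale)+
qed

lemma g_add: "g j (u + v) = g j u + g j v" and g_zero: "g j 0 = 0"
proof -
  interpret l: Vector_Spaces.linear scale scale "g j" by (rule g_linear)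
  show "g j (u + v) = g j u + g j v" "g j 0 = 0" by (fact l.add l.zero)+
qed

definition dirac_submodule :: "(nat \<Rightarrow> 'b set) \<Rightarrow> bool"
  where "dirac_submodule U \<longleftrightarrow> graded_submodule s U \<and>
    (\<forall>m. \<forall>u\<in>U m. (\<forall>b<s. c b u \<in> U m) \<and> (\<forall>j<Suc s. g j u \<in> U m) \<and> D u \<in> U (Suc m))"

lemma dirac_submoduleD:
  assumes "dirac_submodule U"
  shows "graded_submodule s U" "b < s \<Longrightarrow> u \<in> U m \<Longrightarrow> c b u \<in> U m"
    "j < Suc s \<Longrightarrow> u \<in> U m \<Longrightarrow> g j u \<in> U m" "u \<in> U m \<Longrightarrow> D u \<in> U (Suc m)"
  using assms by (auto simp: dirac_submodule_def)

text \<open>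
  The exponent combines the factor \<open>2\<^sup>s\<close> of the normalisation of \<open>reg_sum\<close> with the factor from
  \<open>clifford_dim_dvd\<close> for \<open>s + 1\<close> involutions.
\<close>
definition dirac_congruent :: "(nat \<Rightarrow> 'b set) \<Rightarrow> (nat \<Rightarrow> 'b set) \<Rightarrow> bool"
  where "dirac_congruent U U' \<longleftrightarrow>
    (\<exists>M0. \<forall>M\<ge>M0. 2 ^ (Suc s div 2 + s) dvd reg_sum s (sdim U) M - reg_sum s (sdim U') M)"

lemma dirac_congruent_refl: "dirac_congruent U U"
  by (simp add: dirac_congruent_def)

lemma dirac_congruent_trans:
  assumes "dirac_congruent U V" "dirac_congruent V W"
  shows "dirac_congruent U W"
proof -
  obtain M1 where M1: "\<And>M. M \<ge> M1 \<Longrightarrow> 2 ^ (Suc s div 2 + s) dvd reg_sum s (sdim U) M - reg_sum s (sdim V) M"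
    using assms(1) by (auto simp: dirac_congruent_def)
  obtain M2 where M2: "\<And>M. M \<ge> M2 \<Longrightarrow> 2 ^ (Suc s div 2 + s) dvd reg_sum s (sdim V) M - reg_sum s (sdim W) M"
    using assms(2) by (auto simp: dirac_congruent_def)
  show ?thesis unfolding dirac_congruent_def
  proof (intro exI allI impI)
    fix M assume "M \<ge> max M1 M2"
    then show "2 ^ (Suc s div 2 + s) dvd reg_sum s (sdim U) M - reg_sum s (sdim W) M"
      using dvd_add[OF M1[of M] M2[of M]] by simp
  qed
qed

lemma reg_sum_eventually_const:
  assumes "graded_submodule s U" "noetherian s U (\<lambda>_. {0})"
  shows "\<exists>M0. \<forall>M\<ge>M0. reg_sum s (sdim U) (Suc M) = reg_sum s (sdim U) M"
proof -
  have "graded_submodule s (\<lambda>_. {0})" by (auto simp: graded_submodule_def y_zero)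
  moreover have "(\<lambda>_. {0}) \<le> U" using graded_submoduleD(1)[OF assms(1)] by (auto simp: le_fun_def subspace_0)
  ultimately have "\<exists>M. \<forall>m\<ge>M. (pair_sum ^^ s) (\<lambda>m. sdim U m - sdim (\<lambda>_. {0}) m) m = 0"
    using hilbert_function assms by blast
  moreover have "sdim (\<lambda>_. {0}) = (\<lambda>_. 0)" by (simp add: sdim_def fun_eq_iff)
  ultimately show ?thesis by (simp add: reg_sum_Suc)
qed

text \<open>
  The families \<open>K\<close> and \<open>I\<close> of the proof are the cycles and boundaries of the differential \<open>D\<close> on \<open>U / U'\<close>,
  pulled back to \<open>U\<close>. The \<open>g\<^sub>j\<close> preserve both, so the dimensions of both are divisible. As
  \<open>2 y\<^sub>b u = D (c\<^sub>b u) + c\<^sub>b (D u)\<close>, the variables map \<open>K\<close> into \<open>I\<close>, and so \<open>K\<close> and \<open>I\<close> agree in large degrees.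
  By rank and nullity, \<open>U\<close> and \<open>U'\<close> differ as \<open>K\<close> and \<open>I\<close> do.
\<close>
lemma dirac_congruence:
  assumes U: "dirac_submodule U" and U': "dirac_submodule U'" and le: "U' \<le> U"
    and DD: "\<And>m u. u \<in> U m \<Longrightarrow> D (D u) \<in> U' (Suc (Suc m))"
    and noeth: "noetherian s U (\<lambda>_. {0})"
  shows "dirac_congruent U U'"
proof -
  note sU = graded_submoduleD[OF dirac_submoduleD(1)[OF U]] and sU' = graded_submoduleD[OF dirac_submoduleD(1)[OF U']]
  note dU = dirac_submoduleD(2-4)[OF U] and dU' = dirac_submoduleD(2-4)[OF U']
  have leD: "u \<in> U' m \<Longrightarrow> u \<in> U m" for u m using le by (auto simp: le_fun_def)
  define K where "K m = {u \<in> U m. D u \<in> U' (Suc m)}" for m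
  define I where "I m = set_sum (U' m) (shift_image D U m)" for m
  have S: "subspace (shift_image D U m)" "shift_image D U m \<subseteq> U m" for m
    using subspace_shift_image[OF D_linear sU(1)] dU(3) subspace_0[OF sU(1)] by (auto simp: shift_image_def split: nat.splits)
  have S_y: "y b w \<in> shift_image D U (Suc m)" if w: "w \<in> shift_image D U m" "b < s" for b w m
  proof (cases m)
    case 0 then show ?thesis using w subspace_0[OF sU(1)] D_zero by (auto simp: y_zero image_iff intro!: bexI[of _ 0])
  next
    case (Suc m')
    then obtain v where "v \<in> U m'" "w = D v" using w Suc by auto
    then show ?thesis using Suc sU(3)[of b v m'] w(2) D_y[of b v] by (metis imageI shift_image_simps(2))
  qed
  have S_g: "g j w \<in> shift_image D U m" if w: "w \<in> shift_image D U m" "j < Suc s" for j w m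
  proof (cases m)
    case 0 then show ?thesis using w g_zero by auto
  next
    case (Suc m')
    then obtain v where v: "v \<in> U m'" "w = D v" using w by auto
    have "g j w = D (g j v) \<or> g j w = D (- g j v)"
      using D_g[OF w(2), of v] v(2) D_neg[of "g j v"] by (metis minus_minus)
    moreover have "g j v \<in> U m'" "- g j v \<in> U m'" using dU(2)[OF w(2) v(1)] subspace_neg[OF sU(1)] by auto
    ultimately show ?thesis using Suc by auto
  qed
  have K_sub: "graded_submodule s K" unfolding graded_submodule_def
  proof (intro allI conjI impI ballI)
    fix m
    show "subspace (K m)" unfolding K_def by (rule subspace_vimage_Int[OF D_linear sU(1) sU'(1)])
    show "fin_dim (K m)" by (rule fin_dim_subset[OF sU(2)[of m]]) (auto simp: K_def)
    fix b u assume "b < s" "u \<in> K m"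
    then show "y b u \<in> K (Suc m)" using sU(3)[of b u m] sU'(3)[of b "D u" "Suc m"] by (simp add: K_def D_y)
  qed
  have I_sub: "graded_submodule s I" unfolding graded_submodule_def
  proof (intro allI conjI impI ballI)
    fix m
    show "subspace (I m)" unfolding I_def by (intro subspace_set_sum sU' S)
    show "fin_dim (I m)" unfolding I_def by (intro fin_dim_set_sum sU' fin_dim_shift_image D_linear sU)
    fix b u assume b: "b < s" and "u \<in> I m"
    then obtain x w where x: "x \<in> U' m" "w \<in> shift_image D U m" "u = x + w" by (auto simp: I_def set_sum_def)
    show "y b u \<in> I (Suc m)"
      using S_y[OF x(2) b] sU'(3)[OF b x(1)] unfolding I_def x(3) y_add set_sum_def by auto
  qed
  note sK = graded_submoduleD[OF K_sub] and sI = graded_submoduleD[OF I_sub]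
  have KU: "K \<le> U" by (auto simp: K_def le_fun_def)
  have SK: "shift_image D U m \<subseteq> K m" for m
  proof (cases m)
    case 0 then show ?thesis using subspace_0[OF sK(1)] by auto
  next
    case (Suc m') then show ?thesis using dU(3) DD by (auto simp: K_def)
  qed
  have U'K: "U' m \<subseteq> K m" for m using leD dU'(3) by (auto simp: K_def)
  have IK: "I \<le> K" using set_sum_least[OF U'K SK sK(1)] by (simp add: I_def le_fun_def)
  have U'I: "U' m \<subseteq> I m" and DI: "u \<in> U m \<Longrightarrow> D u \<in> I (Suc m)" for m u
    using set_sum_left[OF S(1)] set_sum_right[OF sU'(1), of "D ` U m" "Suc m"] by (auto simp: I_def)
  have K_dvd: "2 ^ (Suc s div 2) dvd dim (K m)" for m
  proof (rule g_invariant_dim_dvd[OF sK(1,2)])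
    fix j u assume j: "j < Suc s" and u: "u \<in> K m"
    have "g j (D u) \<in> U' (Suc m)" using dU'(2)[OF j] u by (simp add: K_def)
    then have "D (g j u) \<in> U' (Suc m)" using D_g[OF j, of u] subspace_neg[OF sU'(1)] by auto
    then show "g j u \<in> K m" using dU(2)[OF j] u by (simp add: K_def)
  qed
  have I_dvd: "2 ^ (Suc s div 2) dvd dim (I m)" for m
  proof (rule g_invariant_dim_dvd[OF sI(1,2)])
    fix j u assume j: "j < Suc s" and "u \<in> I m"
    then obtain x w where x: "x \<in> U' m" "w \<in> shift_image D U m" "u = x + w" by (auto simp: I_def set_sum_def)
    show "g j u \<in> I m"
      using S_g[OF x(2) j] dU'(2)[OF j x(1)] unfolding I_def x(3) g_add set_sum_def by auto
  qed
  have yKI: "y b u \<in> I (Suc m)" if b: "b < s" and u: "u \<in> K m" for b u m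
  proof -
    have "D (c b u) \<in> I (Suc m)" using DI dU(1)[OF b] u by (simp add: K_def)
    moreover have "c b (D u) \<in> I (Suc m)" using U'I dU'(1)[OF b] u by (auto simp: K_def)
    ultimately have "(1/2) *s (2 *s y b u) \<in> I (Suc m)"
      unfolding D_c[OF b, symmetric] by (intro subspace_scale subspace_add sI(1))
    then show ?thesis using two by simp
  qed
  \<comment> \<open>Every family between \<open>I\<close> and \<open>K\<close> is stable under the variables, so the chain condition over \<open>s\<close> variables is one without variables.\<close>
  have "noetherian 0 K I" unfolding noetherian_def
  proof (intro allI impI)
    fix C assume C: "\<forall>n. graded_submodule 0 (C n) \<and> I \<le> C n \<and> C n \<le> K \<and> C n \<le> C (Suc n)"
    have CD: "C n m \<subseteq> K m" "I m \<subseteq> C n m" for n m using C by (auto simp: le_fun_def)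
    have "graded_submodule s (C n)" for n
      using C yKI CD unfolding graded_submodule_def by (meson subsetD)
    moreover have "noetherian s K I"
      by (rule noetherian_subinterval[OF noeth _ KU]) (use sI(1) in \<open>auto simp: le_fun_def subspace_0\<close>)
    ultimately show "\<exists>N. \<forall>n\<ge>N. C n = C N" using C unfolding noetherian_def by blast
  qed
  then obtain M1 where M1: "\<And>m. m \<ge> M1 \<Longrightarrow> K m = I m"
    using noetherian_0_eventually_eq[of K I] IK graded_submodule_mono[OF K_sub] graded_submodule_mono[OF I_sub] by blast
  have "noetherian s I (\<lambda>_. {0})" "noetherian s U' (\<lambda>_. {0})"
    using noetherian_subinterval[OF noeth order_refl] IK KU le order_trans by blast+
  then obtain M2 M3 where M2: "\<And>M. M \<ge> M2 \<Longrightarrow> reg_sum s (sdim I) (Suc M) = reg_sum s (sdim I) M"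
    and M3: "\<And>M. M \<ge> M3 \<Longrightarrow> reg_sum s (sdim U') (Suc M) = reg_sum s (sdim U') M"
    using reg_sum_eventually_const[OF I_sub] reg_sum_eventually_const[OF dirac_submoduleD(1)[OF U']] by blast
  have *: "reg_sum s (sdim U) M - reg_sum s (sdim K) M = reg_sum s (sdim U') (Suc M) - reg_sum s (sdim I) (Suc M)" for M
  proof (rule reg_sum_shift)
    show "sdim U m - sdim K m = sdim U' (Suc m) - sdim I (Suc m)" for m
      using sdim_rank_nullity[of D U U' m, OF D_linear sU(1,2) sU'(1,2)]
      by (simp add: K_def[abs_def] I_def[abs_def])
    have "I 0 = U' 0" by (auto simp: I_def set_sum_def)
    then show "sdim U' 0 = sdim I 0" by (simp add: sdim_def)
  qed
  define T where "T = (\<Sum>m<M1. sdim K m - sdim I m)"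
  have "int (2 ^ (Suc s div 2)) dvd sdim K m - sdim I m" for m
    unfolding sdim_def using K_dvd I_dvd by (intro dvd_diff dvd_mult) (simp_all only: int_dvd_int_iff)
  then have T: "2 ^ (Suc s div 2) dvd T" unfolding T_def by (intro dvd_sum) simp
  have "partial_sum (\<lambda>m. sdim K m - sdim I m) M = T" if "M \<ge> M1" for M
    unfolding partial_sum_def T_def
    by (rule sum.mono_neutral_right) (use that M1 in \<open>auto simp: sdim_def\<close>)
  then have KI: "reg_sum s (sdim K) M - reg_sum s (sdim I) M = 2 ^ s * T" if "M \<ge> M1" for M
    using pair_sum_pow_const_from[of M1 _ T M s] that fun_cong[OF reg_sum_diff[of s "sdim K" "sdim I"], of M]
    by (simp add: reg_sum_def)
  show ?thesis unfolding dirac_congruent_def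
  proof (intro exI allI impI)
    fix M assume "M \<ge> max M1 (max M2 M3)"
    then have "reg_sum s (sdim U) M - reg_sum s (sdim U') M = 2 ^ s * T"
      using *[of M] KI[of M] M2[of M] M3[of M] by simp
    then show "2 ^ (Suc s div 2 + s) dvd reg_sum s (sdim U) M - reg_sum s (sdim U') M"
      using T by (simp add: power_add mult.commute mult_dvd_mono)
  qed
qed

end

section \<open>Complexes whose homology is torsion\<close>

text \<open>
  A differential \<open>d\<close> of degree \<open>1\<close> on the module \<open>W\<close>, which is generated in degree \<open>0\<close>. The assumption
  \<open>torsion_homology\<close> says that \<open>q\<^sup>N\<close>, written as \<open>D\<^sup>2\<^sup>N\<close>, kills the homology of \<open>d\<close>.
\<close>
locale dirac_complex = dirac_module scale y s c g D
  for scale :: "'a::field \<Rightarrow> 'b::ab_group_add \<Rightarrow> 'b"  (infixr \<open>*s\<close> 75)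
    and y :: "nat \<Rightarrow> 'b \<Rightarrow> 'b" and s :: nat and c g :: "nat \<Rightarrow> 'b \<Rightarrow> 'b" and D :: "'b \<Rightarrow> 'b" +
  fixes d :: "'b \<Rightarrow> 'b" and W :: "nat \<Rightarrow> 'b set"
  assumes d_linear: "linear_op d"
    and d_y: "d (y b u) = y b (d u)" and d_c: "d (c b u) = c b (d u)"
    and d_g: "d (g b u) = g b (d u)" and d_D: "d (D u) = D (d u)"
    and d_d: "d (d u) = 0"
    and W_dirac: "dirac_submodule W"
    and W_d: "u \<in> W m \<Longrightarrow> d u \<in> W (Suc m)"
    and W_generated: "W (Suc m) \<subseteq> span (\<Union>b<s. y b ` W m)"
    and torsion_homology: "\<exists>N. \<forall>m. \<forall>z\<in>W m. d z = 0 \<longrightarrow> (D ^^ (2 * N)) z \<in> shift_image d W (m + 2 * N)"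
begin

lemmas W_sub = graded_submoduleD[OF dirac_submoduleD(1)[OF W_dirac]]

lemma d_zero: "d 0 = 0"
  using module_hom.zero[OF Vector_Spaces.linear.axioms(3)[OF d_linear]] .

text \<open>
  With \<open>J\<^sub>k\<close> the submodule generated by the products with the variables from \<open>k\<close> on, induction on \<open>k\<close> shows that
  \<open>W / J\<^sub>k\<close> is Noetherian over the first \<open>k\<close> variables. It starts with \<open>W / J\<^sub>0\<close>, which is concentrated in
  degree \<open>0\<close>, where it is finite-dimensional.
\<close>
lemma W_noetherian: "noetherian s W (\<lambda>_. {0})"
proof -
  define J where "J k m = (case m of 0 \<Rightarrow> {0} | Suc m' \<Rightarrow> span (\<Union>b\<in>{k..<s}. y b ` W m'))" for k m
  have J_simps: "J k 0 = {0}" "J k (Suc m) = span (\<Union>b\<in>{k..<s}. y b ` W m)" for k m by (simp_all add: J_def)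
  have JW: "J k m \<subseteq> W m" for k m
  proof (cases m)
    case 0 then show ?thesis using subspace_0[OF W_sub(1)] by (simp add: J_simps)
  next
    case (Suc m')
    have "span (\<Union>b\<in>{k..<s}. y b ` W m') \<subseteq> W (Suc m')"
      by (rule span_minimal[OF _ W_sub(1)]) (use W_sub(3) in auto)
    then show ?thesis by (simp add: Suc J_simps)
  qed
  have J_subspace: "subspace (J k m)" for k m by (cases m) (auto simp: J_simps)
  have J_sub: "graded_submodule s (J k)" for k unfolding graded_submodule_def
  proof (intro allI conjI impI ballI)
    fix m
    show "subspace (J k m)" by (rule J_subspace)
    show "fin_dim (J k m)" by (rule fin_dim_subset[OF W_sub(2) JW])
    fix b u assume b: "b < s" and u: "u \<in> J k m"
    show "y b u \<in> J k (Suc m)"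
    proof (cases m)
      case 0 then show ?thesis using u by (simp add: J_simps y_zero span_zero)
    next
      case (Suc m')
      have "span (\<Union>b\<in>{k..<s}. y b ` W m') \<subseteq> {u \<in> UNIV. y b u \<in> J k (Suc m)}"
      proof (rule span_minimal)
        show "(\<Union>b\<in>{k..<s}. y b ` W m') \<subseteq> {u \<in> UNIV. y b u \<in> J k (Suc m)}"
        proof
          fix v assume "v \<in> (\<Union>b\<in>{k..<s}. y b ` W m')"
          then obtain a w where a: "a \<in> {k..<s}" "w \<in> W m'" "v = y a w" by blast
          have "y b v = y a (y b w)" unfolding a(3) by (rule y_commute)
          moreover have "y b w \<in> W m" using W_sub(3)[OF b a(2)] Suc by simp
          ultimately have "y b v \<in> (\<Union>b\<in>{k..<s}. y b ` W m)" using a(1) by blast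
          then show "v \<in> {u \<in> UNIV. y b u \<in> J k (Suc m)}" by (simp add: J_simps span_base)
        qed
        show "subspace {u \<in> UNIV. y b u \<in> J k (Suc m)}"
          by (intro subspace_vimage_Int y_linear subspace_UNIV J_subspace)
      qed
      then show ?thesis using u Suc by (auto simp: J_simps)
    qed
  qed
  have "noetherian k W (J k)" if "k \<le> s" for k
    using that
  proof (induction k)
    case 0
    show ?case unfolding noetherian_def
    proof (intro allI impI)
      fix C assume C: "\<forall>n. graded_submodule 0 (C n) \<and> J 0 \<le> C n \<and> C n \<le> W \<and> C n \<le> C (Suc n)"
      have C_mono: "C n m \<subseteq> C n' m" if "n \<le> n'" for n n' m
        using lift_Suc_mono_le[of C n n'] C that by (auto simp: le_fun_def)
      have CW: "C n m \<subseteq> W m" and JC: "J 0 m \<subseteq> C n m" for n m using C by (auto simp: le_fun_def)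
      have sC: "subspace (C n m)" for n m using C by (auto simp: graded_submodule_def)
      have pos: "C n (Suc m) = W (Suc m)" for n m
        using CW[of n "Suc m"] JC[of "Suc m" n] W_generated[of m] by (auto simp: J_simps atLeast0LessThan)
      \<comment> \<open>In degree 0 the chain consists of subspaces of a finite-dimensional space; take a largest one.\<close>
      have bound: "dim (C n 0) \<le> dim (W 0)" for n by (rule fin_dim_dim_mono[OF W_sub(2) CW])
      define P where "P = range (\<lambda>n. dim (C n 0))"
      have "finite P" using bound by (auto simp: P_def intro!: finite_subset[of _ "{..dim (W 0)}"])
      then have "Max P \<in> P" by (intro Max_in) (auto simp: P_def)
      then obtain N where N: "dim (C N 0) = Max P" by (auto simp: P_def)
      have zero: "C n 0 = C N 0" if n: "n \<ge> N" for n
      proof -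
        have "dim (C n 0) \<le> dim (C N 0)" unfolding N using \<open>finite P\<close> by (intro Max_ge) (auto simp: P_def)
        moreover have f: "fin_dim (C n 0)" by (rule fin_dim_subset[OF W_sub(2) CW])
        ultimately have "dim (C N 0) = dim (C n 0)" using fin_dim_dim_mono[OF f C_mono[OF n]] by simp
        then show ?thesis using subspace_eq_of_dim_eq[OF f C_mono[OF n] sC] by simp
      qed
      have "C n m = C N m" if "n \<ge> N" for n m
        using zero[OF that] pos by (cases m) simp_all
      then show "\<exists>N. \<forall>n\<ge>N. C n = C N" by (intro exI[of _ N] allI impI ext)
    qed
  next
    case (Suc k)
    have "(\<lambda>m. set_sum (J (Suc k) m) (shift_image (y k) W m)) = J k"
    proof
      fix m show "set_sum (J (Suc k) m) (shift_image (y k) W m) = J k m"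
      proof (cases m)
        case 0 then show ?thesis by (simp add: J_simps)
      next
        case (Suc m')
        have "{k..<s} = insert k {Suc k..<s}" using Suc.prems by auto
        then have "(\<Union>b\<in>{k..<s}. y b ` W m') = y k ` W m' \<union> (\<Union>b\<in>{Suc k..<s}. y b ` W m')" by auto
        moreover have "set_sum (span A) B = span (B \<union> A)" if "subspace B" for A B
        proof
          show "set_sum (span A) B \<subseteq> span (B \<union> A)"
            by (intro set_sum_least subspace_span) (use span_mono[of A "B \<union> A"] span_superset[of "B \<union> A"] in auto)
          show "span (B \<union> A) \<subseteq> set_sum (span A) B"
            using set_sum_left[OF that, of "span A"] set_sum_right[OF subspace_span, of B A] span_superset[of A]
            by (intro span_minimal subspace_set_sum subspace_span that) blast
        qed
        ultimately show ?thesis using subspace_image_op[OF y_linear W_sub(1)] by (simp add: Suc J_simps)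
      qed
    qed
    then have "noetherian k W (\<lambda>m. set_sum (J (Suc k) m) (shift_image (y k) W m))" using Suc by simp
    then show ?case
      using noetherian_step graded_submodule_mono[OF dirac_submoduleD(1)[OF W_dirac] Suc.prems]
        graded_submodule_mono[OF J_sub Suc.prems] by blast
  qed
  then have "noetherian s W (J s)" by simp
  moreover have "J s = (\<lambda>_. {0})" by (auto simp: J_def fun_eq_iff split: nat.splits)
  ultimately show ?thesis by simp
qed

text \<open>
  The modules \<open>V\<^sub>k\<close> of all cycles \<open>z\<close> such that \<open>q\<^sup>k z\<close> is a boundary increase from the boundaries to all
  cycles, and \<open>q V\<^sub>k\<^sub>+\<^sub>1 \<subseteq> V\<^sub>k\<close>. So cycles and boundaries are congruent, and the regularised sum of \<open>W\<close> is
  the difference of theirs, since \<open>d\<close> shifts the degree by one and thus changes the sign.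
\<close>
theorem reg_sum_dvd: "\<exists>M0. \<forall>M\<ge>M0. 2 ^ (Suc s div 2 + s) dvd reg_sum s (sdim W) M"
proof -
  define Z where "Z m = {w \<in> W m. d w = 0}" for m
  define B where "B = shift_image d W"
  have Z_subspace: "subspace (Z m)" for m
    using subspace_vimage_Int[OF d_linear W_sub(1) subspace_single_0, of m] by (simp add: Z_def)
  note dW = dirac_submoduleD(2-4)[OF W_dirac]
  have B_eq: "B 0 = {0}" "B (Suc m) = d ` W m" for m by (simp_all add: B_def)
  have B_subspace: "subspace (B m)" for m unfolding B_def by (rule subspace_shift_image[OF d_linear W_sub(1)])
  have BZ: "B m \<subseteq> Z m" for m
    using W_d d_d subspace_0[OF W_sub(1)] d_zero by (cases m) (auto simp: B_eq Z_def)
  have c0: "c b 0 = 0" for b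
    using module_hom.zero[OF Vector_Spaces.linear.axioms(3)[OF c_linear]] .
  have B_dirac: "dirac_submodule B" unfolding dirac_submodule_def graded_submodule_def
  proof (intro conjI allI ballI impI)
    fix m
    show "subspace (B m)" by (rule B_subspace)
    show "fin_dim (B m)" by (rule fin_dim_subset[OF W_sub(2)[of m]]) (use BZ in \<open>auto simp: Z_def\<close>)
    fix u assume u: "u \<in> B m"
    have W0: "0 \<in> W n" for n by (rule subspace_0[OF W_sub(1)])
    show "y b u \<in> B (Suc m)" if "b < s" for b
      using u W0 W_sub(3)[OF that] by (cases m) (auto simp: B_eq y_zero d_y[symmetric] image_iff d_zero intro: bexI[of _ 0])
    show "D u \<in> B (Suc m)"
      using u W0 dW(3) by (cases m) (auto simp: B_eq D_zero d_D[symmetric] image_iff d_zero intro: bexI[of _ 0])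
    show "c b u \<in> B m" if "b < s" for b
      using u dW(1)[OF that] by (cases m) (auto simp: B_eq c0 d_c[symmetric])
    show "g j u \<in> B m" if "j < Suc s" for j
      using u dW(2)[OF that] by (cases m) (auto simp: B_eq g_zero d_g[symmetric])
  qed
  note sB = graded_submoduleD[OF dirac_submoduleD(1)[OF B_dirac]] and dB = dirac_submoduleD(2-4)[OF B_dirac]
  have DD_c: "D (D (c b u)) = c b (D (D u))" if "b < s" for b u
  proof -
    have "D (c b u) = 2 *s y b u - c b (D u)" "D (c b (D u)) = 2 *s y b (D u) - c b (D (D u))"
      using D_c[OF that, of u] D_c[OF that, of "D u"] by (simp_all add: eq_diff_eq)
    then show ?thesis using D_add[of "D (c b u)" "c b (D u)"] D_c[OF that, of u] by (simp add: D_scale D_y)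
  qed
  define q where "q k = D ^^ (2 * k)" for k
  have q_lin: "linear_op (q k)" for k unfolding q_def by (rule linear_op_funpow[OF D_linear])
  have q_neg: "q k (- u) = - q k u" for k u
    using module_hom.neg[OF Vector_Spaces.linear.axioms(3)[OF q_lin]] .
  have q_0: "q 0 u = u" and q_Suc: "q (Suc k) u = D (D (q k u))" and q_Suc': "q (Suc k) u = q k (D (D u))" for k u
    by (simp_all add: q_def funpow_swap1)
  have q_c: "q k (c b u) = c b (q k u)" if "b < s" for k b u
    by (induction k) (simp_all add: q_0 q_Suc DD_c[OF that])
  have q_y: "q k (y b u) = y b (q k u)" for k b u
    by (induction k) (simp_all add: q_0 q_Suc D_y)
  have q_D: "q k (D u) = D (q k u)" for k u
    by (induction k) (simp_all add: q_0 q_Suc)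
  have DD_g: "D (D (g j u)) = g j (D (D u))" if "j < Suc s" for j u
    using D_g_sign[OF that] by (auto simp: D_neg)
  have q_g: "q k (g j u) = g j (q k u)" if "j < Suc s" for k j u
    by (induction k) (simp_all add: q_0 q_Suc DD_g[OF that])
  define V where "V k m = {w \<in> Z m. q k w \<in> B (m + 2 * k)}" for k m
  have V_dirac: "dirac_submodule (V k)" for k unfolding dirac_submodule_def graded_submodule_def
  proof (intro conjI allI ballI impI)
    fix m
    show "subspace (V k m)" unfolding V_def by (rule subspace_vimage_Int[OF q_lin Z_subspace B_subspace])
    show "fin_dim (V k m)" by (rule fin_dim_subset[OF W_sub(2)[of m]]) (auto simp: V_def Z_def)
    fix u assume u: "u \<in> V k m"
    show "y b u \<in> V k (Suc m)" if "b < s" for b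
      using u W_sub(3)[OF that] sB(3)[OF that] by (auto simp: V_def Z_def q_y d_y y_zero)
    show "D u \<in> V k (Suc m)"
      using u dW(3) dB(3) by (auto simp: V_def Z_def q_D d_D D_zero)
    show "c b u \<in> V k m" if "b < s" for b
      using u dW(1)[OF that] dB(1)[OF that] by (auto simp: V_def Z_def q_c[OF that] d_c c0)
    show "g j u \<in> V k m" if "j < Suc s" for j
      using u dW(2)[OF that] dB(2)[OF that] by (auto simp: V_def Z_def q_g[OF that] d_g g_zero)
  qed
  have noeth_le: "noetherian s Y (\<lambda>_. {0})" if "Y \<le> W" for Y
    by (rule noetherian_subinterval[OF W_noetherian order_refl that])
  have step: "dirac_congruent (V (Suc k)) (V k)" for k
  proof (rule dirac_congruence[OF V_dirac V_dirac])
    show "V k \<le> V (Suc k)" using dB(3) by (auto simp: V_def le_fun_def q_Suc)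
    show "D (D u) \<in> V k (Suc (Suc m))" if "u \<in> V (Suc k) m" for m u
      using that dW(3) by (auto simp: V_def Z_def d_D D_zero q_Suc')
    show "noetherian s (V (Suc k)) (\<lambda>_. {0})" by (rule noeth_le) (auto simp: V_def Z_def le_fun_def)
  qed
  have chain: "dirac_congruent (V k) (V 0)" for k
    by (induction k) (use dirac_congruent_refl dirac_congruent_trans step in blast)+
  have V0: "V 0 = B" using BZ by (auto simp: V_def q_0 fun_eq_iff)
  obtain N where "\<And>m z. z \<in> Z m \<Longrightarrow> q N z \<in> B (m + 2 * N)"
    using torsion_homology unfolding Z_def B_def q_def by blast
  then have VN: "V N = Z" by (auto simp: V_def fun_eq_iff)
  have "dirac_congruent Z B" using chain[of N] V0 VN by simp
  then obtain M1 where M1: "\<And>M. M \<ge> M1 \<Longrightarrow> 2 ^ (Suc s div 2 + s) dvd reg_sum s (sdim Z) M - reg_sum s (sdim B) M"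
    by (auto simp: dirac_congruent_def)
  have "B \<le> W" using BZ by (auto simp: Z_def le_fun_def)
  then obtain M2 where M2: "\<And>M. M \<ge> M2 \<Longrightarrow> reg_sum s (sdim B) (Suc M) = reg_sum s (sdim B) M"
    using reg_sum_eventually_const[OF dirac_submoduleD(1)[OF B_dirac] noeth_le] by blast
  have *: "reg_sum s (sdim Z) M - reg_sum s (sdim W) M
      = reg_sum s (sdim B) (Suc M) - reg_sum s (sdim (\<lambda>_. {0})) (Suc M)" for M
  proof (rule reg_sum_shift)
    have B': "(\<lambda>m. set_sum {0} (shift_image d W m)) = B" by (simp add: B_def)
    show "sdim Z m - sdim W m = sdim B (Suc m) - sdim (\<lambda>_. {0}) (Suc m)" for m
      using sdim_rank_nullity[of d W "\<lambda>_. {0}" m, OF d_linear W_sub(1,2) subspace_single_0 fin_dim_zero] unfolding B'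
      by (simp add: Z_def[abs_def])
    show "sdim B 0 = sdim (\<lambda>_. {0}) 0" by (simp add: sdim_def B_eq)
  qed
  have z: "reg_sum s (sdim (\<lambda>_. {0})) M = 0" for M
    using pair_sum_pow_const_from[of 0 "partial_sum (sdim (\<lambda>_. {0}))" 0 M s] by (simp add: reg_sum_def partial_sum_def sdim_def)
  show ?thesis
  proof (intro exI allI impI)
    fix M assume "M \<ge> max M1 M2"
    then show "2 ^ (Suc s div 2 + s) dvd reg_sum s (sdim W) M" 
      using *[of M] z M1[of M] M2[of M] by (simp add: algebra_simps)
  qed
qed

end

section \<open>Sign operators on functions of finite sets\<close>

definition neg_if :: "bool \<Rightarrow> 'b \<Rightarrow> 'b::group_add"
  where "neg_if p x = (if p then - x else x)"

lemma neg_if_add: "neg_if p (x + y) = neg_if p x + neg_if p (y::'b::ab_group_add)"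
  by (simp add: neg_if_def)

lemma neg_if_zero [simp]: "neg_if p 0 = 0"
  by (simp add: neg_if_def)

lemma neg_if_neg_if: "neg_if p (neg_if q x) = neg_if (p \<noteq> q) x"
  by (auto simp: neg_if_def)

lemma neg_if_mult: "neg_if p (a * b) = a * neg_if p (b::'b::comm_ring_1)"
  by (simp add: neg_if_def)

lemma neg_if_sum: "neg_if p (sum f A) = (\<Sum>a\<in>A. neg_if p (f a :: 'b::ab_group_add))"
  by (simp add: neg_if_def sum_negf)

lemma neg_if_apply: "neg_if p f x = neg_if p (f x)"
  by (simp add: neg_if_def)

definition flip :: "nat \<Rightarrow> nat set \<Rightarrow> nat set"
  where "flip b L = (if b \<in> L then L - {b} else insert b L)"

lemma flip_flip [simp]: "flip b (flip b L) = L"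
  by (auto simp: flip_def)

lemma flip_commute: "flip a (flip b L) = flip b (flip a L)"
  by (auto simp: flip_def)

lemma mem_flip: "a \<in> flip b L \<longleftrightarrow> (if a = b then a \<notin> L else a \<in> L)"
  by (auto simp: flip_def)

text \<open>
  A function on sets of natural numbers stands for the coefficients of an element of an exterior algebra.
  All operators needed add or remove one generator, up to a sign given by a parity of this kind.
\<close>
definition parity :: "(nat \<Rightarrow> bool) \<Rightarrow> nat set \<Rightarrow> bool"
  where "parity P L \<longleftrightarrow> odd (card {a \<in> L. P a})"

lemma parity_flip:
  assumes "finite {a. P a}"
  shows "parity P (flip b L) \<longleftrightarrow> (parity P L \<noteq> P b)"
proof -
  have fin: "finite {a \<in> L. P a}" by (rule finite_subset[OF _ assms]) auto
  show ?thesis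
  proof (cases "P b")
    case False
    then have "{a \<in> flip b L. P a} = {a \<in> L. P a}" by (auto simp: flip_def)
    then show ?thesis using False by (simp add: parity_def)
  next
    case True
    show ?thesis
    proof (cases "b \<in> L")
      case b: True
      then have "{a \<in> L. P a} = insert b {a \<in> flip b L. P a}" "b \<notin> {a \<in> flip b L. P a}"
        using True by (auto simp: flip_def)
      moreover have "finite {a \<in> flip b L. P a}" using fin by (rule rev_finite_subset) (use b in \<open>auto simp: flip_def\<close>)
      ultimately show ?thesis using True by (simp add: parity_def)
    next
      case False
      then have "{a \<in> flip b L. P a} = insert b {a \<in> L. P a}" using True by (auto simp: flip_def)
      then show ?thesis using True False fin by (simp add: parity_def)
    qed
  qed
qed

text \<open>
  Adding or removing the generator \<open>b\<close>. With \<open>P a = (a < b)\<close> this is the sum of the exterior product with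
  \<open>b\<close> and the contraction against \<open>b\<close>. Choosing the generators above \<open>b\<close> instead counts from the other end
  and gives the operators that commute with the first ones.
\<close>
definition signed_flip :: "(nat \<Rightarrow> bool) \<Rightarrow> nat \<Rightarrow> (nat set \<Rightarrow> 'b) \<Rightarrow> nat set \<Rightarrow> 'b::ab_group_add"
  where "signed_flip P b f L = neg_if (parity P L) (f (flip b L))"

lemma signed_flip_signed_flip:
  assumes "finite {x. Q x}"
  shows "signed_flip P a (signed_flip Q b f) L = neg_if (parity P L \<noteq> (parity Q L \<noteq> Q a)) (f (flip a (flip b L)))"
  by (simp add: signed_flip_def neg_if_neg_if parity_flip[OF assms] flip_commute[of a b])

text \<open>
  Whether two such operators commute or anticommute depends on whether each of them sees the generator that
  the other one changes.
\<close>
lemma signed_flip_commute: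
  assumes "finite {x. P x}" "finite {x. Q x}" "P b = Q a"
  shows "signed_flip P a (signed_flip Q b f) = signed_flip Q b (signed_flip P a f)"
  unfolding fun_eq_iff signed_flip_signed_flip[OF assms(1)] signed_flip_signed_flip[OF assms(2)]
  using assms(3) by (auto simp: flip_commute[of a b] neg_if_def)

lemma signed_flip_anticommute:
  assumes "finite {x. P x}" "finite {x. Q x}" "P b \<noteq> Q a"
  shows "signed_flip P a (signed_flip Q b f) = - signed_flip Q b (signed_flip P a f)"
  unfolding fun_eq_iff uminus_apply signed_flip_signed_flip[OF assms(1)] signed_flip_signed_flip[OF assms(2)]
  using assms(3) by (auto simp: flip_commute[of a b] neg_if_def)

lemma signed_flip_involution:
  assumes "finite {x. P x}" "\<not> P b"
  shows "signed_flip P b (signed_flip P b f) = f"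
  unfolding fun_eq_iff signed_flip_signed_flip[OF assms(1)] using assms(2) by (simp add: neg_if_def)

section \<open>Exterior products and contractions\<close>

definition create :: "nat \<Rightarrow> (nat set \<Rightarrow> 'r) \<Rightarrow> nat set \<Rightarrow> 'r::comm_ring_1"
  where "create j f J = (if j \<in> J then signed_flip (\<lambda>a. a < j) j f J else 0)"

definition annihilate :: "nat \<Rightarrow> (nat set \<Rightarrow> 'r) \<Rightarrow> nat set \<Rightarrow> 'r::comm_ring_1"
  where "annihilate j f J = (if j \<in> J then 0 else signed_flip (\<lambda>a. a < j) j f J)"

lemma fin_less: "finite {a::nat. a < j}" by simp

lemma create_create: "create j (create k f) J = - create k (create j f) J"
  by (cases "j = k") (auto simp: create_def signed_flip_def mem_flip neg_if_def parity_flip[OF fin_less] flip_commute[of j k])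

lemma create_annihilate: "j \<noteq> k \<Longrightarrow> create j (annihilate k f) J = - annihilate k (create j f) J"
  by (auto simp: create_def annihilate_def signed_flip_def mem_flip neg_if_def parity_flip[OF fin_less] flip_commute[of j k])

lemma create_annihilate_same: "create j (annihilate j f) J + annihilate j (create j f) J = f J"
  by (auto simp: create_def annihilate_def signed_flip_def mem_flip neg_if_def parity_flip[OF fin_less])

lemma create_lincomb: "create j (\<lambda>J. \<Sum>k\<in>S. v k * h k J) J = (\<Sum>k\<in>S. v k * create j (h k) J)"
  by (simp add: create_def signed_flip_def neg_if_sum neg_if_mult)

lemma annihilate_lincomb: "annihilate j (\<lambda>J. \<Sum>k\<in>S. v k * h k J) J = (\<Sum>k\<in>S. v k * annihilate j (h k) J)"
  by (simp add: annihilate_def signed_flip_def neg_if_sum neg_if_mult)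

definition wedge :: "nat \<Rightarrow> (nat \<Rightarrow> 'r) \<Rightarrow> (nat set \<Rightarrow> 'r) \<Rightarrow> nat set \<Rightarrow> 'r::comm_ring_1"
  where "wedge n u f J = (\<Sum>j<n. u j * create j f J)"

definition contract :: "nat \<Rightarrow> (nat \<Rightarrow> 'r) \<Rightarrow> (nat set \<Rightarrow> 'r) \<Rightarrow> nat set \<Rightarrow> 'r::comm_ring_1"
  where "contract n v f J = (\<Sum>j<n. v j * annihilate j f J)"

lemma wedge_wedge: "wedge n u (wedge n v f) J = - wedge n v (wedge n u f) J"
proof -
  have "wedge n u (wedge n v f) J = (\<Sum>j<n. \<Sum>k<n. u j * (v k * create j (create k f) J))"
    unfolding wedge_def[abs_def] create_lincomb by (simp add: sum_distrib_left)
  also have "\<dots> = (\<Sum>k<n. \<Sum>j<n. u j * (v k * create j (create k f) J))" by (rule sum.swap)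
  also have "\<dots> = (\<Sum>k<n. \<Sum>j<n. - (v k * (u j * create k (create j f) J)))"
    by (subst create_create) (simp add: mult.left_commute)
  also have "\<dots> = - wedge n v (wedge n u f) J"
    unfolding wedge_def[abs_def] create_lincomb by (simp add: sum_distrib_left sum_negf)
  finally show ?thesis .
qed

lemma wedge_contract:
  "wedge n u (contract n v f) J + contract n v (wedge n u f) J = (\<Sum>j<n. u j * v j) * f J"
proof -
  have a: "wedge n u (contract n v f) J = (\<Sum>j<n. \<Sum>k<n. u j * (v k * create j (annihilate k f) J))"
    unfolding wedge_def[abs_def] contract_def[abs_def] create_lincomb by (simp add: sum_distrib_left)
  have "contract n v (wedge n u f) J = (\<Sum>k<n. \<Sum>j<n. u j * (v k * annihilate k (create j f) J))"
    unfolding wedge_def[abs_def] contract_def[abs_def] annihilate_lincomb by (simp add: sum_distrib_left mult.left_commute)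
  also have "\<dots> = (\<Sum>j<n. \<Sum>k<n. u j * (v k * annihilate k (create j f) J))" by (rule sum.swap)
  finally have "wedge n u (contract n v f) J + contract n v (wedge n u f) J
      = (\<Sum>j<n. \<Sum>k<n. u j * (v k * (create j (annihilate k f) J + annihilate k (create j f) J)))"
    by (simp add: a sum.distrib[symmetric] distrib_left)
  also have "\<dots> = (\<Sum>j<n. \<Sum>k<n. if j = k then u j * v j * f J else 0)"
    by (intro sum.cong refl) (auto simp: create_annihilate create_annihilate_same)
  also have "\<dots> = (\<Sum>j<n. u j * v j) * f J" by (simp add: sum_distrib_right)
  finally show ?thesis .
qed

lemma wedge_linear:
  "wedge n u (f + h) = wedge n u f + wedge n u h" "wedge n u (\<lambda>J. x * f J) = (\<lambda>J. x * wedge n u f J)"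
  "wedge n u (\<lambda>J. - f J) J = - wedge n u f J"
  by (auto simp: wedge_def create_def signed_flip_def neg_if_def fun_eq_iff sum.distrib[symmetric]
      sum_distrib_left sum_negf[symmetric] algebra_simps intro!: sum.cong)

lemma contract_linear:
  "contract n u (f + h) = contract n u f + contract n u h" "contract n u (\<lambda>J. x * f J) = (\<lambda>J. x * contract n u f J)"
  "contract n u (\<lambda>J. - f J) J = - contract n u f J"
  by (auto simp: contract_def annihilate_def signed_flip_def neg_if_def fun_eq_iff sum.distrib[symmetric]
      sum_distrib_left sum_negf[symmetric] algebra_simps intro!: sum.cong)

lemma wedge_zero: "wedge n u (\<lambda>_. 0) = (\<lambda>_. 0 :: 'r::comm_ring_1)"
proof -
  have "create j (\<lambda>_. 0 :: 'r) J = 0" for j J by (auto simp: create_def signed_flip_def)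
  then show ?thesis by (simp add: wedge_def fun_eq_iff)
qed

lemma wedge_sum: "wedge n u (\<lambda>J. \<Sum>k\<in>S. h k J) J = (\<Sum>k\<in>S. wedge n u (h k) J)"
  unfolding wedge_def create_lincomb[where v = "\<lambda>_. 1", simplified] sum_distrib_left by (rule sum.swap)

lemma contract_zero: "contract n u (\<lambda>_. 0) = (\<lambda>_. 0 :: 'r::comm_ring_1)"
proof -
  have "annihilate j (\<lambda>_. 0 :: 'r) J = 0" for j J by (auto simp: annihilate_def signed_flip_def)
  then show ?thesis by (simp add: contract_def fun_eq_iff)
qed

lemma contract_sum: "contract n u (\<lambda>J. \<Sum>k\<in>S. h k J) J = (\<Sum>k\<in>S. contract n u (h k) J)"
  unfolding contract_def annihilate_lincomb[where v = "\<lambda>_. 1", simplified] sum_distrib_left by (rule sum.swap)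

lemma wedge_nonzero:
  assumes "wedge n u f J \<noteq> 0"
  obtains j where "j < n" "j \<in> J" "f (J - {j}) \<noteq> 0"
proof -
  obtain j where j: "j \<in> {..<n}" "u j * create j f J \<noteq> 0"
    using assms unfolding wedge_def by (rule sum.not_neutral_contains_not_neutral)
  then have "create j f J \<noteq> 0" by auto
  then show ?thesis using that[of j] j(1) by (auto simp: create_def signed_flip_def flip_def neg_if_def split: if_splits)
qed

lemma contract_nonzero:
  assumes "contract n u f J \<noteq> 0"
  obtains j where "j < n" "j \<notin> J" "f (insert j J) \<noteq> 0"
proof -
  obtain j where j: "j \<in> {..<n}" "u j * annihilate j f J \<noteq> 0"
    using assms unfolding contract_def by (rule sum.not_neutral_contains_not_neutral)
  then have "annihilate j f J \<noteq> 0" by auto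
  then show ?thesis using that[of j] j(1) by (auto simp: annihilate_def signed_flip_def flip_def neg_if_def split: if_splits)
qed

text \<open>
  Only the diagonal survives in a double sum whose off-diagonal terms cancel in pairs. Doubling the sum and
  exchanging the order of summation treats all pairs at once, at the cost of dividing by \<open>2\<close>.
\<close>
lemma double_sum_symmetric:
  fixes T :: "nat \<Rightarrow> nat \<Rightarrow> 'r::ab_group_add"
  assumes "\<And>x::'r. x + x = 0 \<Longrightarrow> x = 0"
    and "\<And>a b. a < s \<Longrightarrow> b < s \<Longrightarrow> T a b + T b a = (if a = b then u a + u a else 0)"
  shows "(\<Sum>a<s. \<Sum>b<s. T a b) = (\<Sum>a<s. u a)"
proof -
  have "(\<Sum>a<s. \<Sum>b<s. T a b) + (\<Sum>a<s. \<Sum>b<s. T a b) = (\<Sum>a<s. \<Sum>b<s. T a b) + (\<Sum>b<s. \<Sum>a<s. T a b)"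
    by (subst (2) sum.swap) simp
  also have "\<dots> = (\<Sum>a<s. \<Sum>b<s. T a b + T b a)" by (simp add: sum.distrib)
  also have "\<dots> = (\<Sum>a<s. \<Sum>b<s. if a = b then u a + u a else 0)"
    using assms(2) by (intro sum.cong refl) auto
  also have "\<dots> = (\<Sum>a<s. u a) + (\<Sum>a<s. u a)" by (simp add: sum.distrib)
  finally have "((\<Sum>a<s. \<Sum>b<s. T a b) - (\<Sum>a<s. u a)) + ((\<Sum>a<s. \<Sum>b<s. T a b) - (\<Sum>a<s. u a)) = 0"
    by (simp add: algebra_simps)
  then show ?thesis using assms(1) by (metis eq_iff_diff_eq_0)
qed

lemma sum_upd_Suc:
  assumes "(a::nat) < r"
  shows "(\<Sum>b<r. (\<alpha>(a := Suc (\<alpha> a))) b) = Suc (\<Sum>b<r. \<alpha> b)"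
proof -
  have "(\<Sum>b<r. (\<alpha>(a := Suc (\<alpha> a))) b) = (\<Sum>b<r. \<alpha> b + (if b = a then 1 else 0))"
    by (rule sum.cong) auto
  then show ?thesis using assms by (simp add: sum.distrib)
qed

section \<open>A Koszul complex with torsion homology\<close>

text \<open>
  The rows \<open>A a\<close> are vectors of length \<open>n\<close> that are orthogonal of square \<open>q\<close>, and \<open>H m\<close> stands for the
  homogeneous elements of degree \<open>m\<close>. An element of the sum of the modules \<open>D\<^sup>j(R\<^sup>r) \<otimes> \<Lambda>\<^sup>i\<^sup>-\<^sup>j(R\<^sup>n)\<close> is a
  function of an exponent \<open>\<alpha>\<close>, which indexes a divided power, and of a set \<open>J\<close>.
\<close>
locale koszul =
  fixes r n i :: nat and A :: "nat \<Rightarrow> nat \<Rightarrow> 'r::comm_ring_1" and q :: 'r and H :: "nat \<Rightarrow> 'r set"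
  assumes orthogonal: "a < r \<Longrightarrow> b < r \<Longrightarrow> (\<Sum>j<n. A a j * A b j) = (if a = b then q else 0)"
    and torsion_free: "(x::'r) + x = 0 \<Longrightarrow> x = 0"
    and degrees: "r + i > n"
    and H_zero: "0 \<in> H m" and H_add: "x \<in> H m \<Longrightarrow> x' \<in> H m \<Longrightarrow> x + x' \<in> H m"
    and H_neg: "x \<in> H m \<Longrightarrow> - x \<in> H m"
    and H_A: "a < r \<Longrightarrow> j < n \<Longrightarrow> x \<in> H m \<Longrightarrow> A a j * x \<in> H (Suc m)"
begin

definition koszul_basis :: "((nat \<Rightarrow> nat) \<times> nat set) set"
  where "koszul_basis = {(\<alpha>, J). (\<forall>a\<ge>r. \<alpha> a = 0) \<and> J \<subseteq> {..<n} \<and> (\<Sum>a<r. \<alpha> a) + card J = i}"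

definition koszul_d :: "((nat \<Rightarrow> nat) \<Rightarrow> nat set \<Rightarrow> 'r) \<Rightarrow> (nat \<Rightarrow> nat) \<Rightarrow> nat set \<Rightarrow> 'r"
  where "koszul_d f \<alpha> J = (\<Sum>a<r. wedge n (A a) (f (\<alpha>(a := Suc (\<alpha> a)))) J)"

text \<open>
  A partial homotopy that raises the divided power in one direction and contracts against the corresponding
  vector. With divided powers no multiplicities occur, so no integers have to be inverted.
\<close>
definition koszul_h :: "nat \<Rightarrow> ((nat \<Rightarrow> nat) \<Rightarrow> nat set \<Rightarrow> 'r) \<Rightarrow> (nat \<Rightarrow> nat) \<Rightarrow> nat set \<Rightarrow> 'r"
  where "koszul_h a f \<alpha> J = (if \<alpha> a = 0 then 0 else contract n (A a) (f (\<alpha>(a := \<alpha> a - 1))) J)"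

text \<open>
  The part on which multiplication by \<open>q\<close> is not yet homotopic to zero through direction \<open>a\<close> alone.
\<close>
definition koszul_pi :: "nat \<Rightarrow> ((nat \<Rightarrow> nat) \<Rightarrow> nat set \<Rightarrow> 'r) \<Rightarrow> (nat \<Rightarrow> nat) \<Rightarrow> nat set \<Rightarrow> 'r"
  where "koszul_pi a f \<alpha> J = (if \<alpha> a = 0 then contract n (A a) (wedge n (A a) (f \<alpha>)) J else 0)"

definition koszul_part :: "nat \<Rightarrow> ((nat \<Rightarrow> nat) \<Rightarrow> nat set \<Rightarrow> 'r) set"
  where "koszul_part m = {f. \<forall>\<alpha> J. f \<alpha> J \<in> H m \<and> (f \<alpha> J \<noteq> 0 \<longrightarrow> (\<alpha>, J) \<in> koszul_basis)}"

lemma H_sum: "(\<And>x. x \<in> S \<Longrightarrow> h x \<in> H m) \<Longrightarrow> sum h S \<in> H m"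
  by (induction S rule: infinite_finite_induct) (auto simp: H_zero H_add)

lemma H_neg_if: "x \<in> H m \<Longrightarrow> neg_if p x \<in> H m"
  by (simp add: neg_if_def H_neg)

lemma koszul_d_square: "koszul_d (koszul_d f) \<alpha> J = 0"
proof -
  let ?T = "\<lambda>a b. wedge n (A a) (wedge n (A b) (f ((\<alpha>(a := Suc (\<alpha> a)))(b := Suc ((\<alpha>(a := Suc (\<alpha> a))) b))))) J"
  have "koszul_d (koszul_d f) \<alpha> J = (\<Sum>a<r. \<Sum>b<r. ?T a b)"
    unfolding koszul_d_def[abs_def] wedge_sum ..
  also have "\<dots> = (\<Sum>a<r. 0)"
  proof (rule double_sum_symmetric[OF torsion_free])
    fix a b
    have "(\<alpha>(a := Suc (\<alpha> a)))(b := Suc ((\<alpha>(a := Suc (\<alpha> a))) b)) = (\<alpha>(b := Suc (\<alpha> b)))(a := Suc ((\<alpha>(b := Suc (\<alpha> b))) a))"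
      by (auto simp: fun_eq_iff)
    then show "?T a b + ?T b a = (if a = b then 0 + 0 else 0)"
      using wedge_wedge[of n "A a" "A b"] by simp
  qed
  finally show ?thesis by simp
qed

text \<open>
  For \<open>b \<noteq> a\<close> the contraction against \<open>A a\<close> anticommutes with the product by \<open>A b\<close>, so that only the
  direction \<open>a\<close> contributes to the sum.
\<close>
lemma homotopy:
  assumes a: "a < r"
  shows "koszul_d (koszul_h a f) \<alpha> J + koszul_h a (koszul_d f) \<alpha> J = q * f \<alpha> J - koszul_pi a f \<alpha> J"
proof -
  let ?X = "\<lambda>b. if \<alpha> a = 0 then 0 else wedge n (A b) (contract n (A a) (f (\<alpha>(a := \<alpha> a - 1, b := Suc (\<alpha> b))))) J"
  have 1: "wedge n (A b) (koszul_h a f (\<alpha>(b := Suc (\<alpha> b)))) J = ?X b" if "b \<noteq> a" for b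
  proof -
    have "koszul_h a f (\<alpha>(b := Suc (\<alpha> b))) = (if \<alpha> a = 0 then (\<lambda>_. 0) else contract n (A a) (f (\<alpha>(a := \<alpha> a - 1, b := Suc (\<alpha> b)))))"
      using that by (auto simp: koszul_h_def fun_eq_iff fun_upd_twist)
    then show ?thesis by (simp add: wedge_linear wedge_zero)
  qed
  have "koszul_h a f (\<alpha>(a := Suc (\<alpha> a))) = contract n (A a) (f \<alpha>)" by (auto simp: koszul_h_def fun_eq_iff)
  then have 2: "koszul_d (koszul_h a f) \<alpha> J = wedge n (A a) (contract n (A a) (f \<alpha>)) J + (\<Sum>b\<in>{..<r} - {a}. ?X b)"
    unfolding koszul_d_def using a 1 by (subst sum.remove[of _ a]) auto
  have 3: "contract n (A a) (wedge n (A b) h) J = - wedge n (A b) (contract n (A a) h) J" if "b \<in> {..<r} - {a}" for b h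
    using wedge_contract[of n "A b" "A a" h J] orthogonal[of b a] that a by (simp add: add_eq_0_iff)
  have "koszul_h a (koszul_d f) \<alpha> J = (if \<alpha> a = 0 then 0 else contract n (A a) (wedge n (A a) (f \<alpha>)) J) - (\<Sum>b\<in>{..<r} - {a}. ?X b)"
  proof (cases "\<alpha> a = 0")
    case True then show ?thesis by (simp add: koszul_h_def)
  next
    case False
    let ?\<beta> = "\<alpha>(a := \<alpha> a - 1)"
    have "koszul_h a (koszul_d f) \<alpha> J = (\<Sum>b<r. contract n (A a) (wedge n (A b) (f (?\<beta>(b := Suc (?\<beta> b))))) J)"
      using False unfolding koszul_h_def koszul_d_def[abs_def] contract_sum by simp
    also have "\<dots> = contract n (A a) (wedge n (A a) (f \<alpha>)) J + (\<Sum>b\<in>{..<r} - {a}. - ?X b)"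
      using a False 3 by (subst sum.remove[of _ a]) (auto intro!: sum.cong)
    finally show ?thesis using False by (simp add: sum_negf)
  qed
  then have "koszul_d (koszul_h a f) \<alpha> J + koszul_h a (koszul_d f) \<alpha> J = wedge n (A a) (contract n (A a) (f \<alpha>)) J
      + contract n (A a) (wedge n (A a) (f \<alpha>)) J - koszul_pi a f \<alpha> J"
    unfolding 2 koszul_pi_def by (cases "\<alpha> a = 0") simp_all
  then show ?thesis
    using wedge_contract[of n "A a" "A a" "f \<alpha>" J] orthogonal[of a a] a by simp
qed

lemma koszul_d_linear: "koszul_d (f + h) = koszul_d f + koszul_d h" "koszul_d (\<lambda>\<alpha> J. x * f \<alpha> J) = (\<lambda>\<alpha> J. x * koszul_d f \<alpha> J)"
  by (auto simp: koszul_d_def fun_eq_iff wedge_linear sum.distrib sum_distrib_left)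

lemma koszul_d_zero: "koszul_d 0 = 0"
  by (simp add: koszul_d_def fun_eq_iff wedge_zero zero_fun_def)

lemma koszul_part_zero: "0 \<in> koszul_part m" and koszul_part_add: "f \<in> koszul_part m \<Longrightarrow> h \<in> koszul_part m \<Longrightarrow> f + h \<in> koszul_part m" and koszul_part_neg: "f \<in> koszul_part m \<Longrightarrow> - f \<in> koszul_part m"
  by (auto simp: koszul_part_def H_zero H_add H_neg) (metis add.left_neutral)

lemma koszul_d_part:
  assumes f: "f \<in> koszul_part m"
  shows "koszul_d f \<in> koszul_part (Suc m)"
  unfolding koszul_part_def
proof (intro CollectI allI conjI impI)
  fix \<alpha> J
  have fH: "f \<beta> L \<in> H m" for \<beta> L using f by (simp add: koszul_part_def)
  show "koszul_d f \<alpha> J \<in> H (Suc m)"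
    unfolding koszul_d_def wedge_def create_def signed_flip_def
    by (intro H_sum H_A) (auto simp: H_zero fH intro: H_neg_if)
  assume "koszul_d f \<alpha> J \<noteq> 0"
  then obtain a where a: "a < r" "wedge n (A a) (f (\<alpha>(a := Suc (\<alpha> a)))) J \<noteq> 0"
    unfolding koszul_d_def using sum.not_neutral_contains_not_neutral by blast
  from a(2) obtain j where j: "j < n" "j \<in> J" "f (\<alpha>(a := Suc (\<alpha> a))) (J - {j}) \<noteq> 0"
    by (rule wedge_nonzero)
  then have idx: "(\<alpha>(a := Suc (\<alpha> a)), J - {j}) \<in> koszul_basis" using f by (auto simp: koszul_part_def)
  then have J: "J \<subseteq> {..<n}" using j by (auto simp: koszul_basis_def)
  then have "card J = Suc (card (J - {j}))" using j(2) by (metis card_Suc_Diff1 finite_lessThan finite_subset)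
  moreover have "(\<Sum>b<r. (\<alpha>(a := Suc (\<alpha> a))) b) = Suc (\<Sum>b<r. \<alpha> b)"
    by (rule sum_upd_Suc[OF a(1)])
  ultimately show "(\<alpha>, J) \<in> koszul_basis" using idx J a(1) by (auto simp: koszul_basis_def split: if_splits)
qed

lemma koszul_h_part:
  assumes f: "f \<in> koszul_part m" and a: "a < r"
  shows "koszul_h a f \<in> koszul_part (Suc m)"
  unfolding koszul_part_def
proof (intro CollectI allI conjI impI)
  fix \<alpha> J
  have fH: "f \<beta> L \<in> H m" for \<beta> L using f by (simp add: koszul_part_def)
  have "contract n (A a) (f \<beta>) J \<in> H (Suc m)" for \<beta>
    unfolding contract_def annihilate_def signed_flip_def
    by (intro H_sum H_A a) (auto simp: H_zero fH intro: H_neg_if)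
  then show "koszul_h a f \<alpha> J \<in> H (Suc m)" by (simp add: koszul_h_def H_zero)
  assume "koszul_h a f \<alpha> J \<noteq> 0"
  then have \<alpha>: "\<alpha> a \<noteq> 0" "contract n (A a) (f (\<alpha>(a := \<alpha> a - 1))) J \<noteq> 0" by (auto simp: koszul_h_def split: if_splits)
  from \<alpha>(2) obtain j where j: "j < n" "j \<notin> J" "f (\<alpha>(a := \<alpha> a - 1)) (insert j J) \<noteq> 0"
    by (rule contract_nonzero)
  then have idx: "(\<alpha>(a := \<alpha> a - 1), insert j J) \<in> koszul_basis" using f by (auto simp: koszul_part_def)
  then have J: "J \<subseteq> {..<n}" by (auto simp: koszul_basis_def)
  then have "card (insert j J) = Suc (card J)" using j(2) by (simp add: finite_subset)
  moreover have "(\<Sum>b<r. \<alpha> b) = Suc (\<Sum>b<r. (\<alpha>(a := \<alpha> a - 1)) b)"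
    using sum_upd_Suc[OF a, of "\<alpha>(a := \<alpha> a - 1)"] \<alpha>(1) by simp
  ultimately show "(\<alpha>, J) \<in> koszul_basis" using idx J a by (auto simp: koszul_basis_def split: if_splits)
qed

text \<open>
  Over the ring with \<open>q\<close> inverted, this is, up to a power of \<open>q\<close>, the projection onto the exterior algebra
  of the orthogonal complement of the first \<open>k\<close> vectors.
\<close>
primrec proj :: "nat \<Rightarrow> (nat set \<Rightarrow> 'r) \<Rightarrow> nat set \<Rightarrow> 'r" where
  "proj 0 w = w"
| "proj (Suc k) w = contract n (A k) (wedge n (A k) (proj k w))"

lemma wedge_proj:
  assumes "b \<le> a" "a < r"
  shows "wedge n (A a) (proj b w) = proj b (wedge n (A a) w)"
  using assms(1)
proof (induction b)
  case (Suc b)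
  have 1: "wedge n (A a) (contract n (A b) h) = (\<lambda>J. - contract n (A b) (wedge n (A a) h) J)" for h
    using wedge_contract[of n "A a" "A b" h] orthogonal[of a b] assms(2) Suc.prems
    by (auto simp: fun_eq_iff eq_neg_iff_add_eq_0)
  have 2: "wedge n (A a) (wedge n (A b) h) = (\<lambda>J. - wedge n (A b) (wedge n (A a) h) J)" for h
    using wedge_wedge[of n "A a" "A b" h] by (auto simp: fun_eq_iff)
  have "contract n (A b) (\<lambda>J. - h J) = (\<lambda>J. - contract n (A b) h J)" for h
    by (simp add: fun_eq_iff contract_linear contract_zero)
  then show ?case using Suc by (simp add: 1 2)
qed simp

text \<open>
  The projection factors through the exterior product with the first \<open>k\<close> vectors, which is of exterior
  degree at least \<open>t + k > n\<close>.
\<close>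
lemma proj_zero:
  assumes "\<And>J. w J \<noteq> 0 \<Longrightarrow> J \<subseteq> {..<n} \<and> t \<le> card J" "t + k > n" "k \<le> r"
  shows "proj k w = (\<lambda>_. 0)"
  using assms
proof (induction k arbitrary: w t)
  case 0
  have "w J = 0" for J
    using 0(1)[of J] 0(2) card_mono[of "{..<n}" J] by fastforce
  then show ?case by (simp add: fun_eq_iff)
next
  case (Suc k)
  have "proj k (wedge n (A k) w) = (\<lambda>_. 0)"
  proof (rule Suc.IH)
    fix J assume "wedge n (A k) w J \<noteq> 0"
    then obtain j where j: "j < n" "j \<in> J" "w (J - {j}) \<noteq> 0" by (rule wedge_nonzero)
    then have *: "J - {j} \<subseteq> {..<n}" "t \<le> card (J - {j})" using Suc.prems(1)[of "J - {j}"] by auto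
    then have J: "J \<subseteq> {..<n}" using j by auto
    then have "card J = Suc (card (J - {j}))" using j(2) by (metis card_Suc_Diff1 finite_lessThan finite_subset)
    then show "J \<subseteq> {..<n} \<and> Suc t \<le> card J" using J * by simp
  qed (use Suc.prems in auto)
  then show ?case using wedge_proj[of k k w] Suc.prems by (simp add: contract_linear contract_zero)
qed

text \<open>
  On cycles, multiplication by \<open>q\<close> agrees with \<open>koszul_pi a\<close> modulo boundaries, for every \<open>a\<close>. Composing these
  for all \<open>a\<close> shows that \<open>q\<^sup>r\<close> agrees with the projection \<open>proj r\<close> on the part where \<open>\<alpha> = 0\<close>, and this
  vanishes for reasons of degree.
\<close>
lemma torsion:
  assumes z: "z \<in> koszul_part m" and dz: "koszul_d z = 0"
  shows "(\<lambda>\<alpha> J. q ^ r * z \<alpha> J) \<in> shift_image koszul_d koszul_part (m + 2 * r)"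
proof -
  define Z where "Z k = (\<lambda>\<alpha> J. if \<exists>a<k. \<alpha> a \<noteq> 0 then 0 else proj k (z \<alpha>) J)" for k
  have Z_Suc: "Z (Suc k) = koszul_pi k (Z k)" for k
  proof (intro ext)
    fix \<alpha> J
    show "Z (Suc k) \<alpha> J = koszul_pi k (Z k) \<alpha> J"
    proof (cases "\<exists>a<k. \<alpha> a \<noteq> 0")
      case True
      then have "Z k \<alpha> = (\<lambda>_. 0)" "Z (Suc k) \<alpha> J = 0" by (auto simp: Z_def fun_eq_iff less_Suc_eq)
      then show ?thesis by (simp add: koszul_pi_def wedge_zero contract_zero)
    next
      case False
      then have "Z k \<alpha> = proj k (z \<alpha>)" by (auto simp: Z_def fun_eq_iff)
      then show ?thesis using False by (auto simp: koszul_pi_def Z_def less_Suc_eq)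
    qed
  qed
  have main: "Z k \<in> koszul_part (m + 2 * k) \<and> koszul_d (Z k) = 0 \<and>
    (\<exists>w \<in> shift_image koszul_d koszul_part (m + 2 * k). (\<lambda>\<alpha> J. q ^ k * z \<alpha> J) = Z k + w)" if "k \<le> r" for k
    using that
  proof (induction k)
    case 0
    have "Z 0 = z" by (simp add: Z_def)
    moreover have "0 \<in> shift_image koszul_d koszul_part m"
      using koszul_part_zero koszul_d_linear(2)[of 0 "\<lambda>_ _. 0"] by (cases m) (auto simp: zero_fun_def intro!: image_eqI[of _ _ "\<lambda>_ _. 0"])
    ultimately show ?case using z dz by (auto intro!: bexI[of _ 0])
  next
    case (Suc k)
    then have "k \<le> r" by simp
    with Suc.IH obtain w where IH: "Z k \<in> koszul_part (m + 2 * k)" "koszul_d (Z k) = 0" "w \<in> shift_image koszul_d koszul_part (m + 2 * k)"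
      "(\<lambda>\<alpha> J. q ^ k * z \<alpha> J) = Z k + w" by blast
    have kr: "k < r" using Suc.prems by simp
    have sK: "koszul_h k (Z k) \<in> koszul_part (Suc (m + 2 * k))" by (rule koszul_h_part[OF IH(1) kr])
    have ks0: "koszul_h k 0 = 0" by (auto simp: koszul_h_def fun_eq_iff contract_linear contract_zero zero_fun_def)
    have eq: "koszul_d (koszul_h k (Z k)) \<alpha> J = q * Z k \<alpha> J - Z (Suc k) \<alpha> J" for \<alpha> J
      using homotopy[OF kr, of "Z k" \<alpha> J] by (simp add: IH(2) ks0 Z_Suc)
    have qK: "(\<lambda>\<alpha> J. q * f \<alpha> J) \<in> koszul_part (Suc (Suc l))" if "f \<in> koszul_part l" for f l
    proof -
      have "q * f \<alpha> J \<in> H (Suc (Suc l))" for \<alpha> J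
      proof -
        have "q * f \<alpha> J = (\<Sum>j<n. A k j * (A k j * f \<alpha> J))"
          using orthogonal[of k k] kr sum_distrib_right[of "\<lambda>j. A k j * A k j" "{..<n}" "f \<alpha> J"]
          by (simp add: mult.assoc)
        also have "\<dots> \<in> H (Suc (Suc l))" by (intro H_sum H_A kr) (use that in \<open>auto simp: koszul_part_def\<close>)
        finally show ?thesis .
      qed
      moreover have "q * f \<alpha> J \<noteq> 0 \<Longrightarrow> f \<alpha> J \<noteq> 0" for \<alpha> J by auto
      ultimately show ?thesis using that by (auto simp: koszul_part_def)
    qed
    have Z': "Z (Suc k) = (\<lambda>\<alpha> J. q * Z k \<alpha> J) + - koszul_d (koszul_h k (Z k))"
      by (simp add: fun_eq_iff eq)
    have "Z (Suc k) \<in> koszul_part (m + 2 * Suc k)"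
      unfolding Z' using koszul_part_add[OF qK[OF IH(1)] koszul_part_neg[OF koszul_d_part[OF sK]]] by simp
    moreover have "koszul_d (Z (Suc k)) = 0"
    proof -
      have "- koszul_d (koszul_h k (Z k)) = (\<lambda>\<alpha> J. (-1) * koszul_d (koszul_h k (Z k)) \<alpha> J)" by (simp add: fun_eq_iff)
      then have "koszul_d (- koszul_d (koszul_h k (Z k))) = (\<lambda>\<alpha> J. (-1) * koszul_d (koszul_d (koszul_h k (Z k))) \<alpha> J)" by (simp only: koszul_d_linear(2))
      then have "koszul_d (- koszul_d (koszul_h k (Z k))) = 0" by (simp add: koszul_d_square fun_eq_iff)
      then show ?thesis unfolding Z' koszul_d_linear(1) koszul_d_linear(2) by (simp add: IH(2) fun_eq_iff)
    qed
    moreover have "\<exists>w' \<in> shift_image koszul_d koszul_part (m + 2 * Suc k). (\<lambda>\<alpha> J. q ^ Suc k * z \<alpha> J) = Z (Suc k) + w'"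
    proof -
      obtain v where v: "v \<in> koszul_part (Suc (m + 2 * k))" "(\<lambda>\<alpha> J. q * w \<alpha> J) = koszul_d v"
      proof (cases "m + 2 * k")
        case 0
        then have "w = 0" using IH(3) by simp
        then have "(\<lambda>\<alpha> J. q * w \<alpha> J) = koszul_d 0" unfolding koszul_d_zero by (simp add: fun_eq_iff)
        then show ?thesis using that[OF koszul_part_zero] by blast
      next
        case (Suc l)
        then obtain v where v: "v \<in> koszul_part l" "w = koszul_d v" using IH(3) by auto
        then show ?thesis using that[of "\<lambda>\<alpha> J. q * v \<alpha> J"] qK[OF v(1)] Suc by (simp add: koszul_d_linear)
      qed
      have "(\<lambda>\<alpha> J. q ^ Suc k * z \<alpha> J) = Z (Suc k) + koszul_d (koszul_h k (Z k) + v)"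
      proof (intro ext)
        fix \<alpha> J
        have "q ^ Suc k * z \<alpha> J = q * (Z k \<alpha> J + w \<alpha> J)"
          using fun_cong[OF fun_cong[OF IH(4)], of \<alpha> J] by (simp add: mult.assoc)
        also have "\<dots> = q * Z k \<alpha> J + koszul_d v \<alpha> J"
          using fun_cong[OF fun_cong[OF v(2)], of \<alpha> J] by (simp add: distrib_left)
        finally show "q ^ Suc k * z \<alpha> J = (Z (Suc k) + koszul_d (koszul_h k (Z k) + v)) \<alpha> J"
          unfolding koszul_d_linear(1) by (simp add: eq)
      qed
      moreover have "koszul_h k (Z k) + v \<in> koszul_part (Suc (m + 2 * k))" by (rule koszul_part_add[OF sK v(1)])
      ultimately show ?thesis by (intro bexI[of _ "koszul_d (koszul_h k (Z k) + v)"]) auto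
    qed
    ultimately show ?case by blast
  qed
  have "Z r = 0"
  proof (intro ext)
    fix \<alpha> J
    show "Z r \<alpha> J = 0 \<alpha> J"
    proof (cases "\<exists>a<r. \<alpha> a \<noteq> 0")
      case False
      have "proj r (z \<alpha>) = (\<lambda>_. 0)"
      proof (rule proj_zero[where t = i])
        fix J assume "z \<alpha> J \<noteq> 0"
        then have "(\<alpha>, J) \<in> koszul_basis" using z by (auto simp: koszul_part_def)
        then show "J \<subseteq> {..<n} \<and> i \<le> card J" using False by (auto simp: koszul_basis_def)
      qed (use degrees in auto)
      then show ?thesis using False by (simp add: Z_def)
    qed (simp add: Z_def)
  qed
  then show ?thesis using main[of r] by auto
qed

end

section \<open>Counting monomials\<close>

definition compositions :: "nat \<Rightarrow> nat \<Rightarrow> (nat \<Rightarrow> nat) set"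
  where "compositions r k = {\<alpha>. (\<forall>a\<ge>r. \<alpha> a = 0) \<and> (\<Sum>a<r. \<alpha> a) = k}"

lemma bij_betw_compositions_lists:
  "bij_betw (\<lambda>\<alpha>. map \<alpha> [0..<r]) (compositions r k) {l. length l = r \<and> sum_list l = k}"
proof (rule bij_betw_byWitness[where f' = "\<lambda>l a. if a < r then l ! a else 0"])
  show "\<forall>\<alpha>\<in>compositions r k. (\<lambda>a. if a < r then map \<alpha> [0..<r] ! a else 0) = \<alpha>"
    by (auto simp: compositions_def fun_eq_iff)
  show "\<forall>l\<in>{l. length l = r \<and> sum_list l = k}. map (\<lambda>a. if a < r then l ! a else 0) [0..<r] = l"
    by (auto intro!: nth_equalityI)
  show "(\<lambda>\<alpha>. map \<alpha> [0..<r]) ` compositions r k \<subseteq> {l. length l = r \<and> sum_list l = k}"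
    by (auto simp: compositions_def sum_list_sum_nth atLeast0LessThan)
  show "(\<lambda>l a. if a < r then l ! a else 0) ` {l. length l = r \<and> sum_list l = k} \<subseteq> compositions r k"
    by (auto simp: compositions_def sum_list_sum_nth atLeast0LessThan)
qed

lemma finite_compositions: "finite (compositions r k)"
proof -
  have "{l. length l = r \<and> sum_list l = k} \<subseteq> {l. set l \<subseteq> {..k} \<and> length l = r}"
    using member_le_sum_list by fastforce
  then have "finite {l. length l = r \<and> sum_list l = k}"
    by (rule finite_subset) (simp add: finite_lists_length_eq)
  then show ?thesis using bij_betw_finite[OF bij_betw_compositions_lists] by blast
qed

lemma card_compositions: "card (compositions r k) = (k + r - 1) choose k"
  using bij_betw_same_card[OF bij_betw_compositions_lists] card_length_sum_list by metis

lemma sum_choose_mult: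
  assumes "i \<le> n"
  shows "(\<Sum>j\<le>i. (n choose j) * ((n - j) choose (i - j))) = 2 ^ i * (n choose i)"
proof -
  have "(\<Sum>j\<le>i. (n choose j) * ((n - j) choose (i - j))) = (\<Sum>j\<le>i. (n choose i) * (i choose j))"
    using assms by (intro sum.cong refl) (simp add: choose_mult)
  also have "\<dots> = (n choose i) * (\<Sum>j\<le>i. i choose j)" by (rule sum_distrib_left[symmetric])
  finally show ?thesis by (simp add: choose_row_sum mult.commute)
qed

text \<open>
  For \<open>r = n - i + 1\<close> the summand for sets of \<open>j\<close> elements is \<open>(n choose j) * ((n - j) choose (i - j))\<close>,
  which counts the pairs of a set of \<open>i\<close> elements and a subset of it with \<open>j\<close> elements.
\<close>
lemma card_compositions_subsets:
  assumes "i \<le> n" "r = n - i + 1"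
  shows "finite {(\<alpha>, J). (\<forall>a\<ge>r. \<alpha> a = 0) \<and> J \<subseteq> {..<n} \<and> (\<Sum>a<r. \<alpha> a) + card J = i}"
    and "card {(\<alpha>, J). (\<forall>a\<ge>r. \<alpha> a = 0) \<and> J \<subseteq> {..<n} \<and> (\<Sum>a<r. \<alpha> a) + card J = i} = 2 ^ i * (n choose i)"
proof -
  let ?koszul_basis = "{(\<alpha>, J). (\<forall>a\<ge>r. \<alpha> a = 0) \<and> J \<subseteq> {..<n} \<and> (\<Sum>a<r. \<alpha> a) + card J = i}"
  let ?F = "\<lambda>j. compositions r (i - j) \<times> {J. J \<subseteq> {..<n} \<and> card J = j}"
  have eq: "?koszul_basis = (\<Union>j\<in>{..i}. ?F j)" by (auto simp: compositions_def)
  have fin: "finite (?F j)" for j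
    using finite_compositions by (intro finite_cartesian_product) auto
  show "finite ?koszul_basis" unfolding eq using fin by blast
  have "card ?koszul_basis = (\<Sum>j\<le>i. card (?F j))"
    unfolding eq using fin by (intro card_UN_disjoint) auto
  also have "\<dots> = (\<Sum>j\<le>i. (n choose j) * ((n - j) choose (i - j)))"
  proof (intro sum.cong refl)
    fix j assume "j \<in> {..i}"
    then have "i - j + r - 1 = n - j" using assms by simp
    then show "card (?F j) = (n choose j) * ((n - j) choose (i - j))"
      using n_subsets[of "{..<n}" j] by (simp add: card_cartesian_product card_compositions)
  qed
  finally show "card ?koszul_basis = 2 ^ i * (n choose i)" using sum_choose_mult[OF assms(1)] by simp
qed

text \<open>
  A free module of rank \<open>C\<close> over the polynomial ring in \<open>s\<close> variables has the Hilbert series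
  \<open>C / (1 - t)\<^sup>s\<close>, with the value \<open>C / 2\<^sup>s\<close> at \<open>-1\<close>.
\<close>
lemma reg_sum_free_module:
  assumes "M \<ge> 1"
  shows "reg_sum s (\<lambda>m. (-1) ^ m * (C * int ((m + s - 1) choose m))) M = C"
  using assms
proof (induction s arbitrary: M)
  case 0
  have "partial_sum (\<lambda>m. (-1) ^ m * (C * int ((m + 0 - 1) choose m))) M = C" if "M \<ge> 1" for M
  proof -
    have "partial_sum (\<lambda>m. (-1) ^ m * (C * int ((m + 0 - 1) choose m))) M = (\<Sum>m\<in>{0}. (-1) ^ m * (C * int ((m - 1) choose m)))"
      unfolding partial_sum_def by (rule sum.mono_neutral_cong_right) (use that in auto)
    then show ?thesis by simp
  qed
  then show ?case using 0 by (simp add: reg_sum_def)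
next
  case (Suc s)
  let ?h = "\<lambda>s m. (-1) ^ m * (C * int ((m + s - 1) choose m))"
  have "pair_sum (partial_sum (?h (Suc s))) M = partial_sum (?h s) (Suc M)" for M
  proof (induction M)
    case 0 then show ?case by (simp add: pair_sum_def partial_sum_def)
  next
    case (Suc M)
    have "(M + Suc s choose Suc M) = (M + s choose M) + (M + s choose Suc M)" by simp
    then have "?h (Suc s) M + ?h (Suc s) (Suc M) = ?h s (Suc M)" by (simp add: algebra_simps)
    then show ?case using Suc by (simp add: pair_sum_def partial_sum_def)
  qed
  then have "pair_sum (partial_sum (?h (Suc s))) = (\<lambda>M. partial_sum (?h s) (Suc M))" by (simp add: fun_eq_iff)
  then have "reg_sum (Suc s) (?h (Suc s)) M = reg_sum s (?h s) (Suc M)"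
    by (simp only: reg_sum_def funpow_Suc_right o_apply pair_sum_pow_Suc[of s "partial_sum (?h s)"])
  then show ?case using Suc.IH[of "Suc M"] by simp
qed

section \<open>Polynomials in the second set of variables\<close>

type_synonym 'a ypoly = "(nat \<Rightarrow>\<^sub>0 nat) \<Rightarrow>\<^sub>0 'a"

definition Cst :: "'a::comm_ring_1 \<Rightarrow> 'a ypoly"
  where "Cst c = Poly_Mapping.single 0 c"

definition Var :: "nat \<Rightarrow> 'a::comm_ring_1 ypoly"
  where "Var b = Poly_Mapping.single (Poly_Mapping.single b 1) 1"

lemma Cst_simps: "Cst (a + b) = Cst a + Cst b" "Cst (a * b) = Cst a * Cst b" "Cst 1 = 1" "Cst 0 = 0"
  by (simp_all add: Cst_def single_add mult_single)

lemma lookup_Cst_mult: "Poly_Mapping.lookup (Cst c * p) \<mu> = c * Poly_Mapping.lookup p \<mu>"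
  unfolding Cst_def mult_map_scale_conv_mult[symmetric]
  by (simp add: Poly_Mapping.map.rep_eq when_def)

lemma poly_torsion_free:
  fixes p :: "'a::field ypoly"
  assumes "(2::'a) \<noteq> 0" "p + p = 0"
  shows "p = 0"
proof (rule poly_mapping_eqI)
  fix \<mu>
  have "2 * Poly_Mapping.lookup p \<mu> = Poly_Mapping.lookup (p + p) \<mu>" by (simp only: lookup_add mult_2)
  then show "Poly_Mapping.lookup p \<mu> = Poly_Mapping.lookup 0 \<mu>" using assms by simp
qed

definition Mon :: "nat \<Rightarrow> nat \<Rightarrow> (nat \<Rightarrow>\<^sub>0 nat) set"
  where "Mon s m = {\<mu>. Poly_Mapping.lookup \<mu> \<in> compositions s m}"

lemma bij_betw_Mon: "bij_betw Poly_Mapping.lookup (Mon s m) (compositions s m)"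
proof -
  have "\<alpha> \<in> Poly_Mapping.lookup ` Mon s m" if "\<alpha> \<in> compositions s m" for \<alpha>
  proof -
    have "\<forall>a\<ge>s. \<alpha> a = 0" using that unfolding compositions_def by blast
    then have "{x. \<alpha> x \<noteq> 0} \<subseteq> {..<s}" by (metis (mono_tags, lifting) lessThan_iff mem_Collect_eq not_less subsetI)
    then have "finite {x. \<alpha> x \<noteq> 0}" by (rule finite_subset) simp
    then have "Poly_Mapping.lookup (Abs_poly_mapping \<alpha>) = \<alpha>" by simp
    then show ?thesis using that by (intro image_eqI[of _ _ "Abs_poly_mapping \<alpha>"]) (simp_all add: Mon_def)
  qed
  then show ?thesis by (auto simp: bij_betw_def inj_on_def lookup_inject Mon_def)
qed

lemma finite_Mon: "finite (Mon s m)"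
  using bij_betw_finite[OF bij_betw_Mon] finite_compositions by blast

lemma card_Mon: "card (Mon s m) = (m + s - 1) choose m"
  using bij_betw_same_card[OF bij_betw_Mon] card_compositions by metis

lemma Mon_add_single:
  assumes "\<mu> \<in> Mon s m" "b < s"
  shows "Poly_Mapping.single b 1 + \<mu> \<in> Mon s (Suc m)"
proof -
  have "Poly_Mapping.lookup (Poly_Mapping.single b 1 + \<mu>)
      = (Poly_Mapping.lookup \<mu>)(b := Suc (Poly_Mapping.lookup \<mu> b))"
    by (auto simp: fun_eq_iff lookup_add lookup_single when_def)
  then show ?thesis using assms sum_upd_Suc[OF assms(2), of "Poly_Mapping.lookup \<mu>"]
    by (auto simp: Mon_def compositions_def)
qed

lemma Mon_Suc_cases:
  assumes "\<mu> \<in> Mon s (Suc m)"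
  obtains b \<nu> where "b < s" "\<nu> \<in> Mon s m" "\<mu> = Poly_Mapping.single b 1 + \<nu>"
proof -
  let ?l = "Poly_Mapping.lookup \<mu>"
  have l: "\<forall>a\<ge>s. ?l a = 0" "(\<Sum>a<s. ?l a) = Suc m" using assms by (auto simp: Mon_def compositions_def)
  then obtain b where b: "b < s" "?l b \<noteq> 0"
    using sum.not_neutral_contains_not_neutral[of ?l "{..<s}"] by auto
  define \<nu> where "\<nu> = \<mu> - Poly_Mapping.single b 1"
  have \<nu>: "Poly_Mapping.lookup \<nu> = ?l(b := ?l b - 1)"
    by (auto simp: fun_eq_iff \<nu>_def lookup_minus lookup_single when_def)
  have "\<mu> = Poly_Mapping.single b 1 + \<nu>"
    by (rule poly_mapping_eqI) (use b in \<open>auto simp: lookup_add lookup_single \<nu> when_def\<close>)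
  moreover have "\<nu> \<in> Mon s m"
    using l b sum_upd_Suc[OF b(1), of "?l(b := ?l b - 1)"] by (auto simp: Mon_def compositions_def \<nu>)
  ultimately show ?thesis using that b by blast
qed

definition Hom :: "nat \<Rightarrow> nat \<Rightarrow> 'a::comm_ring_1 ypoly set"
  where "Hom s m = {p. Poly_Mapping.keys p \<subseteq> Mon s m}"

lemma Hom_0: "0 \<in> Hom s m"
  by (simp add: Hom_def)

lemma Hom_add: "p \<in> Hom s m \<Longrightarrow> p' \<in> Hom s m \<Longrightarrow> p + p' \<in> Hom s m"
  using Poly_Mapping.keys_add[of p p'] by (auto simp: Hom_def)

lemma Hom_neg: "p \<in> Hom s m \<Longrightarrow> - p \<in> Hom s m"
  by (simp add: Hom_def)

lemma Hom_Cst_mult: "p \<in> Hom s m \<Longrightarrow> Cst c * p \<in> Hom s m"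
  by (auto simp: Hom_def in_keys_iff lookup_Cst_mult subset_iff) (metis mult_zero_right)

lemma Hom_Var_mult:
  assumes "p \<in> Hom s m" "b < s"
  shows "Var b * p \<in> Hom s (Suc m)"
proof -
  have "Poly_Mapping.keys (Var b * p) \<subseteq> {Poly_Mapping.single b 1 + \<mu> | \<mu>. \<mu> \<in> Poly_Mapping.keys p}"
    using Poly_Mapping.keys_mult[of "Var b" p] by (auto simp: Var_def split: if_splits)
  then show ?thesis using assms Mon_add_single[OF _ assms(2)] by (auto simp: Hom_def)
qed

lemma Hom_sum: "(\<And>x. x \<in> S \<Longrightarrow> h x \<in> Hom s m) \<Longrightarrow> sum h S \<in> Hom s m"
  by (induction S rule: infinite_finite_induct) (auto simp: Hom_0 Hom_add)

lemma sum_monomials: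
  assumes "finite S" "Poly_Mapping.keys p \<subseteq> S"
  shows "(\<Sum>\<mu>\<in>S. Poly_Mapping.single \<mu> (Poly_Mapping.lookup p \<mu>)) = p"
proof (rule poly_mapping_eqI)
  fix \<nu>
  have "Poly_Mapping.lookup (\<Sum>\<mu>\<in>S. Poly_Mapping.single \<mu> (Poly_Mapping.lookup p \<mu>)) \<nu>
      = (\<Sum>\<mu>\<in>S. if \<mu> = \<nu> then Poly_Mapping.lookup p \<nu> else 0)"
    by (simp add: lookup_sum lookup_single when_def cong: if_cong sum.cong)
  also have "\<dots> = Poly_Mapping.lookup p \<nu>" using assms by (auto simp: in_keys_iff)
  finally show "Poly_Mapping.lookup (\<Sum>\<mu>\<in>S. Poly_Mapping.single \<mu> (Poly_Mapping.lookup p \<mu>)) \<nu> = Poly_Mapping.lookup p \<nu>" .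
qed

lemma signed_flip_apply [simp]: "signed_flip P b f L \<alpha> J = neg_if (parity P L) (f (flip b L) \<alpha> J)"
  by (simp add: signed_flip_def neg_if_apply)

lemma flip_subset: "b < s \<Longrightarrow> flip b L \<subseteq> {..<s} \<Longrightarrow> L \<subseteq> {..<s}"
  by (auto simp: flip_def split: if_splits)

section \<open>The tensor product with an exterior algebra\<close>

text \<open>
  The first set indexes a basis of the exterior algebra that carries the Clifford action. The exponent and
  the second set index a basis of the Koszul complex.
\<close>
type_synonym 'a cochain = "nat set \<Rightarrow> (nat \<Rightarrow> nat) \<Rightarrow> nat set \<Rightarrow> 'a ypoly"

locale orthogonal_forms =
  fixes r n s i :: nat and coef :: "nat \<Rightarrow> nat \<Rightarrow> nat \<Rightarrow> 'k::field"
    and A :: "nat \<Rightarrow> nat \<Rightarrow> 'k ypoly" and q :: "'k ypoly"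
  defines "A a j \<equiv> \<Sum>b<s. Cst (coef a j b) * Var b"
    and "q \<equiv> \<Sum>b<s. Var b * Var b"
  assumes two_nonzero: "(2::'k) \<noteq> 0" and imaginary_unit: "\<exists>x::'k. x * x = -1"
    and forms_orthogonal: "a < r \<Longrightarrow> b < r \<Longrightarrow> (\<Sum>j<n. A a j * A b j) = (if a = b then q else 0)"
    and rn: "i \<le> n" "r = n - i + 1"
begin

sublocale koszul r n i A q "Hom s"
proof
  fix x x' :: "'k ypoly" and m a b j :: nat
  show "x + x = 0 \<Longrightarrow> x = 0" using poly_torsion_free[OF two_nonzero] .
  show "A a j * x \<in> Hom s (Suc m)" if "x \<in> Hom s m"
    unfolding A_def sum_distrib_right mult.assoc
    by (intro Hom_sum Hom_Cst_mult Hom_Var_mult) (use that in auto)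
  show "r + i > n" using rn by simp
qed (use forms_orthogonal Hom_0 Hom_add Hom_neg in auto)

definition scal :: "'k \<Rightarrow> 'k cochain \<Rightarrow> 'k cochain"
  where "scal x f L \<alpha> J = Cst x * f L \<alpha> J"

definition mult_var :: "nat \<Rightarrow> 'k cochain \<Rightarrow> 'k cochain"
  where "mult_var b f L \<alpha> J = Var b * f L \<alpha> J"

definition clifford :: "nat \<Rightarrow> 'k cochain \<Rightarrow> 'k cochain"
  where "clifford b = signed_flip (\<lambda>a. a < b) b"

text \<open>
  The index \<open>s\<close> stands for the sign of the exterior degree.
\<close>
definition commutant :: "nat \<Rightarrow> 'k cochain \<Rightarrow> 'k cochain"
  where "commutant j = (if j < s then signed_flip (\<lambda>a. j < a \<and> a < s) j
    else (\<lambda>f L. neg_if (parity (\<lambda>a. a < s) L) (f L)))"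

definition dirac :: "'k cochain \<Rightarrow> 'k cochain"
  where "dirac f L \<alpha> J = (\<Sum>b<s. Var b * clifford b f L \<alpha> J)"

definition differential :: "'k cochain \<Rightarrow> 'k cochain"
  where "differential f L = koszul_d (f L)"

definition W :: "nat \<Rightarrow> 'k cochain set"
  where "W m = {f. \<forall>L. f L \<in> koszul_part m \<and> (f L \<noteq> 0 \<longrightarrow> L \<subseteq> {..<s})}"

sublocale V: vspace scal
  by unfold_locales (auto simp: scal_def fun_eq_iff Cst_simps algebra_simps)

lemma clifford_anticommute:
  assumes "a \<noteq> b"
  shows "clifford a (clifford b f) = - clifford b (clifford a f)"
  unfolding clifford_def by (rule signed_flip_anticommute) (use assms in auto)

lemma clifford_square: "clifford b (clifford b f) = f"
  unfolding clifford_def by (rule signed_flip_involution) auto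

lemma Cst_neg_if: "Cst x * neg_if p (z::'k ypoly) = neg_if p (Cst x * z)"
  by (simp add: neg_if_def)

lemma clifford_linear: "V.linear_op (clifford b)"
  by (rule V.linear_opI) (auto simp: clifford_def fun_eq_iff scal_def neg_if_add Cst_neg_if)

lemma mult_var_linear: "V.linear_op (mult_var b)"
  by (rule V.linear_opI) (auto simp: mult_var_def fun_eq_iff scal_def algebra_simps)

lemma commutant_linear: "V.linear_op (commutant j)"
  by (rule V.linear_opI) (auto simp: commutant_def fun_eq_iff scal_def neg_if_add Cst_neg_if neg_if_apply)

lemma dirac_linear: "V.linear_op dirac"
  by (rule V.linear_opI)
    (auto simp: dirac_def clifford_def fun_eq_iff scal_def neg_if_add Cst_neg_if[symmetric] sum.distrib sum_distrib_left
      algebra_simps intro!: sum.cong)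

lemma differential_linear: "V.linear_op differential"
proof (rule V.linear_opI)
  show "differential (f + h) = differential f + differential h" for f h by (simp add: differential_def fun_eq_iff koszul_d_linear)
  fix x f
  have "scal x h L = (\<lambda>\<alpha> J. Cst x * h L \<alpha> J)" for h L by (simp add: scal_def fun_eq_iff)
  then have "koszul_d (scal x f L) = scal x (differential f) L" for L by (simp only: koszul_d_linear(2) differential_def)
  then show "differential (scal x f) = scal x (differential f)" by (simp add: differential_def fun_eq_iff)
qed

lemma signed_flip_dirac: "signed_flip P b (dirac f) L \<alpha> J = (\<Sum>a<s. Var a * signed_flip P b (clifford a f) L \<alpha> J)"
  by (simp add: dirac_def neg_if_sum neg_if_mult)

lemma dirac_clifford:
  assumes "b < s"
  shows "dirac (clifford b f) + clifford b (dirac f) = scal 2 (mult_var b f)"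
proof (intro ext)
  fix L \<alpha> J
  have *: "clifford a (clifford b f) L \<alpha> J + clifford b (clifford a f) L \<alpha> J = (if a = b then f L \<alpha> J + f L \<alpha> J else 0)" for a
    using clifford_anticommute[of a b f] by (auto simp: clifford_square)
  have "(dirac (clifford b f) + clifford b (dirac f)) L \<alpha> J
      = (\<Sum>a<s. Var a * (clifford a (clifford b f) L \<alpha> J + clifford b (clifford a f) L \<alpha> J))"
    unfolding plus_fun_apply clifford_def[of b] signed_flip_dirac by (simp add: dirac_def distrib_left sum.distrib)
  also have "\<dots> = (\<Sum>a<s. if a = b then Var b * (f L \<alpha> J + f L \<alpha> J) else 0)"
    unfolding * by (intro sum.cong) auto
  also have "\<dots> = Cst (1 + 1) * (Var b * f L \<alpha> J)"
    using assms unfolding Cst_simps by (simp add: algebra_simps)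
  finally show "(dirac (clifford b f) + clifford b (dirac f)) L \<alpha> J = scal 2 (mult_var b f) L \<alpha> J"
    by (simp add: scal_def mult_var_def)
qed

lemma dirac_square: "dirac (dirac f) L \<alpha> J = q * f L \<alpha> J"
proof -
  have "dirac (dirac f) L \<alpha> J = (\<Sum>a<s. \<Sum>b<s. Var a * (Var b * clifford a (clifford b f) L \<alpha> J))"
    unfolding dirac_def[of "dirac f"] clifford_def[of a for a] signed_flip_dirac by (simp add: sum_distrib_left clifford_def)
  also have "\<dots> = (\<Sum>a<s. Var a * (Var a * f L \<alpha> J))"
  proof (rule double_sum_symmetric[OF torsion_free])
    fix a b
    show "Var a * (Var b * clifford a (clifford b f) L \<alpha> J) + Var b * (Var a * clifford b (clifford a f) L \<alpha> J)
      = (if a = b then Var a * (Var a * f L \<alpha> J) + Var a * (Var a * f L \<alpha> J) else 0)"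
      using clifford_anticommute[of a b f] by (auto simp: clifford_square mult.left_commute)
  qed
  also have "\<dots> = q * f L \<alpha> J" by (simp add: q_def sum_distrib_right mult.assoc)
  finally show ?thesis .
qed

lemma dirac_funpow: "(dirac ^^ (2 * k)) f = (\<lambda>L \<alpha> J. q ^ k * f L \<alpha> J)"
  by (induction k) (auto simp: fun_eq_iff dirac_square mult.assoc)

lemma commutant_less: "j < s \<Longrightarrow> commutant j = signed_flip (\<lambda>a. j < a \<and> a < s) j"
  by (simp add: commutant_def)

lemma commutant_s: "commutant s f L = neg_if (parity (\<lambda>a. a < s) L) (f L)"
  by (simp add: commutant_def)

lemma signed_flip_commutant_s: "b < s \<Longrightarrow> signed_flip P b (commutant s f) = - commutant s (signed_flip P b f)"
  by (auto simp: fun_eq_iff commutant_s signed_flip_def neg_if_neg_if neg_if_apply parity_flip[OF fin_less] neg_if_def)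

lemma dirac_commutant: "(\<forall>f. dirac (commutant j f) = commutant j (dirac f)) \<or> (\<forall>f. dirac (commutant j f) = - commutant j (dirac f))" if "j < Suc s"
proof (cases "j < s")
  case True
  have "clifford a (commutant j f) = commutant j (clifford a f)" if "a < s" for a f
    unfolding clifford_def commutant_less[OF True] by (rule signed_flip_commute) (use that in auto)
  then have "dirac (commutant j f) L \<alpha> J = commutant j (dirac f) L \<alpha> J" for f L \<alpha> J
    unfolding commutant_less[OF True] signed_flip_dirac by (simp add: dirac_def del: signed_flip_apply)
  then show ?thesis by (auto simp: fun_eq_iff)
next
  case False
  then have j: "j = s" using that by simp
  have "clifford a (commutant s f) = - commutant s (clifford a f)" if "a < s" for a f
    unfolding clifford_def by (rule signed_flip_commutant_s[OF that])
  then have "dirac (commutant j f) L \<alpha> J = - commutant j (dirac f) L \<alpha> J" for f L \<alpha> J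
    by (simp add: j dirac_def commutant_s neg_if_apply neg_if_sum neg_if_mult sum_negf)
  then show ?thesis by (auto simp: fun_eq_iff)
qed

lemma commutant_involution: "commutant j (commutant j f) = f"
proof (cases "j < s")
  case True
  show ?thesis unfolding commutant_less[OF True] by (rule signed_flip_involution) auto
next
  case False then show ?thesis by (simp add: commutant_def neg_if_neg_if) (simp add: neg_if_def)
qed

lemma commutant_anticommute:
  assumes "j < Suc s" "l < Suc s" "j \<noteq> l"
  shows "commutant j (commutant l f) = - commutant l (commutant j f)"
proof -
  consider "j < s" "l < s" | "j < s" "l = s" | "j = s" "l < s" using assms by linarith
  then show ?thesis
  proof cases
    case 1
    show ?thesis unfolding commutant_less[OF 1(1)] commutant_less[OF 1(2)]
      by (rule signed_flip_anticommute) (use 1 assms(3) in auto)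
  next
    case 2 then show ?thesis using signed_flip_commutant_s[of j] by (simp add: commutant_less)
  next
    case 3 then show ?thesis using signed_flip_commutant_s[of l] by (simp add: commutant_less)
  qed
qed

lemma mult_var_commute: "mult_var a (mult_var b f) = mult_var b (mult_var a f)"
  by (simp add: mult_var_def fun_eq_iff mult.left_commute)

lemma clifford_mult_var: "clifford a (mult_var b f) = mult_var b (clifford a f)"
  by (simp add: mult_var_def clifford_def fun_eq_iff neg_if_mult)

lemma sum_fun_apply: "(sum F S) x = (\<Sum>t\<in>S. F t x)"
  by (induction S rule: infinite_finite_induct) auto

lemma dirac_eq_sum: "dirac f = (\<Sum>b<s. mult_var b (clifford b f))"
  by (simp add: fun_eq_iff sum_fun_apply dirac_def mult_var_def)

lemma dirac_mult_var: "dirac (mult_var b f) = mult_var b (dirac f)"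
proof (intro ext)
  fix L \<alpha> J
  have "dirac (mult_var b f) L \<alpha> J = (\<Sum>a<s. Var a * mult_var b (clifford a f) L \<alpha> J)" by (simp only: dirac_def clifford_mult_var)
  then show "dirac (mult_var b f) L \<alpha> J = mult_var b (dirac f) L \<alpha> J"
    by (simp add: mult_var_def dirac_def sum_distrib_left mult.left_commute)
qed

lemma is_dirac_module: "dirac_module scal mult_var s clifford commutant dirac"
proof (intro dirac_module.intro graded_ops.intro graded_ops_axioms.intro dirac_module_axioms.intro, goal_cases)
  case 1 show ?case by (rule V.vspace_axioms)
next
  case 2 show ?case by (rule mult_var_linear)
next
  case 3 show ?case by (rule mult_var_commute)
next
  case 4 show ?case by (rule two_nonzero)
next
  case 5 show ?case by (rule imaginary_unit)
next
  case 6 show ?case by (rule clifford_linear)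
next
  case 7 show ?case by (rule commutant_linear)
next
  case 8 show ?case by (rule dirac_linear)
next
  case 9 show ?case by (rule dirac_mult_var)
next
  case 10 then show ?case by (rule dirac_clifford)
next
  case 11 then show ?case by (rule dirac_commutant)
next
  case 12 show ?case by (rule commutant_involution)
next
  case 13 then show ?case by (rule commutant_anticommute)
qed

sublocale V: dirac_module scal mult_var s clifford commutant dirac
  by (rule is_dirac_module)

lemma koszul_part_mult:
  assumes "f \<in> koszul_part m" "\<And>z. z \<in> Hom s m \<Longrightarrow> x * z \<in> Hom s m'"
  shows "(\<lambda>\<alpha> J. x * f \<alpha> J) \<in> koszul_part m'"
  unfolding koszul_part_def
proof (intro CollectI allI conjI impI)
  fix \<alpha> J
  show "x * f \<alpha> J \<in> Hom s m'" using assms by (simp add: koszul_part_def)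
  assume "x * f \<alpha> J \<noteq> 0"
  then have "f \<alpha> J \<noteq> 0" by auto
  then show "(\<alpha>, J) \<in> koszul_basis" using assms(1) by (simp add: koszul_part_def)
qed

lemma W_subspace: "V.subspace (W m)"
proof (rule V.subspaceI)
  show "0 \<in> W m" using koszul_part_zero by (simp add: W_def)
  show "f + h \<in> W m" if "f \<in> W m" "h \<in> W m" for f h
  proof -
    have "L \<subseteq> {..<s}" if "f L + h L \<noteq> 0" for L
      using that \<open>f \<in> W m\<close> \<open>h \<in> W m\<close> unfolding W_def by (metis (mono_tags, lifting) add.right_neutral mem_Collect_eq)
    then show ?thesis using that koszul_part_add by (simp add: W_def)
  qed
  fix x f assume f: "f \<in> W m"
  have eq: "scal x f L = (\<lambda>\<alpha> J. Cst x * f L \<alpha> J)" for L by (simp add: scal_def fun_eq_iff)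
  have "L \<subseteq> {..<s}" if "scal x f L \<noteq> 0" for L
  proof -
    have "f L \<noteq> 0" using that eq[of L] by (auto simp: zero_fun_def)
    then show ?thesis using f by (simp add: W_def)
  qed
  moreover have "scal x f L \<in> koszul_part m" for L
    unfolding eq by (rule koszul_part_mult[OF _ Hom_Cst_mult]) (use f in \<open>simp_all add: W_def\<close>)
  ultimately show "scal x f \<in> W m" by (simp add: W_def)
qed

definition basis_idx :: "nat \<Rightarrow> (nat set \<times> ((nat \<Rightarrow> nat) \<times> nat set) \<times> (nat \<Rightarrow>\<^sub>0 nat)) set"
  where "basis_idx m = Pow {..<s} \<times> koszul_basis \<times> Mon s m"

definition basis_vec :: "nat set \<times> ((nat \<Rightarrow> nat) \<times> nat set) \<times> (nat \<Rightarrow>\<^sub>0 nat) \<Rightarrow> 'k cochain"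
  where "basis_vec t L \<alpha> J = (if L = fst t \<and> (\<alpha>, J) = fst (snd t) then Poly_Mapping.single (snd (snd t)) 1 else 0)"

definition coord :: "nat set \<times> ((nat \<Rightarrow> nat) \<times> nat set) \<times> (nat \<Rightarrow>\<^sub>0 nat) \<Rightarrow> 'k cochain \<Rightarrow> 'k"
  where "coord t f = Poly_Mapping.lookup (f (fst t) (fst (fst (snd t))) (snd (fst (snd t)))) (snd (snd t))"

lemma koszul_basis_card: "finite koszul_basis" "card koszul_basis = 2 ^ i * (n choose i)"
  unfolding koszul_basis_def by (fact card_compositions_subsets[OF rn])+

lemma card_basis_idx: "finite (basis_idx m)" "card (basis_idx m) = 2 ^ s * (2 ^ i * (n choose i)) * ((m + s - 1) choose m)"
  using koszul_basis_card finite_Mon by (auto simp: basis_idx_def card_cartesian_product card_Pow card_Mon mult.assoc)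

lemma basis_vec_W:
  assumes "t \<in> basis_idx m"
  shows "basis_vec t \<in> W m"
proof -
  have "basis_vec t L \<alpha> J \<in> Hom s m" for L \<alpha> J
    using assms by (auto simp: basis_vec_def Hom_def basis_idx_def split: if_splits)
  moreover have "basis_vec t L \<alpha> J \<noteq> 0 \<Longrightarrow> (\<alpha>, J) \<in> koszul_basis \<and> L \<subseteq> {..<s}" for L \<alpha> J
    using assms by (auto simp: basis_vec_def basis_idx_def split: if_splits)
  moreover have "basis_vec t L \<noteq> 0 \<Longrightarrow> \<exists>\<alpha> J. basis_vec t L \<alpha> J \<noteq> 0" for L
    by (auto simp: fun_eq_iff)
  ultimately show ?thesis by (auto simp: W_def koszul_part_def) blast
qed

lemma W_expand:
  assumes f: "f \<in> W m"
  shows "f = (\<Sum>t\<in>basis_idx m. scal (coord t f) (basis_vec t))"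
proof (intro ext)
  fix L \<alpha> J
  let ?p = "f L \<alpha> J"
  have p: "?p \<in> Hom s m" using f by (simp add: W_def koszul_part_def)
  have e: "scal (coord t f) (basis_vec t) L \<alpha> J = (if L = fst t \<and> (\<alpha>, J) = fst (snd t)
      then Poly_Mapping.single (snd (snd t)) (Poly_Mapping.lookup ?p (snd (snd t))) else 0)" for t
    by (cases t) (auto simp: scal_def coord_def basis_vec_def Cst_def mult_single)
  have "(\<Sum>t\<in>basis_idx m. scal (coord t f) (basis_vec t)) L \<alpha> J = (\<Sum>t\<in>basis_idx m. scal (coord t f) (basis_vec t) L \<alpha> J)"
    by (simp add: sum_fun_apply)
  also have "\<dots> = ?p"
  proof (cases "L \<subseteq> {..<s} \<and> (\<alpha>, J) \<in> koszul_basis")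
    case True
    have "(\<Sum>t\<in>basis_idx m. scal (coord t f) (basis_vec t) L \<alpha> J)
        = (\<Sum>t\<in>(\<lambda>\<mu>. (L, (\<alpha>, J), \<mu>)) ` Mon s m. scal (coord t f) (basis_vec t) L \<alpha> J)"
      by (rule sum.mono_neutral_right[OF card_basis_idx(1)]) (use True in \<open>auto simp: basis_idx_def e image_iff\<close>)
    also have "\<dots> = (\<Sum>\<mu>\<in>Mon s m. Poly_Mapping.single \<mu> (Poly_Mapping.lookup ?p \<mu>))"
      by (subst sum.reindex) (auto simp: inj_on_def e)
    also have "\<dots> = ?p" using sum_monomials[OF finite_Mon] p by (simp add: Hom_def)
    finally show ?thesis .
  next
    case False
    have "f L \<noteq> 0" if "?p \<noteq> 0" using that by (auto simp: fun_eq_iff)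
    then have "?p = 0" using False f by (auto simp: W_def koszul_part_def)
    moreover have "scal (coord t f) (basis_vec t) L \<alpha> J = 0" if "t \<in> basis_idx m" for t
      using that False by (auto simp: e basis_idx_def)
    ultimately show ?thesis by simp
  qed
  finally show "f L \<alpha> J = (\<Sum>t\<in>basis_idx m. scal (coord t f) (basis_vec t)) L \<alpha> J" by simp
qed

text \<open>
  The three factors count the sets \<open>L\<close>, the basis of the Koszul complex and the monomials of degree \<open>m\<close>.
\<close>
lemma W_dim: "V.fin_dim (W m)" "V.dim (W m) = 2 ^ s * (2 ^ i * (n choose i)) * ((m + s - 1) choose m)"
proof -
  have dual: "coord t (basis_vec t') = (if t = t' then 1 else 0)" for t t'
    by (cases t; cases t') (auto simp: coord_def basis_vec_def lookup_single when_def)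
  have coord_rules: "coord t 0 = 0" "coord t (x + y) = coord t x + coord t y" "coord t (scal c x) = c * coord t x" for t x y c
    by (simp_all add: coord_def lookup_add scal_def lookup_Cst_mult)
  note basis = V.dim_eq_card_dual_basis[of "W m" "basis_idx m" basis_vec coord, OF W_subspace card_basis_idx(1) basis_vec_W coord_rules dual W_expand]
  show "V.fin_dim (W m)" by (rule basis(1))
  show "V.dim (W m) = 2 ^ s * (2 ^ i * (n choose i)) * ((m + s - 1) choose m)"
    using basis(2) card_basis_idx(2) by simp
qed

lemma W_generated: "W (Suc m) \<subseteq> V.span (\<Union>b<s. mult_var b ` W m)"
proof
  fix f assume "f \<in> W (Suc m)"
  then have "f = (\<Sum>t\<in>basis_idx (Suc m). scal (coord t f) (basis_vec t))" by (rule W_expand)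
  also have "\<dots> \<in> V.span (\<Union>b<s. mult_var b ` W m)"
  proof (intro V.span_sum V.span_scale)
    fix t assume "t \<in> basis_idx (Suc m)"
    then obtain L x \<mu> where t: "t = (L, x, \<mu>)" "L \<subseteq> {..<s}" "x \<in> koszul_basis" "\<mu> \<in> Mon s (Suc m)" by (auto simp: basis_idx_def)
    obtain b \<nu> where b: "b < s" "\<nu> \<in> Mon s m" "\<mu> = Poly_Mapping.single b 1 + \<nu>"
      using t(4) by (rule Mon_Suc_cases)
    have "basis_vec t = mult_var b (basis_vec (L, x, \<nu>))"
      by (auto simp: t(1) b(3) fun_eq_iff basis_vec_def mult_var_def Var_def mult_single)
    moreover have "basis_vec (L, x, \<nu>) \<in> W m" by (rule basis_vec_W) (use t b in \<open>simp add: basis_idx_def\<close>)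
    ultimately show "basis_vec t \<in> V.span (\<Union>b<s. mult_var b ` W m)" using b(1) by (intro V.span_base) blast
  qed
  finally show "f \<in> V.span (\<Union>b<s. mult_var b ` W m)" .
qed

lemma koszul_d_neg: "koszul_d (- f) = - koszul_d f"
proof -
  have "- h = (\<lambda>\<alpha> J. (-1) * h \<alpha> J)" for h :: "(nat \<Rightarrow> nat) \<Rightarrow> nat set \<Rightarrow> 'k ypoly" by (simp add: fun_eq_iff)
  then show ?thesis by (simp only: koszul_d_linear(2))
qed

lemma koszul_d_neg_if: "koszul_d (neg_if p f) = neg_if p (koszul_d f)"
  by (simp add: neg_if_def koszul_d_neg)

lemma koszul_part_neg_if: "f \<in> koszul_part m \<Longrightarrow> neg_if p f \<in> koszul_part m"
  by (simp add: neg_if_def koszul_part_neg)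

lemma differential_signed_flip: "differential (signed_flip P b f) = signed_flip P b (differential f)"
  by (simp add: differential_def signed_flip_def koszul_d_neg_if fun_eq_iff)

lemma differential_mult_var: "differential (mult_var b f) = mult_var b (differential f)"
proof -
  have "mult_var b h L = (\<lambda>\<alpha> J. Var b * h L \<alpha> J)" for h L by (simp add: mult_var_def fun_eq_iff)
  then have "koszul_d (mult_var b f L) = mult_var b (differential f) L" for L by (simp only: koszul_d_linear(2) differential_def)
  then show ?thesis by (simp add: differential_def fun_eq_iff)
qed

lemma differential_dirac: "differential (dirac f) = dirac (differential f)"
proof -
  interpret l: Vector_Spaces.linear scal scal differential by (rule differential_linear)
  show ?thesis by (simp add: dirac_eq_sum l.sum differential_mult_var clifford_def differential_signed_flip)
qed

lemma mult_var_W: "b < s \<Longrightarrow> f \<in> W m \<Longrightarrow> mult_var b f \<in> W (Suc m)"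
proof -
  assume b: "b < s" and f: "f \<in> W m"
  have eq: "mult_var b f L = (\<lambda>\<alpha> J. Var b * f L \<alpha> J)" for L by (simp add: mult_var_def fun_eq_iff)
  have "L \<subseteq> {..<s}" if "mult_var b f L \<noteq> 0" for L
  proof -
    have "f L \<noteq> 0" using that eq[of L] by (auto simp: zero_fun_def)
    then show ?thesis using f by (simp add: W_def)
  qed
  moreover have "mult_var b f L \<in> koszul_part (Suc m)" for L
    unfolding eq by (rule koszul_part_mult[OF _ Hom_Var_mult[OF _ b]]) (use f in \<open>simp_all add: W_def\<close>)
  ultimately show "mult_var b f \<in> W (Suc m)" by (simp add: W_def)
qed

lemma signed_flip_W: "b < s \<Longrightarrow> f \<in> W m \<Longrightarrow> signed_flip P b f \<in> W m"
proof -
  assume b: "b < s" and f: "f \<in> W m"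
  have "L \<subseteq> {..<s}" if "signed_flip P b f L \<noteq> 0" for L
  proof -
    have "f (flip b L) \<noteq> 0" using that by (auto simp: signed_flip_def)
    then show ?thesis using f flip_subset[OF b, of L] by (simp add: W_def)
  qed
  then show ?thesis using f by (simp add: W_def signed_flip_def koszul_part_neg_if)
qed

lemma commutant_W: "j < Suc s \<Longrightarrow> f \<in> W m \<Longrightarrow> commutant j f \<in> W m"
proof (cases "j < s")
  case True
  assume "f \<in> W m"
  then show ?thesis unfolding commutant_less[OF True] by (rule signed_flip_W[OF True])
next
  case False
  assume f: "f \<in> W m"
  have "L \<subseteq> {..<s}" if "neg_if p (f L) \<noteq> 0" for L p
  proof -
    have "f L \<noteq> 0" using that by auto
    then show ?thesis using f by (simp add: W_def)
  qed
  then show ?thesis using f False by (simp add: W_def commutant_def koszul_part_neg_if)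
qed

lemma dirac_W: "f \<in> W m \<Longrightarrow> dirac f \<in> W (Suc m)"
  unfolding dirac_eq_sum clifford_def by (intro V.subspace_sum W_subspace mult_var_W signed_flip_W) auto

lemma differential_W: "f \<in> W m \<Longrightarrow> differential f \<in> W (Suc m)"
proof -
  assume f: "f \<in> W m"
  have "L \<subseteq> {..<s}" if "differential f L \<noteq> 0" for L
  proof -
    have "f L \<noteq> 0" using that koszul_d_zero by (auto simp: differential_def)
    then show ?thesis using f by (simp add: W_def)
  qed
  then show ?thesis using f by (simp add: W_def differential_def koszul_d_part)
qed

text \<open>
  The differential acts on each value \<open>z L\<close> separately, so a preimage can be chosen for each \<open>L\<close>; it is taken
  to be zero outside the index range.
\<close>
lemma homology_torsion:
  assumes z: "z \<in> W m" and dz: "differential z = 0"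
  shows "(dirac ^^ (2 * r)) z \<in> shift_image differential W (m + 2 * r)"
proof -
  have "koszul_d (z L) = 0" for L using dz by (simp add: differential_def fun_eq_iff)
  then have tor: "(\<lambda>\<alpha> J. q ^ r * z L \<alpha> J) \<in> shift_image koszul_d koszul_part (m + 2 * r)" for L
    using torsion[of "z L" m] z by (simp add: W_def)
  show ?thesis
  proof (cases "m + 2 * r")
    case 0
    then show ?thesis using tor unfolding dirac_funpow by (simp add: fun_eq_iff)
  next
    case (Suc l)
    have "\<exists>w. w \<in> koszul_part l \<and> koszul_d w = (\<lambda>\<alpha> J. q ^ r * z L \<alpha> J) \<and> (w \<noteq> 0 \<longrightarrow> L \<subseteq> {..<s})" for L
    proof (cases "L \<subseteq> {..<s}")
      case True
      obtain w where "w \<in> koszul_part l" "(\<lambda>\<alpha> J. q ^ r * z L \<alpha> J) = koszul_d w"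
        using tor[of L] unfolding Suc by auto
      then show ?thesis using True by auto
    next
      case False
      then have "z L = 0" using z by (auto simp: W_def)
      then have "(\<lambda>\<alpha> J. q ^ r * z L \<alpha> J) = 0" by (simp add: fun_eq_iff)
      then show ?thesis using koszul_d_zero koszul_part_zero by auto
    qed
    then obtain w where w: "\<And>L. w L \<in> koszul_part l" "\<And>L. koszul_d (w L) = (\<lambda>\<alpha> J. q ^ r * z L \<alpha> J)" "\<And>L. w L \<noteq> 0 \<longrightarrow> L \<subseteq> {..<s}"
      by metis
    have "w \<in> W l" using w(1,3) by (simp add: W_def)
    moreover have "(dirac ^^ (2 * r)) z = differential w" unfolding dirac_funpow by (simp add: differential_def w(2) fun_eq_iff)
    ultimately show ?thesis unfolding Suc by simp
  qed
qed

lemma is_dirac_complex: "dirac_complex scal mult_var s clifford commutant dirac differential W"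
proof (intro dirac_complex.intro dirac_complex_axioms.intro, goal_cases)
  case 1 show ?case by (rule is_dirac_module)
next
  case 2 show ?case by (rule differential_linear)
next
  case 3 show ?case by (rule differential_mult_var)
next
  case 4 show ?case unfolding clifford_def by (rule differential_signed_flip)
next
  case (5 b u)
  then show ?case
  proof (cases "b < s")
    case True then show ?thesis by (simp only: commutant_less differential_signed_flip)
  next
    case False then show ?thesis by (simp add: commutant_def differential_def koszul_d_neg_if fun_eq_iff)
  qed
next
  case 6 show ?case by (rule differential_dirac)
next
  case 7 show ?case by (simp add: differential_def koszul_d_square fun_eq_iff)
next
  case 8 show ?case
    unfolding V.dirac_submodule_def V.graded_submodule_def
    using W_subspace W_dim(1) mult_var_W commutant_W dirac_W signed_flip_W by (auto simp: clifford_def)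
next
  case 9 then show ?case by (rule differential_W)
next
  case 10 show ?case by (rule W_generated)
next
  case 11 show ?case using homology_torsion by blast
qed

sublocale V: dirac_complex scal mult_var s clifford commutant dirac differential W
  by (rule is_dirac_complex)

theorem rank_dvd: "2 ^ (Suc s div 2) dvd 2 ^ i * (n choose i)"
proof -
  let ?C = "2 ^ s * (2 ^ i * (n choose i))"
  obtain M0 where M0: "\<And>M. M \<ge> M0 \<Longrightarrow> 2 ^ (Suc s div 2 + s) dvd reg_sum s (V.sdim W) M"
    using V.reg_sum_dvd by blast
  have "V.sdim W = (\<lambda>m. (-1) ^ m * (int ?C * int ((m + s - 1) choose m)))"
    by (simp add: V.sdim_def W_dim(2) fun_eq_iff)
  then have "reg_sum s (V.sdim W) (Suc M0) = int ?C"
    using reg_sum_free_module[of "Suc M0" s "int ?C"] by simp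
  then have "int (2 ^ (Suc s div 2 + s)) dvd int ?C" using M0[of "Suc M0"] by simp
  then have "2 ^ s * 2 ^ (Suc s div 2) dvd ?C" by (simp only: int_dvd_int_iff power_add mult.commute)
  then show ?thesis by simp
qed

end

section \<open>From a formula to orthogonal vectors\<close>

definition mono_eval :: "('i \<Rightarrow> 'r) \<Rightarrow> ('i \<Rightarrow>\<^sub>0 nat) \<Rightarrow> 'r::comm_ring_1"
  where "mono_eval v \<mu> = (\<Prod>x\<in>Poly_Mapping.keys \<mu>. v x ^ Poly_Mapping.lookup \<mu> x)"

definition poly_eval :: "('c \<Rightarrow> 'r) \<Rightarrow> ('i \<Rightarrow> 'r) \<Rightarrow> (('i \<Rightarrow>\<^sub>0 nat) \<Rightarrow>\<^sub>0 'c::comm_ring_1) \<Rightarrow> 'r::comm_ring_1"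
  where "poly_eval \<phi> v p = (\<Sum>\<mu>\<in>Poly_Mapping.keys p. \<phi> (Poly_Mapping.lookup p \<mu>) * mono_eval v \<mu>)"

lemma mono_eval_superset:
  assumes "finite S" "Poly_Mapping.keys \<mu> \<subseteq> S"
  shows "mono_eval v \<mu> = (\<Prod>x\<in>S. v x ^ Poly_Mapping.lookup \<mu> x)"
  unfolding mono_eval_def
  by (rule prod.mono_neutral_left) (use assms in \<open>auto simp: in_keys_iff\<close>)

lemma mono_eval_add: "mono_eval v (\<mu> + \<nu>) = mono_eval v \<mu> * mono_eval v \<nu>"
proof -
  let ?S = "Poly_Mapping.keys \<mu> \<union> Poly_Mapping.keys \<nu>"
  have "mono_eval v (\<mu> + \<nu>) = (\<Prod>x\<in>?S. v x ^ Poly_Mapping.lookup (\<mu> + \<nu>) x)"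
    by (rule mono_eval_superset) (use Poly_Mapping.keys_add[of \<mu> \<nu>] in auto)
  also have "\<dots> = (\<Prod>x\<in>?S. v x ^ Poly_Mapping.lookup \<mu> x) * (\<Prod>x\<in>?S. v x ^ Poly_Mapping.lookup \<nu> x)"
    by (simp add: lookup_add power_add prod.distrib)
  also have "\<dots> = mono_eval v \<mu> * mono_eval v \<nu>"
    using mono_eval_superset[of ?S \<mu> v] mono_eval_superset[of ?S \<nu> v] by simp
  finally show ?thesis .
qed

lemma mono_eval_single: "mono_eval v (Poly_Mapping.single x k) = v x ^ k"
  by (cases "k = 0") (simp_all add: mono_eval_def)

locale coefficient_hom =
  fixes \<phi> :: "'c::comm_ring_1 \<Rightarrow> 'r::comm_ring_1"
  assumes \<phi>_add: "\<phi> (x + y) = \<phi> x + \<phi> y" and \<phi>_mult: "\<phi> (x * y) = \<phi> x * \<phi> y" and \<phi>_one: "\<phi> 1 = 1"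
begin

lemma \<phi>_zero: "\<phi> 0 = 0"
  using \<phi>_add[of 0 0] by simp

lemma poly_eval_single: "poly_eval \<phi> v (Poly_Mapping.single \<mu> c) = \<phi> c * mono_eval v \<mu>"
  by (cases "c = 0") (simp_all add: poly_eval_def \<phi>_zero)

lemma poly_eval_add: "poly_eval \<phi> v (p + p') = poly_eval \<phi> v p + poly_eval \<phi> v p'"
  unfolding poly_eval_def
  by (rule setsum_keys_plus_distrib) (simp_all add: \<phi>_zero \<phi>_add distrib_right)

lemma poly_eval_zero: "poly_eval \<phi> v 0 = 0"
  by (simp add: poly_eval_def)

lemma poly_eval_sum: "poly_eval \<phi> v (sum f S) = (\<Sum>x\<in>S. poly_eval \<phi> v (f x))"
  by (induction S rule: infinite_finite_induct) (simp_all add: poly_eval_zero poly_eval_add)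

lemma poly_eval_mult: "poly_eval \<phi> v (p * p') = poly_eval \<phi> v p * poly_eval \<phi> v p'"
proof -
  let ?m = "\<lambda>p \<mu>. Poly_Mapping.single \<mu> (Poly_Mapping.lookup p \<mu>)"
  have "p * p' = (\<Sum>\<mu>\<in>Poly_Mapping.keys p. ?m p \<mu>) * (\<Sum>\<nu>\<in>Poly_Mapping.keys p'. ?m p' \<nu>)"
    by (simp add: sum_monomials)
  also have "\<dots> = (\<Sum>\<mu>\<in>Poly_Mapping.keys p. \<Sum>\<nu>\<in>Poly_Mapping.keys p'.
      Poly_Mapping.single (\<mu> + \<nu>) (Poly_Mapping.lookup p \<mu> * Poly_Mapping.lookup p' \<nu>))"
    by (simp add: sum_product mult_single)
  finally show ?thesis
    by (simp add: poly_eval_sum poly_eval_single \<phi>_mult mono_eval_add)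
      (simp add: poly_eval_def sum_product mult_ac)
qed

lemma poly_eval_power2: "poly_eval \<phi> v (p\<^sup>2) = (poly_eval \<phi> v p)\<^sup>2"
  by (simp add: power2_eq_square poly_eval_mult)

end

lemma coefficient_hom_Cst_to_ac: "coefficient_hom (\<lambda>x::'a::field. Cst (to_ac x))"
  by unfold_locales (simp_all add: Cst_simps)

text \<open>
  Substituting \<open>x\<close> by a unit vector yields the products of a vector with itself. Substituting the sum of two
  unit vectors then yields twice the product of two different vectors.
\<close>
lemma formula_orthogonal:
  fixes c :: "nat \<Rightarrow> nat \<Rightarrow> nat \<Rightarrow> 'a::field" and s :: nat
  defines "A a j \<equiv> (\<Sum>b<s. Cst (to_ac (c (Suc j) (Suc a) (Suc b))) * Var b)"
    and "q \<equiv> (\<Sum>b<s. Var b * Var b)"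
  assumes formula: "sums_of_squares_formula r s n c" and two: "(2::'a alg_closure) \<noteq> 0"
    and a: "a < r" "a' < r"
  shows "(\<Sum>j<n. A a j * A a' j) = (if a = a' then q else 0)"
proof -
  define \<phi> where "\<phi> = (\<lambda>x::'a. Cst (to_ac x))"
  interpret coefficient_hom \<phi> unfolding \<phi>_def by (rule coefficient_hom_Cst_to_ac)
  have reindex: "(\<Sum>a = 1..k. f a) = (\<Sum>a<k. f (Suc a))" for k and f :: "nat \<Rightarrow> 'a alg_closure ypoly"
    by (simp add: sum.atLeast1_atMost_eq)
  have identity: "(\<Sum>a<r. (u a)\<^sup>2) * q = (\<Sum>j<n. (\<Sum>a<r. u a * A a j)\<^sup>2)" for u :: "nat \<Rightarrow> 'a alg_closure ypoly"
  proof -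
    define v where "v = case_sum (\<lambda>a. u (a - 1)) (\<lambda>b. Var (b - 1))"
    have var: "poly_eval \<phi> v (var_x a) = u (a - 1)" "poly_eval \<phi> v (var_y b) = Var (b - 1)"
      "poly_eval \<phi> v (const_poly x) = \<phi> x" for a b x
      by (simp_all add: var_x_def var_y_def const_poly_def poly_eval_single mono_eval_single \<phi>_one v_def)
        (simp add: mono_eval_def)
    have "poly_eval \<phi> v (bilinear_expr r s (c (Suc j))) = (\<Sum>a<r. u a * A a j)" for j
    proof -
      have "poly_eval \<phi> v (bilinear_expr r s (c (Suc j)))
          = (\<Sum>a = 1..r. \<Sum>b = 1..s. \<phi> (c (Suc j) a b) * u (a - 1) * Var (b - 1))"
        by (simp only: bilinear_expr_def poly_eval_sum poly_eval_mult var)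
      also have "\<dots> = (\<Sum>a<r. \<Sum>b<s. \<phi> (c (Suc j) (Suc a) (Suc b)) * u a * Var b)"
        by (simp only: reindex diff_Suc_1)
      also have "\<dots> = (\<Sum>a<r. u a * A a j)" by (simp add: A_def \<phi>_def sum_distrib_left mult_ac)
      finally show ?thesis .
    qed
    moreover have "poly_eval \<phi> v ((\<Sum>a = 1..r. (var_x a)\<^sup>2) * (\<Sum>b = 1..s. (var_y b)\<^sup>2))
        = poly_eval \<phi> v (\<Sum>j = 1..n. (bilinear_expr r s (c j))\<^sup>2)"
      using formula by (simp add: sums_of_squares_formula_def)
    ultimately show ?thesis
      by (simp only: poly_eval_sum poly_eval_mult poly_eval_power2 var reindex q_def power2_eq_square diff_Suc_1)
  qed
  have delta: "(\<Sum>a<r. (if a = b then 1 else 0) * f a) = f b" if "b < r" for b and f :: "nat \<Rightarrow> 'a alg_closure ypoly"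
    using that by (simp add: if_distrib[of "\<lambda>x. x * f _"] cong: if_cong)
  have diag: "(\<Sum>j<n. A b j * A b j) = q" if b: "b < r" for b
  proof -
    have "(\<Sum>a<r. (if a = b then 1 else 0 :: 'a alg_closure ypoly)\<^sup>2) = 1"
      using delta[OF b, of "\<lambda>a. if a = b then 1 else 0"] by (simp add: power2_eq_square)
    then show ?thesis using identity[of "\<lambda>a. if a = b then 1 else 0"] delta[OF b] by (simp add: power2_eq_square)
  qed
  show ?thesis
  proof (cases "a = a'")
    case True then show ?thesis using diag a by simp
  next
    case False
    let ?u = "\<lambda>x. (if x = a then 1 else 0) + (if x = a' then 1 else 0) :: 'a alg_closure ypoly"
    have lin: "(\<Sum>x<r. ?u x * f x) = f a + f a'" for f
      using delta a by (simp only: distrib_right sum.distrib)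
    have "(\<Sum>x<r. (?u x)\<^sup>2) = 2" using lin[of ?u] False by (simp add: power2_eq_square)
    then have "2 * q = (\<Sum>j<n. (A a j + A a' j)\<^sup>2)" using identity[of ?u] lin by simp
    also have "\<dots> = (\<Sum>j<n. A a j * A a j) + (\<Sum>j<n. A a' j * A a' j) + ((\<Sum>j<n. A a j * A a' j) + (\<Sum>j<n. A a j * A a' j))"
      unfolding sum.distrib[symmetric] by (intro sum.cong refl) (simp add: power2_eq_square algebra_simps)
    finally have "(\<Sum>j<n. A a j * A a' j) + (\<Sum>j<n. A a j * A a' j) = 0" using diag a by simp
    from poly_torsion_free[OF two this] show ?thesis using False by simp
  qed
qed

theorem theorem1p1:
  fixes r s n :: nat
  assumes "CHAR('a::field) \<noteq> 2"
    and "r > 0" and "s > 0" and "n > 0"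
    and "\<exists>c :: nat \<Rightarrow> nat \<Rightarrow> nat \<Rightarrow> 'a. sums_of_squares_formula r s n c"
  shows "\<forall>i::nat. int n - int r < int i \<and> i \<le> (s - 1) div 2 \<longrightarrow>
    2 ^ ((s - 1) div 2 - i + 1) dvd (n choose i)"
proof (intro allI impI)
  fix i :: nat
  assume i: "int n - int r < int i \<and> i \<le> (s - 1) div 2"
  obtain c :: "nat \<Rightarrow> nat \<Rightarrow> nat \<Rightarrow> 'a" where c: "sums_of_squares_formula r s n c" using assms(5) by blast
  have two: "(2::'a alg_closure) \<noteq> 0"
  proof
    assume "(2::'a alg_closure) = 0"
    then have "to_ac (2::'a) = to_ac 0" by simp
    then have "(2::'a) = 0" by (simp only: to_ac_eq_iff)
    then have "of_nat 2 = (0::'a)" by simp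
    then have "CHAR('a) dvd 2" by (simp only: of_nat_eq_0_iff_char_dvd)
    then have "CHAR('a) = 1" using assms(1) prime_nat_iff[of 2] two_is_prime_nat by blast
    then show False using CHAR_not_1' by simp
  qed
  obtain x :: "'a alg_closure" where x: "x ^ 2 = -1"
    using nth_root_exists[of 2 "-1 :: 'a alg_closure"] by auto
  show "2 ^ ((s - 1) div 2 - i + 1) dvd (n choose i)"
  proof (cases "i \<le> n")
    case False then show ?thesis by (simp add: binomial_eq_0)
  next
    case True
    have nr: "n - i < r" using i True by linarith
    interpret orthogonal_forms "n - i + 1" n s i "\<lambda>a j b. to_ac (c (Suc j) (Suc a) (Suc b))"
      "\<lambda>a j. \<Sum>b<s. Cst (to_ac (c (Suc j) (Suc a) (Suc b))) * Var b" "\<Sum>b<s. Var b * Var b"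
    proof (unfold_locales, goal_cases)
      case 2 then show ?case using x by (auto simp: power2_eq_square)
    next
      case (3 a b)
      then show ?case using nr by (intro formula_orthogonal[OF c two]) simp_all
    qed (use two True in auto)
    have "Suc s div 2 = (s - 1) div 2 + 1" using assms(3) by (cases s) simp_all
    then have e: "Suc s div 2 = i + ((s - 1) div 2 - i + 1)" using i by simp
    have "2 ^ i * 2 ^ ((s - 1) div 2 - i + 1) dvd 2 ^ i * (n choose i)"
      using rank_dvd by (simp only: e power_add mult.commute)
    then show ?thesis by simp
  qed
qed

end
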